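(* Let $s(e,t)$ be the entropy density of simple graphs with edge density $e$ and triangle density $t$, and let $R$ be the set of achievable asymptotic density pairs (both defined in the context). For every $e\in(0,1)$ there exists a constant $c=c(e)>0$ such that for all $t$ with $(e,t)$ in the interior of $R$, $$s(e,e^3)-s(e,t)\ \ge\ c\,|t-e^3| .$$ Therefore, for fixed $e\in(0,1)$, the function $t\mapsto s(e,t)$ (on the set of $t$ with $(e,t)$ in the interior of $R$) attains its maximum at $t=e^3$ but is not differentiable there. Moreover, for every $e\in(0,1)$ there exists $\tilde c=\tilde c(e)>0$ such that for all $t<e^3$ with $(e,t)$ in the interior of $R$ the stronger inequality $$s(e,e^3)-s(e,t)\ \ge\ \tilde c\,|t-e^3|^{2/3}$$ holds.
   Context: Let $\hat G^n$ be the set of simple graphs $G$ (undirected, no multiple edges, no loops) with $n$ labeled vertices, edge set $E(G)$ and set of triangles $T(G)$. The edge and triangle densities are $e(G)=|E(G)|/\binom n2$ and $t(G)=|T(G)|/\binom n3$. For $\alpha>0$ let $Z^{n,\alpha}_{e,t}$ be the number of graphs $G\in\hat G^n$ with $e(G)\in(e-\alpha,e+\alpha)$ and $t(G)\in(t-\alpha,t+\alpha)$. The entropy density is $$s(e,t)=\lim_{\alpha\downarrow 0}\ \lim_{n\to\infty}\frac{\ln Z^{n,\alpha}_{e,t}}{n^2};$$ these limits are known to exist for $(e,t)\in R$. $R\subset[0,1]^2$ denotes the compact set of accumulation points of the pairs $(e(G),t(G))$, $G\in\bigcup_{n}\hat G^n$. It is bounded above by the curve $t=e^{3/2}$, $0\le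 e\le 1$, and below by the segment $t=0$, $0\le e\le 1/2$, together with a certain scalloped curve $t=h(e)$, $1/2\le e\le 1$, which lies above the curve $t=e(2e-1)$ and meets it at $e=k/(k+1)$, $k\ge1$. *)

theory Defs
  imports "HOL-Analysis.Analysis" "HOL-Library.Ramsey"
begin

text \<open>A simple graph with vertex set \<open>{..<n}\<close> is represented by its set of edges, each edge
  being a two-element set of vertices; \<open>nsets A k\<close> is the set of \<open>k\<close>-element subsets of \<open>A\<close>.\<close>

definition simple_graphs :: "nat \<Rightarrow> nat set set set" where
  "simple_graphs n = Pow (nsets {..<n} 2)"

definition triangles :: "nat \<Rightarrow> nat set set \<Rightarrow> nat set set" where
  "triangles n E = {T \<in> nsets {..<n} 3. nsets T 2 \<subseteq> E}"

definition edge_density :: "nat \<Rightarrow> nat set set \<Rightarrow> real" where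
  "edge_density n E = real (card E) / real (n choose 2)"

definition triangle_density :: "nat \<Rightarrow> nat set set \<Rightarrow> real" where
  "triangle_density n E = real (card (triangles n E)) / real (n choose 3)"

definition num_graphs :: "nat \<Rightarrow> real \<Rightarrow> real \<Rightarrow> real \<Rightarrow> nat" where
  "num_graphs n \<alpha> e t =
     card {E \<in> simple_graphs n. edge_density n E \<in> {e - \<alpha><..<e + \<alpha>}
                              \<and> triangle_density n E \<in> {t - \<alpha><..<t + \<alpha>}}"

text \<open>For \<open>n < 3\<close> a denominator vanishes and the quotient is \<open>0\<close>; this contributes only finitely
  many points and so does not affect the accumulation points.\<close>

definition achievable :: "(real \<times> real) set" where
  "achievable =
     {p. p islimpt (\<Union>n. (\<lambda>E. (edge_density n E, triangle_density n E)) ` simple_graphs n)}"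

definition log_count :: "real \<Rightarrow> real \<Rightarrow> real \<Rightarrow> nat \<Rightarrow> real" where
  "log_count e t \<alpha> n = ln (real (num_graphs n \<alpha> e t)) / (real n)\<^sup>2"

text \<open>The iterated limit of \<open>log_count e t \<alpha> n\<close>, first as \<open>n \<rightarrow> \<infinity>\<close>, then as \<open>\<alpha> \<down> 0\<close>. The large deviation
  principle behind its existence bounds the limit inferior and the limit superior over \<open>n\<close> by
  entropies of the open and the closed window, which might differ for exceptional values of
  \<open>\<alpha>\<close>; hence the two are required to have the same limit as \<open>\<alpha> \<down> 0\<close>, rather than to agree for every
  single \<open>\<alpha>\<close>. Where the inner limits do exist this is the literal iterated limit; see
  \<open>entropy_density_eq_iterated_limit\<close> below. The Isabelle convention \<open>ln 0 = 0\<close> is harmless on the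
  achievable region, where \<open>num_graphs n \<alpha> e t\<close> is positive for all large \<open>n\<close>.\<close>

definition has_entropy_density :: "real \<Rightarrow> real \<Rightarrow> real \<Rightarrow> bool" where
  "has_entropy_density e t s \<longleftrightarrow>
     ((\<lambda>\<alpha>. liminf (\<lambda>n. ereal (log_count e t \<alpha> n))) \<longlongrightarrow> ereal s) (at_right 0) \<and>
     ((\<lambda>\<alpha>. limsup (\<lambda>n. ereal (log_count e t \<alpha> n))) \<longlongrightarrow> ereal s) (at_right 0)"

definition entropy_density :: "real \<Rightarrow> real \<Rightarrow> real" where
  "entropy_density e t = (THE s. has_entropy_density e t s)"

lemma entropy_density_eqI:
  assumes "has_entropy_density e t s"
  shows "entropy_density e t = s"
  unfolding entropy_density_def
proof (rule the_equality)
  show "has_entropy_density e t s" by (fact assms)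
next
  fix s' assume "has_entropy_density e t s'"
  with assms have "ereal s' = ereal s"
    unfolding has_entropy_density_def
    using tendsto_unique[OF trivial_limit_at_right_real] by metis
  then show "s' = s" by simp
qed

lemma entropy_density_eq_iterated_limit:
  assumes inner: "\<forall>\<^sub>F \<alpha> in at_right 0. log_count e t \<alpha> \<longlonglongrightarrow> F \<alpha>"
    and outer: "(F \<longlongrightarrow> s) (at_right 0)"
  shows "entropy_density e t = s"
proof (rule entropy_density_eqI)
  have *: "\<forall>\<^sub>F \<alpha> in at_right 0. ereal (F \<alpha>) = liminf (\<lambda>n. ereal (log_count e t \<alpha> n))
                            \<and> ereal (F \<alpha>) = limsup (\<lambda>n. ereal (log_count e t \<alpha> n))"
    using inner
  proof eventually_elim
    case (elim \<alpha>)
    then have "(\<lambda>n. ereal (log_count e t \<alpha> n)) \<longlonglongrightarrow> ereal (F \<alpha>)" by simp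
    from lim_imp_Liminf[OF sequentially_bot this] lim_imp_Limsup[OF sequentially_bot this]
    show ?case by simp
  qed
  have "((\<lambda>\<alpha>. ereal (F \<alpha>)) \<longlongrightarrow> ereal s) (at_right 0)"
    using outer by simp
  from Lim_transform_eventually[OF this eventually_mono[OF * conjunct1]]
    Lim_transform_eventually[OF this eventually_mono[OF * conjunct2]]
  show "has_entropy_density e t s"
    unfolding has_entropy_density_def by (rule conjI)
qed

end

theory Submission
  imports Defs "HOL-Real_Asymp.Real_Asymp"
begin

text \<open>The lower bound \<open>s(e, e\<^sup>3) \<ge> h(e)/2\<close>, where \<open>h\<close> is the binary entropy, comes from the
  random graph with edge probability \<open>e\<close>. For the upper bound, replace a graph by a symmetric matrix
  \<open>a\<close> of edge probabilities with the same densities and write \<open>a = e + d\<close>. As \<open>h'' \<le> -4\<close>, the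
  entropy is at most \<open>h(e)/2 - y\<close> with \<open>y\<close> the mean of \<open>d\<^sup>2\<close> (up to a multiple of the mean of \<open>d\<close>,
  which vanishes in the limit), while \<open>t - e\<^sup>3\<close> is \<open>3e\<close> times the mean squared row average of \<open>d\<close>,
  which lies in \<open>[0, y]\<close>, plus the normalised trace of \<open>d\<^sup>3\<close>, which is at most \<open>y powr (3/2)\<close> in
  absolute value. Hence \<open>\<bar>t - e\<^sup>3\<bar> \<le> 4y\<close>, and \<open>e\<^sup>3 - t \<le> y powr (3/2)\<close>.

  Existence of the limits that define \<open>s\<close>, and the passage from graphs to matrices, avoid graph limit
  theory: a large class of graphs in a density window contains a subclass of almost the same
  entropy in which the edges of most triangles are nearly uncorrelated, so that the matrix of edge
  frequencies of the subclass has the right triangle density. Conversely, inhomogeneous random graphs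
  concentrate, so such a matrix yields many graphs, of any larger order after a blow-up.\<close>

section \<open>Homomorphism densities\<close>

text \<open>Subadditivity of entropy bounds the logarithm of the size of a class of graphs by the
  entropies of its edge frequencies, but the frequencies need not reproduce the triangle density of
  the class. The balanced complete bipartite graphs, over all bipartitions, have no triangles, yet
  every edge has frequency near 1/2, which predicts triangle density near 1/8. Correlation between
  edges is the obstacle; it is removed by fixing the edges at boundedly many vertices. Each passage
  between graphs and matrices costs an arbitrarily small amount of window width and of entropy. This
  is harmless because the width tends to 0 last: it suffices to compare the upper rate at one width
  with the lower rate at any larger width. The exponent 2/3 is confined to \<open>t < e^3\<close>
  because the quadratic term of the triangle density has a sign, so that only the cubic term can
  lower \<open>t\<close>.\<close>

definition edge_matrix :: "(nat set \<Rightarrow> real) \<Rightarrow> nat \<Rightarrow> nat \<Rightarrow> real" where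
  "edge_matrix w i j = (if i = j then 0 else w {i, j})"

text \<open>Averages over all ordered tuples, repeated vertices included. With this normalisation
  densities scale exactly under blow-ups; against the graph densities it costs an error
  O(1/n).\<close>

definition hom_edge :: "nat \<Rightarrow> (nat \<Rightarrow> nat \<Rightarrow> real) \<Rightarrow> real" where
  "hom_edge n a = (\<Sum>i<n. \<Sum>j<n. a i j) / real n ^ 2"

definition hom_tri :: "nat \<Rightarrow> (nat \<Rightarrow> nat \<Rightarrow> real) \<Rightarrow> real" where
  "hom_tri n a = (\<Sum>i<n. \<Sum>j<n. \<Sum>k<n. a i j * a i k * a j k) / real n ^ 3"

abbreviation adjacency :: "nat set set \<Rightarrow> nat \<Rightarrow> nat \<Rightarrow> real" where
  "adjacency E \<equiv> edge_matrix (\<lambda>x. of_bool (x \<in> E))"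

lemma nsets_Suc_lessThan:
  "nsets {..<Suc n} (Suc k) = nsets {..<n} (Suc k) \<union> insert n ` nsets {..<n} k"
proof (intro equalityI subsetI)
  fix S assume S: "S \<in> nsets {..<Suc n} (Suc k)"
  show "S \<in> nsets {..<n} (Suc k) \<union> insert n ` nsets {..<n} k"
  proof (cases "n \<in> S")
    case True
    then have "S = insert n (S - {n})" "S - {n} \<in> nsets {..<n} k"
      using S by (auto simp: nsets_def less_Suc_eq)
    then show ?thesis by blast
  next
    case False
    then show ?thesis using S by (auto simp: nsets_def less_Suc_eq)
  qed
next
  fix S assume "S \<in> nsets {..<n} (Suc k) \<union> insert n ` nsets {..<n} k"
  then show "S \<in> nsets {..<Suc n} (Suc k)"
    by (auto simp: nsets_def less_Suc_eq subset_iff card_insert_if)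
qed

lemma sum_nsets_Suc_lessThan:
  fixes g :: "nat set \<Rightarrow> real"
  shows "sum g (nsets {..<Suc n} (Suc k)) =
    sum g (nsets {..<n} (Suc k)) + (\<Sum>S\<in>nsets {..<n} k. g (insert n S))"
proof -
  have inj: "inj_on (insert n) (nsets {..<n} k)"
    by (auto simp: inj_on_def nsets_def subset_iff)
  have "sum g (nsets {..<Suc n} (Suc k)) =
      sum g (nsets {..<n} (Suc k)) + sum g (insert n ` nsets {..<n} k)"
    unfolding nsets_Suc_lessThan
    by (rule sum.union_disjoint) (auto simp: finite_imp_finite_nsets nsets_def)
  then show ?thesis by (simp add: sum.reindex[OF inj])
qed

lemma sum_nsets_1: "(\<Sum>S\<in>nsets {..<n} 1. g S) = (\<Sum>i<n. g {i})" for g :: "nat set \<Rightarrow> real"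
proof -
  have "nsets {..<n} 1 = (\<lambda>i. {i}) ` {..<n}"
    by (auto simp: nsets_def card_1_singleton_iff)
  then show ?thesis by (simp add: sum.reindex inj_on_def)
qed

lemma sum_nsets_2:
  "(\<Sum>i<n. \<Sum>j<n. edge_matrix g i j) = 2 * (\<Sum>S\<in>nsets {..<n} 2. g S)"
proof (induction n)
  case 0
  then show ?case by (simp add: nsets_empty_iff)
next
  case (Suc n)
  have "(\<Sum>i<Suc n. \<Sum>j<Suc n. edge_matrix g i j) =
      (\<Sum>i<n. \<Sum>j<n. edge_matrix g i j) + (\<Sum>i<n. edge_matrix g i n) + (\<Sum>j<n. edge_matrix g n j)"
    by (simp add: sum.distrib edge_matrix_def)
  also have "(\<Sum>i<n. edge_matrix g i n) = (\<Sum>i<n. g {n, i})"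
    by (rule sum.cong) (auto simp: edge_matrix_def insert_commute)
  also have "(\<Sum>j<n. edge_matrix g n j) = (\<Sum>i<n. g {n, i})"
    by (rule sum.cong) (auto simp: edge_matrix_def)
  finally show ?case
    using Suc sum_nsets_Suc_lessThan[of g n 1] sum_nsets_1[of "\<lambda>S. g (insert n S)" n]
    by (simp add: numeral_2_eq_2)
qed

text \<open>Induction on \<open>n\<close>: an ordered triple of distinct vertices that contains the
  new vertex has it in one of three positions, and each position yields the ordered sum over pairs,
  which counts every pair twice; 6 = 3 * 2.\<close>

lemma sum_nsets_3:
  fixes g :: "nat set \<Rightarrow> real"
  shows "(\<Sum>i<n. \<Sum>j<n. \<Sum>k<n. if i = j \<or> i = k \<or> j = k then 0 else g {i, j, k}) =
    6 * (\<Sum>S\<in>nsets {..<n} 3. g S)"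
proof (induction n)
  case 0
  then show ?case by (simp add: nsets_empty_iff)
next
  case (Suc n)
  define f where "f i j k = (if i = j \<or> i = k \<or> j = k then 0 else g {i, j, k})" for i j k
  define b where "b = edge_matrix (\<lambda>S. g (insert n S))"
  have "(\<Sum>i<Suc n. \<Sum>j<Suc n. \<Sum>k<Suc n. f i j k) =
      (\<Sum>i<n. \<Sum>j<n. \<Sum>k<n. f i j k) + (\<Sum>i<n. \<Sum>j<n. f i j n)
       + (\<Sum>i<n. \<Sum>j<n. f i n j) + (\<Sum>i<n. \<Sum>j<n. f n i j)"
    by (simp add: sum.distrib f_def)
  also have "(\<Sum>i<n. \<Sum>j<n. f i j n) = (\<Sum>i<n. \<Sum>j<n. b i j)"
    by (intro sum.cong) (auto simp: f_def b_def edge_matrix_def insert_commute)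
  also have "(\<Sum>i<n. \<Sum>j<n. f i n j) = (\<Sum>i<n. \<Sum>j<n. b i j)"
    by (intro sum.cong) (auto simp: f_def b_def edge_matrix_def insert_commute)
  also have "(\<Sum>i<n. \<Sum>j<n. f n i j) = (\<Sum>i<n. \<Sum>j<n. b i j)"
    by (intro sum.cong) (auto simp: f_def b_def edge_matrix_def insert_commute)
  finally show ?case
    using Suc sum_nsets_Suc_lessThan[of g n 2] sum_nsets_2[of "\<lambda>S. g (insert n S)" n]
    unfolding f_def b_def by (simp add: numeral_3_eq_3 numeral_2_eq_2)
qed

lemma nsets_2_triple:
  assumes "i \<noteq> j" "i \<noteq> k" "j \<noteq> k"
  shows "nsets {i, j, k} 2 = {{i, j}, {i, k}, {j, k}}"
proof (intro equalityI subsetI)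
  fix S assume "S \<in> nsets {i, j, k} 2"
  then obtain x y where "S = {x, y}" "x \<noteq> y" "{x, y} \<subseteq> {i, j, k}"
    by (auto simp: nsets_def card_2_iff)
  then show "S \<in> {{i, j}, {i, k}, {j, k}}" by auto
qed (use assms in \<open>auto simp: nsets_def\<close>)

lemma finite_simple_graphs: "finite (simple_graphs n)"
  by (simp add: simple_graphs_def finite_imp_finite_nsets)

lemma sum_adjacency:
  assumes "E \<in> simple_graphs n"
  shows "(\<Sum>i<n. \<Sum>j<n. adjacency E i j) = 2 * real (card E)"
proof -
  have "(\<Sum>S\<in>nsets {..<n} 2. of_bool (S \<in> E)) = real (card (nsets {..<n} 2 \<inter> E))"
    by (subst sum_of_bool_eq) (auto simp: finite_imp_finite_nsets Int_def)
  then show ?thesis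
    using assms by (simp add: sum_nsets_2 simple_graphs_def Int_absorb1)
qed

lemma sum_adjacency_triangle:
  assumes "E \<in> simple_graphs n"
  shows "(\<Sum>i<n. \<Sum>j<n. \<Sum>k<n. adjacency E i j * adjacency E i k * adjacency E j k)
    = 6 * real (card (triangles n E))"
proof -
  have "(\<Sum>i<n. \<Sum>j<n. \<Sum>k<n. adjacency E i j * adjacency E i k * adjacency E j k) =
    (\<Sum>i<n. \<Sum>j<n. \<Sum>k<n. if i = j \<or> i = k \<or> j = k then 0 else of_bool (nsets {i, j, k} 2 \<subseteq> E))"
    by (intro sum.cong) (auto simp: edge_matrix_def nsets_2_triple)
  also have "\<dots> = 6 * (\<Sum>S\<in>nsets {..<n} 3. of_bool (nsets S 2 \<subseteq> E))"
    by (rule sum_nsets_3)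
  also have "(\<Sum>S\<in>nsets {..<n} 3. of_bool (nsets S 2 \<subseteq> E)) = real (card (triangles n E))"
    by (subst sum_of_bool_eq)
      (auto simp: finite_imp_finite_nsets triangles_def Int_def)
  finally show ?thesis .
qed

lemma real_choose_2: "2 * real (n choose 2) = real n * (real n - 1)"
  by (induction n) (simp_all add: numeral_2_eq_2 algebra_simps)

lemma real_choose_3: "6 * real (n choose 3) = real n * (real n - 1) * (real n - 2)"
proof (induction n)
  case (Suc n)
  have "Suc n choose 3 = (n choose 2) + (n choose 3)"
    by (simp add: numeral_2_eq_2 numeral_3_eq_3)
  then have "6 * real (Suc n choose 3) = 3 * (2 * real (n choose 2)) + 6 * real (n choose 3)"
    by simp
  then show ?case
    unfolding real_choose_2 Suc by (simp add: algebra_simps)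
qed simp

text \<open>The exact difference is the edge density divided by \<open>n\<close>. The constant 10 is
  generous and is shared with the triangle version, where the exact factor is (3 - 2/n)/n.\<close>

lemma edge_density_approx:
  assumes "E \<in> simple_graphs n" "2 \<le> n"
  shows "\<bar>edge_density n E - hom_edge n (adjacency E)\<bar> \<le> 10 / real n"
proof -
  define x where "x = edge_density n E"
  have c: "2 * real (card E) = x * (real n * (real n - 1))"
    using assms(2) unfolding x_def edge_density_def real_choose_2[symmetric] by simp
  have "card E \<le> n choose 2"
    using assms(1) card_mono[of "nsets {..<n} 2" E]
    by (simp add: simple_graphs_def finite_imp_finite_nsets card_nsets)
  then have x: "0 \<le> x" "x \<le> 1"
    by (auto simp: x_def edge_density_def divide_simps)
  have "x - hom_edge n (adjacency E) = x / real n"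
    unfolding hom_edge_def sum_adjacency[OF assms(1)] c
    using assms(2) by (simp add: field_simps power2_eq_square)
  then show ?thesis
    unfolding x_def[symmetric] using x by (simp add: divide_right_mono)
qed

lemma triangle_density_approx:
  assumes "E \<in> simple_graphs n" "3 \<le> n"
  shows "\<bar>triangle_density n E - hom_tri n (adjacency E)\<bar> \<le> 10 / real n"
proof -
  define x where "x = triangle_density n E"
  have c: "6 * real (card (triangles n E)) = x * (real n * (real n - 1) * (real n - 2))"
    using assms(2) unfolding x_def triangle_density_def real_choose_3[symmetric] by simp
  have "card (triangles n E) \<le> n choose 3"
    using card_mono[of "nsets {..<n} 3" "triangles n E"]
    by (auto simp: triangles_def finite_imp_finite_nsets card_nsets)
  then have x: "0 \<le> x" "x \<le> 1"
    by (auto simp: x_def triangle_density_def divide_simps)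
  have "x - hom_tri n (adjacency E) = x * ((3 - 2 / real n) / real n)"
    unfolding hom_tri_def sum_adjacency_triangle[OF assms(1)] c
    using assms(2) by (simp add: field_simps power3_eq_cube)
  moreover have *: "0 \<le> (3 - 2 / real n) / real n" "(3 - 2 / real n) / real n \<le> 10 / real n"
    using assms(2) by (auto simp: divide_simps)
  moreover have "x * ((3 - 2 / real n) / real n) \<le> (3 - 2 / real n) / real n"
    by (rule mult_left_le_one_le) (use x *(1) in auto)
  moreover have "0 \<le> x * ((3 - 2 / real n) / real n)"
    by (rule mult_nonneg_nonneg[OF x(1) *(1)])
  ultimately show ?thesis
    unfolding x_def[symmetric] by linarith
qed

section \<open>Averages over the classes of a partition\<close>

text \<open>Conditional expectation of \<open>X\<close> given the label \<open>\<kappa>\<close>, for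
  the uniform measure on \<open>A\<close>.\<close>

definition cond_avg :: "'a set \<Rightarrow> ('a \<Rightarrow> 'k) \<Rightarrow> ('a \<Rightarrow> real) \<Rightarrow> 'a \<Rightarrow> real" where
  "cond_avg A \<kappa> X a = (\<Sum>b\<in>{b\<in>A. \<kappa> b = \<kappa> a}. X b) / real (card {b\<in>A. \<kappa> b = \<kappa> a})"

lemma cond_avg_cong: "\<kappa> a = \<kappa> b \<Longrightarrow> cond_avg A \<kappa> X a = cond_avg A \<kappa> X b"
  by (simp add: cond_avg_def)

lemma cond_avg_diff: "cond_avg A \<kappa> (\<lambda>a. X a - Y a) a = cond_avg A \<kappa> X a - cond_avg A \<kappa> Y a"
  by (simp add: cond_avg_def sum_subtractf diff_divide_distrib)

lemma cond_avg_sum: "cond_avg A \<kappa> (\<lambda>a. \<Sum>i\<in>I. X i a) a = (\<Sum>i\<in>I. cond_avg A \<kappa> (X i) a)"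
  unfolding cond_avg_def by (subst sum.swap) (simp add: sum_divide_distrib)

lemma cond_avg_mono:
  assumes "\<And>b. b \<in> A \<Longrightarrow> X b \<le> Y b"
  shows "cond_avg A \<kappa> X a \<le> cond_avg A \<kappa> Y a"
  unfolding cond_avg_def by (intro divide_right_mono sum_mono) (use assms in auto)

lemma cond_avg_abs: "\<bar>cond_avg A \<kappa> X a\<bar> \<le> cond_avg A \<kappa> (\<lambda>b. \<bar>X b\<bar>) a"
  unfolding cond_avg_def by (simp add: divide_right_mono)

lemma cond_avg_const:
  assumes "finite A" "a \<in> A"
  shows "cond_avg A \<kappa> (\<lambda>_. c) a = c"
proof -
  have "card {b\<in>A. \<kappa> b = \<kappa> a} \<noteq> 0" using assms by auto
  then show ?thesis by (simp add: cond_avg_def)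
qed

lemma cond_avg_bounds:
  assumes "finite A" "a \<in> A" "\<And>b. b \<in> A \<Longrightarrow> l \<le> X b" "\<And>b. b \<in> A \<Longrightarrow> X b \<le> u"
  shows "l \<le> cond_avg A \<kappa> X a" "cond_avg A \<kappa> X a \<le> u"
  using cond_avg_mono[of A "\<lambda>_. l" X \<kappa> a] cond_avg_mono[of A X "\<lambda>_. u" \<kappa> a] assms
  by (simp_all add: cond_avg_const)

lemma cond_avg_pull_out:
  assumes "\<And>b. b \<in> A \<Longrightarrow> \<kappa> b = \<kappa> a \<Longrightarrow> Y b = Y a"
  shows "cond_avg A \<kappa> (\<lambda>b. Y b * X b) a = Y a * cond_avg A \<kappa> X a"
proof -
  have "(\<Sum>b\<in>{b\<in>A. \<kappa> b = \<kappa> a}. Y b * X b) = (\<Sum>b\<in>{b\<in>A. \<kappa> b = \<kappa> a}. Y a * X b)"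
    by (rule sum.cong) (use assms in auto)
  then show ?thesis by (simp add: cond_avg_def sum_distrib_left)
qed

text \<open>After swapping the sums, each \<open>b\<close> collects the term
  \<open>Y b * X b / c b\<close> once for every member of its own class, that is \<open>c b\<close>
  times.\<close>

lemma sum_mult_cond_avg:
  assumes fin: "finite A" and Y: "\<And>a b. a \<in> A \<Longrightarrow> b \<in> A \<Longrightarrow> \<kappa> a = \<kappa> b \<Longrightarrow> Y a = Y b"
  shows "(\<Sum>a\<in>A. Y a * cond_avg A \<kappa> X a) = (\<Sum>a\<in>A. Y a * X a)"
proof -
  define c where "c a = real (card {b\<in>A. \<kappa> b = \<kappa> a})" for a
  have c: "c a \<noteq> 0" if "a \<in> A" for a
    using that fin by (auto simp: c_def)
  have "(\<Sum>a\<in>A. Y a * cond_avg A \<kappa> X a) = (\<Sum>a\<in>A. \<Sum>b\<in>A. if \<kappa> b = \<kappa> a then Y a * X b / c a else 0)"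
    unfolding cond_avg_def c_def[symmetric] sum.inter_filter[OF fin] sum_distrib_left sum_divide_distrib
    by (intro sum.cong) auto
  also have "\<dots> = (\<Sum>b\<in>A. \<Sum>a\<in>A. if \<kappa> b = \<kappa> a then Y a * X b / c a else 0)"
    by (rule sum.swap)
  also have "\<dots> = (\<Sum>b\<in>A. Y b * X b)"
  proof (rule sum.cong)
    fix b assume b: "b \<in> A"
    have "(\<Sum>a\<in>A. if \<kappa> b = \<kappa> a then Y a * X b / c a else 0) =
        (\<Sum>a\<in>{a\<in>A. \<kappa> a = \<kappa> b}. Y b * X b / c b)"
      unfolding sum.inter_filter[OF fin]
    proof (rule sum.cong)
      fix a assume "a \<in> A"
      then have "Y a = Y b \<and> c a = c b" if "\<kappa> a = \<kappa> b"
        using Y[of a b] that b by (simp add: c_def)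
      then show "(if \<kappa> b = \<kappa> a then Y a * X b / c a else 0) = (if \<kappa> a = \<kappa> b then Y b * X b / c b else 0)"
        by auto
    qed simp
    also have "\<dots> = Y b * X b" using c[OF b] by (simp add: c_def)
    finally show "(\<Sum>a\<in>A. if \<kappa> b = \<kappa> a then Y a * X b / c a else 0) = Y b * X b" .
  qed simp
  finally show ?thesis .
qed

lemma sum_cond_avg: "finite A \<Longrightarrow> (\<Sum>a\<in>A. cond_avg A \<kappa> X a) = sum X A"
  using sum_mult_cond_avg[of A \<kappa> "\<lambda>_. 1" X] by simp

context
  fixes A :: "'a set" and \<kappa> :: "'a \<Rightarrow> 'k" and \<kappa>' :: "'a \<Rightarrow> 'l"
  assumes fin: "finite A" and refines: "\<And>a b. \<kappa>' a = \<kappa>' b \<Longrightarrow> \<kappa> a = \<kappa> b"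
begin

text \<open>Tower property. The indicator of a coarse class times \<open>Y\<close> is constant on
  the classes of the finer label \<open>\<kappa>'\<close>, so \<open>sum_mult_cond_avg\<close>
  applies with this product as the weight.\<close>

lemma cond_avg_mult_tower:
  assumes "\<And>a b. a \<in> A \<Longrightarrow> b \<in> A \<Longrightarrow> \<kappa>' a = \<kappa>' b \<Longrightarrow> Y a = Y b"
  shows "cond_avg A \<kappa> (\<lambda>b. Y b * cond_avg A \<kappa>' X b) a = cond_avg A \<kappa> (\<lambda>b. Y b * X b) a"
proof -
  have *: "(\<Sum>b\<in>{b\<in>A. \<kappa> b = \<kappa> a}. f b) = (\<Sum>b\<in>A. of_bool (\<kappa> b = \<kappa> a) * f b)" for f :: "'a \<Rightarrow> real"
    unfolding sum.inter_filter[OF fin] by (rule sum.cong) auto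
  have "(\<Sum>b\<in>A. of_bool (\<kappa> b = \<kappa> a) * Y b * cond_avg A \<kappa>' X b)
      = (\<Sum>b\<in>A. of_bool (\<kappa> b = \<kappa> a) * Y b * X b)"
  proof (rule sum_mult_cond_avg[OF fin])
    fix b c assume "b \<in> A" "c \<in> A" "\<kappa>' b = \<kappa>' c"
    then show "of_bool (\<kappa> b = \<kappa> a) * Y b = of_bool (\<kappa> c = \<kappa> a) * Y c"
      using assms[of b c] refines[of b c] by simp
  qed
  then show ?thesis unfolding cond_avg_def * mult.assoc by simp
qed

text \<open>Pythagoras: the coarse average is the orthogonal projection of the fine one, so the
  cross term equals the coarse sum of squares.\<close>

lemma sum_power2_cond_avg_diff:
  "(\<Sum>a\<in>A. (cond_avg A \<kappa>' X a - cond_avg A \<kappa> X a)\<^sup>2)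
    = (\<Sum>a\<in>A. (cond_avg A \<kappa>' X a)\<^sup>2) - (\<Sum>a\<in>A. (cond_avg A \<kappa> X a)\<^sup>2)"
proof -
  have 1: "(\<Sum>a\<in>A. cond_avg A \<kappa> X a * cond_avg A \<kappa>' X a) = (\<Sum>a\<in>A. cond_avg A \<kappa> X a * X a)"
    by (rule sum_mult_cond_avg[OF fin]) (intro cond_avg_cong refines)
  have 2: "(\<Sum>a\<in>A. cond_avg A \<kappa> X a * cond_avg A \<kappa> X a) = (\<Sum>a\<in>A. cond_avg A \<kappa> X a * X a)"
    by (rule sum_mult_cond_avg[OF fin]) (rule cond_avg_cong)
  have "(u - v)\<^sup>2 = u\<^sup>2 - v\<^sup>2 - 2 * (v * u - v * v)" for u v :: real
    by (simp add: power2_eq_square algebra_simps)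
  then have "(\<Sum>a\<in>A. (cond_avg A \<kappa>' X a - cond_avg A \<kappa> X a)\<^sup>2)
    = (\<Sum>a\<in>A. (cond_avg A \<kappa>' X a)\<^sup>2) - (\<Sum>a\<in>A. (cond_avg A \<kappa> X a)\<^sup>2)
      - 2 * ((\<Sum>a\<in>A. cond_avg A \<kappa> X a * cond_avg A \<kappa>' X a) - (\<Sum>a\<in>A. cond_avg A \<kappa> X a * cond_avg A \<kappa> X a))"
    by (simp only: sum_subtractf sum_distrib_left[symmetric])
  then show ?thesis using 1 2 by simp
qed

text \<open>The error of factorising the average of \<open>X Y\<close> is bounded by how much the average of \<open>X\<close>
  moves when the partition is refined so that \<open>Y\<close> becomes constant on classes; an increment in the
  sum of squares controls this.\<close>

lemma cond_avg_decorrelate: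
  assumes a: "a \<in> A"
    and Y: "\<And>a b. a \<in> A \<Longrightarrow> b \<in> A \<Longrightarrow> \<kappa>' a = \<kappa>' b \<Longrightarrow> Y a = Y b"
    and Y1: "\<And>a. a \<in> A \<Longrightarrow> \<bar>Y a\<bar> \<le> 1"
  shows "\<bar>cond_avg A \<kappa> (\<lambda>b. Y b * X b) a - cond_avg A \<kappa> X a * cond_avg A \<kappa> Y a\<bar>
    \<le> cond_avg A \<kappa> (\<lambda>b. \<bar>cond_avg A \<kappa>' X b - cond_avg A \<kappa> X b\<bar>) a"
proof -
  have "cond_avg A \<kappa> (\<lambda>b. cond_avg A \<kappa> X b * Y b) a = cond_avg A \<kappa> X a * cond_avg A \<kappa> Y a"
    by (rule cond_avg_pull_out) (simp add: cond_avg_def)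
  then have "cond_avg A \<kappa> (\<lambda>b. Y b * cond_avg A \<kappa> X b) a = cond_avg A \<kappa> X a * cond_avg A \<kappa> Y a"
    unfolding mult.commute[of "Y _"] .
  moreover have "cond_avg A \<kappa> (\<lambda>b. Y b * cond_avg A \<kappa>' X b) a = cond_avg A \<kappa> (\<lambda>b. Y b * X b) a"
    by (rule cond_avg_mult_tower) (rule Y)
  ultimately have "cond_avg A \<kappa> (\<lambda>b. Y b * X b) a - cond_avg A \<kappa> X a * cond_avg A \<kappa> Y a
      = cond_avg A \<kappa> (\<lambda>b. Y b * (cond_avg A \<kappa>' X b - cond_avg A \<kappa> X b)) a"
    by (simp only: right_diff_distrib cond_avg_diff)
  also have "\<bar>\<dots>\<bar> \<le> cond_avg A \<kappa> (\<lambda>b. \<bar>Y b * (cond_avg A \<kappa>' X b - cond_avg A \<kappa> X b)\<bar>) a"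
    by (rule cond_avg_abs)
  also have "\<dots> \<le> cond_avg A \<kappa> (\<lambda>b. \<bar>cond_avg A \<kappa>' X b - cond_avg A \<kappa> X b\<bar>) a"
    by (rule cond_avg_mono) (simp add: abs_mult mult_left_le_one_le Y1)
  finally show ?thesis .
qed

end

text \<open>Otherwise every set of at most \<open>K\<close> elements could be enlarged by an element
  that raises \<open>Q\<close> by more than \<open>B / K\<close>; starting from the empty set,
  \<open>K + 1\<close> enlargements push \<open>Q\<close> above its bound \<open>B\<close>.\<close>

lemma exists_set_small_increment:
  fixes Q :: "nat set \<Rightarrow> real"
  assumes Q: "\<And>V. 0 \<le> Q V" "\<And>V. Q V \<le> B" and B: "0 \<le> B" and K: "0 < K"
  shows "\<exists>V. finite V \<and> card V \<le> K \<and> (\<Sum>k<n. Q (insert k V) - Q V) \<le> real n * (B / real K)"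
proof (rule ccontr)
  assume "\<not> ?thesis"
  then have H: "(\<Sum>k<n. Q (insert k V) - Q V) > real n * (B / real K)"
    if "finite V" "card V \<le> K" for V
    using that by (meson not_le)
  \<comment> \<open>Strictness is carried along for \<open>m > 0\<close> so that the final
    contradiction with \<open>Q V \<le> B\<close> also works for \<open>B = 0\<close>; at
    \<open>m = 0\<close> only \<open>0 \<le> Q {}\<close> is available.\<close>
  have "\<exists>V. finite V \<and> card V \<le> m \<and> Q V \<ge> real m * (B / real K)
      \<and> (m > 0 \<longrightarrow> Q V > real m * (B / real K))" if "m \<le> Suc K" for m
    using that
  proof (induction m)
    case 0
    then show ?case using Q(1)[of "{}"] by (intro exI[of _ "{}"]) auto
  next
    case (Suc m)
    then obtain V where V: "finite V" "card V \<le> m" "Q V \<ge> real m * (B / real K)" by auto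
    have "\<exists>k<n. Q (insert k V) - Q V > B / real K"
    proof (rule ccontr)
      assume "\<not> ?thesis"
      then have "(\<Sum>k<n. Q (insert k V) - Q V) \<le> (\<Sum>k<n. B / real K)"
        by (intro sum_mono) (meson lessThan_iff not_less)
      then show False using H[of V] V Suc.prems by auto
    qed
    then obtain k where "Q (insert k V) - Q V > B / real K" by blast
    moreover have "real (Suc m) * (B / real K) = real m * (B / real K) + B / real K"
      by (simp only: of_nat_Suc distrib_right mult_1 add.commute)
    ultimately have "Q (insert k V) > real (Suc m) * (B / real K)"
      using V by linarith
    moreover have "finite (insert k V)" "card (insert k V) \<le> Suc m"
      using V by (auto simp: card_insert_if)
    ultimately show ?case by (intro exI[of _ "insert k V"]) simp
  qed
  from this[of "Suc K"] obtain V where "Q V > real (Suc K) * (B / real K)" by auto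
  moreover have "real (Suc K) * (B / real K) \<ge> B"
    using K B by (simp add: field_simps)
  ultimately show False using Q(2)[of V] by simp
qed

section \<open>Binary entropy and the triangle sum of a matrix\<close>

definition bin_entropy :: "real \<Rightarrow> real" where
  "bin_entropy x = - x * ln x - (1 - x) * ln (1 - x)"

text \<open>This is ln u <= u - 1 at u = y / x, multiplied by \<open>x\<close>: the pointwise form
  of Gibbs' inequality. At \<open>x = 0\<close> the product \<open>x * ln x\<close> is 0.\<close>

lemma mult_ln_le: "0 \<le> x \<Longrightarrow> 0 < y \<Longrightarrow> x * ln y \<le> x * ln x + y - x" for x y :: real
proof (cases "x = 0")
  case False
  assume x: "0 \<le> x" and y: "0 < y"
  with False have x: "0 < x" by simp
  have "ln (y / x) \<le> y / x - 1" using x y by (intro ln_le_minus_one) simp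
  then have "x * ln (y / x) \<le> x * (y / x - 1)" using x by (intro mult_left_mono) auto
  then show ?thesis using x y by (simp add: ln_div algebra_simps)
qed simp

lemma bin_entropy_0 [simp]: "bin_entropy 0 = 0"
  by (simp add: bin_entropy_def)

text \<open>The second derivative -1 / (y * (1 - y)) is at most -4, so the entropy plus 2 * (x -
  e)^2 is concave and lies below its tangent at \<open>e\<close>. The endpoints, where the entropy
  has no derivative, are treated separately.\<close>

lemma bin_entropy_tangent:
  assumes e: "0 < e" "e < 1" and x: "0 \<le> x" "x \<le> 1"
  shows "bin_entropy x \<le> bin_entropy e + (ln (1 - e) - ln e) * (x - e) - 2 * (x - e)\<^sup>2"
proof -
  define f where "f y = bin_entropy e + (ln (1 - e) - ln e) * (y - e) - 2 * (y - e)\<^sup>2 - bin_entropy y" for y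
  define f' where "f' y = (ln (1 - e) - ln e) - 4 * (y - e) - (ln (1 - y) - ln y)" for y
  have "(bin_entropy has_real_derivative ln (1 - y) - ln y) (at y)" if "0 < y" "y < 1" for y
    unfolding bin_entropy_def using that by (auto intro!: derivative_eq_intros)
  then have der: "(f has_real_derivative f' y) (at y)" if "0 < y" "y < 1" for y
    unfolding f_def f'_def using that by (auto intro!: derivative_eq_intros)
  have der': "(f' has_real_derivative (1 / (y * (1 - y)) - 4)) (at y)" if "0 < y" "y < 1" for y
    unfolding f'_def using that by (auto intro!: derivative_eq_intros simp: field_simps)
  have pos: "0 \<le> 1 / (y * (1 - y)) - 4" if "0 < y" "y < 1" for y :: real
  proof -
    have "0 \<le> (1 - 2 * y)\<^sup>2" by simp
    then have "4 * (y * (1 - y)) \<le> 1" by (simp add: power2_eq_square algebra_simps)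
    then show ?thesis using that by (simp add: field_simps)
  qed
  have mono: "f' y \<le> f' z" if "0 < y" "y \<le> z" "z < 1" for y z
  proof (rule DERIV_nonneg_imp_nondecreasing[OF that(2)])
    fix x assume "y \<le> x" "x \<le> z"
    then show "\<exists>d. (f' has_real_derivative d) (at x) \<and> 0 \<le> d"
      using that der'[of x] pos[of x] by (intro exI conjI) auto
  qed
  have f0: "f e = 0" "f' e = 0" by (simp_all add: f_def f'_def)
  have interior: "0 \<le> f y" if y: "0 < y" "y < 1" for y
  proof (cases "y \<le> e")
    case True
    have "f e \<le> f y"
    proof (rule DERIV_nonpos_imp_nonincreasing[OF True])
      fix z assume "y \<le> z" "z \<le> e"
      then show "\<exists>d. (f has_real_derivative d) (at z) \<and> d \<le> 0"
        using y e der[of z] mono[of z e] f0 by (intro exI[of _ "f' z"]) simp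
    qed
    then show ?thesis using f0 by simp
  next
    case False
    then have "e \<le> y" by simp
    have "f e \<le> f y"
    proof (rule DERIV_nonneg_imp_nondecreasing[OF \<open>e \<le> y\<close>])
      fix z assume "e \<le> z" "z \<le> y"
      then show "\<exists>d. (f has_real_derivative d) (at z) \<and> 0 \<le> d"
        using y e der[of z] mono[of e z] f0 by (intro exI[of _ "f' z"]) simp
    qed
    then show ?thesis using f0 by simp
  qed
  have edge: "0 \<le> f 0" "0 \<le> f 1"
  proof -
    \<comment> \<open>At the endpoints everything but a logarithm and a square cancels:
      \<open>f 0\<close> equals -ln (1 - e) - 2 * e^2, and \<open>f 1\<close> is the same expression
      with \<open>1 - e\<close> in place of \<open>e\<close>.\<close>
    have ln2: "- ln (1 - z) \<ge> 2 * z\<^sup>2" if z: "0 < z" "z < 1" for z :: real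
    proof -
      define g where "g u = - ln (1 - u) - 2 * u\<^sup>2" for u :: real
      have "g 0 \<le> g z"
      proof (rule DERIV_nonneg_imp_nondecreasing[of 0 z g])
        fix u assume u: "0 \<le> u" "u \<le> z"
        have "(g has_real_derivative 1 / (1 - u) - 4 * u) (at u)"
          unfolding g_def using u z by (auto intro!: derivative_eq_intros simp: field_simps)
        moreover have "0 \<le> 1 / (1 - u) - 4 * u"
        proof -
          have "0 \<le> (1 - 2 * u)\<^sup>2" by simp
          then have "4 * u * (1 - u) \<le> 1" by (simp add: power2_eq_square algebra_simps)
          then show ?thesis using u z by (simp add: field_simps)
        qed
        ultimately show "\<exists>y. (g has_real_derivative y) (at u) \<and> 0 \<le> y"
          by blast
      qed (use z in simp)
      then show ?thesis by (simp add: g_def)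
    qed
    show "0 \<le> f 0"
      using ln2[of e] e by (simp add: f_def bin_entropy_def algebra_simps power2_eq_square)
    show "0 \<le> f 1"
      using ln2[of "1 - e"] e by (simp add: f_def bin_entropy_def algebra_simps power2_eq_square)
  qed
  have "0 \<le> f x"
    using interior[of x] edge x by (cases "x = 0"; cases "x = 1") auto
  then show ?thesis by (simp add: f_def)
qed

text \<open>Two uses of Cauchy-Schwarz. With \<open>b\<close> the product of the transpose of
  \<open>a\<close> with \<open>a\<close>, the sum is the inner product of \<open>b\<close> and
  \<open>a\<close>, and the squared Hilbert-Schmidt norm of \<open>b\<close> is at most the square
  of that of \<open>a\<close>; hence the squared triangle sum is at most
  \<open>S ^ 3\<close>.\<close>

lemma abs_triangle_sum_le:
  fixes a :: "nat \<Rightarrow> nat \<Rightarrow> real"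
  shows "\<bar>\<Sum>i<n. \<Sum>j<n. \<Sum>k<n. a i j * a i k * a j k\<bar> \<le> (\<Sum>i<n. \<Sum>j<n. (a i j)\<^sup>2) powr (3/2)"
proof -
  define S where "S = (\<Sum>i<n. \<Sum>j<n. (a i j)\<^sup>2)"
  define b where "b j k = (\<Sum>i<n. a i j * a i k)" for j k
  have S0: "0 \<le> S" by (simp add: S_def sum_nonneg)
  have CS: "(\<Sum>i\<in>I. f i * g i)\<^sup>2 \<le> (\<Sum>i\<in>I. (f i)\<^sup>2) * (\<Sum>i\<in>I. (g i)\<^sup>2)" for f g :: "'z \<Rightarrow> real" and I
    by (rule Cauchy_Schwarz_ineq_sum)
  have S2: "S = (\<Sum>p\<in>{..<n} \<times> {..<n}. (a (fst p) (snd p))\<^sup>2)"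
    by (simp add: S_def sum.cartesian_product split_def)
  have "(\<Sum>j<n. \<Sum>k<n. (b j k)\<^sup>2) \<le> (\<Sum>j<n. \<Sum>k<n. (\<Sum>i<n. (a i j)\<^sup>2) * (\<Sum>i<n. (a i k)\<^sup>2))"
    unfolding b_def by (intro sum_mono CS)
  also have "\<dots> = (\<Sum>j<n. \<Sum>i<n. (a i j)\<^sup>2) * (\<Sum>j<n. \<Sum>i<n. (a i j)\<^sup>2)"
    by (simp add: sum_product)
  also have "(\<Sum>j<n. \<Sum>i<n. (a i j)\<^sup>2) = S" unfolding S_def by (rule sum.swap)
  finally have B: "(\<Sum>j<n. \<Sum>k<n. (b j k)\<^sup>2) \<le> S * S" .
  have "(\<Sum>i<n. \<Sum>j<n. \<Sum>k<n. a i j * a i k * a j k) = (\<Sum>j<n. \<Sum>i<n. \<Sum>k<n. a i j * a i k * a j k)"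
    by (rule sum.swap)
  also have "\<dots> = (\<Sum>j<n. \<Sum>k<n. \<Sum>i<n. a i j * a i k * a j k)"
    by (intro sum.cong refl sum.swap)
  also have "\<dots> = (\<Sum>j<n. \<Sum>k<n. b j k * a j k)"
    by (simp add: b_def sum_distrib_right)
  finally have T: "(\<Sum>i<n. \<Sum>j<n. \<Sum>k<n. a i j * a i k * a j k) = (\<Sum>p\<in>{..<n} \<times> {..<n}. b (fst p) (snd p) * a (fst p) (snd p))"
    by (simp add: sum.cartesian_product split_def)
  have "(\<Sum>i<n. \<Sum>j<n. \<Sum>k<n. a i j * a i k * a j k)\<^sup>2 \<le> (\<Sum>j<n. \<Sum>k<n. (b j k)\<^sup>2) * S"
    unfolding T S2 using CS[of "\<lambda>p. b (fst p) (snd p)" "\<lambda>p. a (fst p) (snd p)" "{..<n} \<times> {..<n}"]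
    by (simp add: sum.cartesian_product split_def)
  also have "\<dots> \<le> S * S * S" by (rule mult_right_mono[OF B S0])
  also have "\<dots> = (S powr (3/2))\<^sup>2"
    using S0 by (cases "S = 0") (simp_all add: power2_eq_square powr_add[symmetric] powr_numeral power3_eq_cube)
  finally show ?thesis
    unfolding S_def[symmetric] by (simp add: abs_le_square_iff[symmetric])
qed

section \<open>Products of Bernoulli measures\<close>

text \<open>Probability of the outcome \<open>S\<close> when each \<open>x\<close> in
  \<open>I\<close> is chosen independently with probability \<open>p x\<close>; below,
  \<open>I\<close> is the set of all possible edges.\<close>

definition bernoulli_weight :: "'a set \<Rightarrow> ('a \<Rightarrow> real) \<Rightarrow> 'a set \<Rightarrow> real" where
  "bernoulli_weight I p S = (\<Prod>x\<in>I. if x \<in> S then p x else 1 - p x)"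

definition expect :: "'a set \<Rightarrow> ('a \<Rightarrow> real) \<Rightarrow> ('a set \<Rightarrow> real) \<Rightarrow> real" where
  "expect I p f = (\<Sum>S\<in>Pow I. bernoulli_weight I p S * f S)"

lemma sum_Pow_insert:
  fixes f :: "'a set \<Rightarrow> real"
  assumes "finite I" "x \<notin> I"
  shows "(\<Sum>S\<in>Pow (insert x I). f S) = (\<Sum>S\<in>Pow I. f (insert x S)) + (\<Sum>S\<in>Pow I. f S)"
proof -
  have inj: "inj_on (insert x) (Pow I)"
    using assms(2) by (intro inj_onI) (metis Pow_iff insert_ident subsetD)
  have "(\<Sum>S\<in>Pow (insert x I). f S) = (\<Sum>S\<in>Pow I. f S) + (\<Sum>S\<in>insert x ` Pow I. f S)"
    unfolding Pow_insert by (rule sum.union_disjoint) (use assms in auto)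
  then show ?thesis by (simp add: sum.reindex[OF inj])
qed

lemma bernoulli_weight_insert:
  assumes "finite I" "x \<notin> I" "S \<subseteq> I"
  shows "bernoulli_weight (insert x I) p (insert x S) = p x * bernoulli_weight I p S"
    and "bernoulli_weight (insert x I) p S = (1 - p x) * bernoulli_weight I p S"
proof -
  have "(\<Prod>y\<in>I. if y \<in> insert x S then p y else 1 - p y) = (\<Prod>y\<in>I. if y \<in> S then p y else 1 - p y)"
    by (rule prod.cong) (use assms in auto)
  then show "bernoulli_weight (insert x I) p (insert x S) = p x * bernoulli_weight I p S"
    using assms unfolding bernoulli_weight_def by simp
  show "bernoulli_weight (insert x I) p S = (1 - p x) * bernoulli_weight I p S"
    using assms unfolding bernoulli_weight_def by auto
qed

lemma expect_insert:
  assumes "finite I" "x \<notin> I"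
  shows "expect (insert x I) p f =
    p x * expect I p (\<lambda>S. f (insert x S)) + (1 - p x) * expect I p f"
  using bernoulli_weight_insert[OF assms]
  by (simp add: expect_def sum_Pow_insert[OF assms] sum_distrib_left mult.assoc)

lemma expect_empty [simp]: "expect {} p f = f {}"
  by (simp add: expect_def bernoulli_weight_def)

lemma expect_add: "expect I p (\<lambda>S. f S + g S) = expect I p f + expect I p g"
  by (simp add: expect_def distrib_left sum.distrib)

lemma expect_diff: "expect I p (\<lambda>S. f S - g S) = expect I p f - expect I p g"
  by (simp add: expect_def right_diff_distrib sum_subtractf)

lemma expect_cmult: "expect I p (\<lambda>S. c * f S) = c * expect I p f"
  by (simp add: expect_def sum_distrib_left mult.left_commute)

lemma expect_divide: "expect I p (\<lambda>S. f S / c) = expect I p f / c"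
  by (simp add: expect_def sum_divide_distrib)

lemma expect_sum: "expect I p (\<lambda>S. \<Sum>i\<in>J. f i S) = (\<Sum>i\<in>J. expect I p (f i))"
  unfolding expect_def sum_distrib_left by (rule sum.swap)

lemma expect_const: "finite I \<Longrightarrow> expect I p (\<lambda>_. c) = c"
  by (induction I rule: finite_induct) (simp_all add: expect_insert algebra_simps)

lemma expect_superset:
  assumes "finite I" "T \<subseteq> I"
  shows "expect I p (\<lambda>S. of_bool (T \<subseteq> S)) = (\<Prod>x\<in>T. p x)"
  using assms
proof (induction I arbitrary: T rule: finite_induct)
  case (insert x I)
  show ?case
  proof (cases "x \<in> T")
    case True
    have "expect I p (\<lambda>S. of_bool (T \<subseteq> S)) = 0"
      using True insert.hyps by (auto simp: expect_def intro!: sum.neutral)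
    moreover have "(\<lambda>S. of_bool (T \<subseteq> insert x S) :: real) = (\<lambda>S. of_bool (T - {x} \<subseteq> S))"
      by (auto simp: fun_eq_iff)
    moreover have "finite T" using insert finite_subset by blast
    ultimately show ?thesis
      using insert.IH[of "T - {x}"] insert.prems insert.hyps True
      by (simp add: expect_insert prod.remove[of T x] subset_insert_iff)
  next
    case False
    then have "(\<lambda>S. of_bool (T \<subseteq> insert x S) :: real) = (\<lambda>S. of_bool (T \<subseteq> S))"
      by (auto simp: fun_eq_iff)
    with False show ?thesis
      using insert.IH[of T] insert.prems insert.hyps
      by (simp add: expect_insert subset_insert algebra_simps)
  qed
qed simp

lemma bernoulli_weight_nonneg:
  "(\<And>x. x \<in> I \<Longrightarrow> 0 \<le> p x \<and> p x \<le> 1) \<Longrightarrow> 0 \<le> bernoulli_weight I p S"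
  unfolding bernoulli_weight_def by (rule prod_nonneg) auto

lemma sum_bernoulli_weight: "finite I \<Longrightarrow> (\<Sum>S\<in>Pow I. bernoulli_weight I p S) = 1"
  using expect_const[of I p 1] by (simp add: expect_def)

lemma expect_mono:
  assumes "\<And>x. x \<in> I \<Longrightarrow> 0 \<le> p x \<and> p x \<le> 1" "\<And>S. S \<subseteq> I \<Longrightarrow> f S \<le> g S"
  shows "expect I p f \<le> expect I p g"
  unfolding expect_def
  by (intro sum_mono mult_left_mono bernoulli_weight_nonneg) (use assms in auto)

lemma expect_square_shift:
  assumes "finite I"
  shows "expect I p (\<lambda>S. (f S - c)\<^sup>2) =
    expect I p (\<lambda>S. (f S - expect I p f)\<^sup>2) + (expect I p f - c)\<^sup>2"
proof -
  define m where "m = expect I p f"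
  have "(f S - c)\<^sup>2 = (f S - m)\<^sup>2 + (2 * (m - c) * (f S - m) + (m - c)\<^sup>2)" for S
    by (simp add: power2_eq_square algebra_simps)
  then have "expect I p (\<lambda>S. (f S - c)\<^sup>2) =
      expect I p (\<lambda>S. (f S - m)\<^sup>2) + (2 * (m - c) * (expect I p f - m) + (m - c)\<^sup>2)"
    by (simp add: expect_add expect_cmult expect_diff expect_const assms)
  then show ?thesis by (simp add: m_def)
qed

text \<open>Law of total variance, one coordinate at a time: conditioning on \<open>x\<close> leaves
  two variances covered by the induction hypothesis and adds p * (1 - p) times the squared
  difference of the two conditional means, which is at most \<open>c\<close> squared.\<close>

lemma variance_bounded_differences:
  assumes "finite I" "\<And>x. x \<in> I \<Longrightarrow> 0 \<le> p x \<and> p x \<le> 1"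
    and "\<And>x S. x \<in> I \<Longrightarrow> S \<subseteq> I \<Longrightarrow> \<bar>f (insert x S) - f (S - {x})\<bar> \<le> c"
  shows "expect I p (\<lambda>S. (f S - expect I p f)\<^sup>2) \<le> real (card I) * c\<^sup>2"
  using assms
proof (induction I arbitrary: f rule: finite_induct)
  case (insert x I)
  note bd = insert.prems(2)
  define g where "g S = f (insert x S)" for S
  define m1 m0 m where "m1 = expect I p g" and "m0 = expect I p f"
    and "m = expect (insert x I) p f"
  have p: "0 \<le> p x" "p x \<le> 1" "\<And>y. y \<in> I \<Longrightarrow> 0 \<le> p y \<and> p y \<le> 1"
    using insert.prems(1) by auto
  have m: "m = p x * m1 + (1 - p x) * m0"
    unfolding m_def m1_def m0_def g_def by (rule expect_insert[OF insert.hyps])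
  have v0: "expect I p (\<lambda>S. (f S - m0)\<^sup>2) \<le> real (card I) * c\<^sup>2"
    unfolding m0_def by (rule insert.IH[OF p(3)]) (auto intro!: bd)
  have v1: "expect I p (\<lambda>S. (g S - m1)\<^sup>2) \<le> real (card I) * c\<^sup>2"
    unfolding m1_def
  proof (rule insert.IH)
    fix y S assume y: "y \<in> I" "S \<subseteq> I"
    have "insert x S - {y} = insert x (S - {y})" using y insert.hyps by auto
    then show "\<bar>g (insert y S) - g (S - {y})\<bar> \<le> c"
      using bd[of y "insert x S"] y by (simp add: g_def insert_commute subset_insertI2)
  qed (use p in auto)
  have "\<bar>expect I p (\<lambda>S. g S - f S)\<bar> \<le> c"
  proof -
    have "g S - f S \<le> c \<and> - c \<le> g S - f S" if S: "S \<subseteq> I" for S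
    proof -
      have "S - {x} = S" using S insert.hyps by auto
      moreover have "S \<subseteq> insert x I" using S by auto
      ultimately have "\<bar>g S - f S\<bar> \<le> c"
        using bd[of x S] by (simp add: g_def)
      then show ?thesis by linarith
    qed
    then have "expect I p (\<lambda>S. g S - f S) \<le> expect I p (\<lambda>_. c)"
      "expect I p (\<lambda>_. - c) \<le> expect I p (\<lambda>S. g S - f S)"
      using p(3) by (auto intro!: expect_mono)
    then show ?thesis using insert.hyps by (simp add: expect_const)
  qed
  then have d: "(m1 - m0)\<^sup>2 \<le> c\<^sup>2"
    by (simp add: expect_diff m1_def m0_def abs_le_square_iff[symmetric])
  have "expect (insert x I) p (\<lambda>S. (f S - m)\<^sup>2) =
      p x * (expect I p (\<lambda>S. (g S - m1)\<^sup>2) + (m1 - m)\<^sup>2)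
      + (1 - p x) * (expect I p (\<lambda>S. (f S - m0)\<^sup>2) + (m0 - m)\<^sup>2)"
    unfolding m1_def m0_def expect_square_shift[OF insert.hyps(1), symmetric]
    by (simp add: expect_insert insert.hyps g_def)
  also have "\<dots> \<le> p x * (real (card I) * c\<^sup>2 + (m1 - m)\<^sup>2)
      + (1 - p x) * (real (card I) * c\<^sup>2 + (m0 - m)\<^sup>2)"
    using p v0 v1 by (intro add_mono mult_left_mono) auto
  also have "\<dots> = real (card I) * c\<^sup>2 + p x * (1 - p x) * (m1 - m0)\<^sup>2"
    unfolding m by (simp add: power2_eq_square algebra_simps)
  also have "p x * (1 - p x) * (m1 - m0)\<^sup>2 \<le> 1 * c\<^sup>2"
    using p d by (intro mult_mono) (auto simp: mult_le_one)
  finally show ?case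
    using insert.hyps by (simp add: m_def algebra_simps)
qed simp

text \<open>Additivity of entropy over independent coordinates. The inductive step rests on the
  product rule \<open>phi\<close> for -u * ln u and on the weights having total mass 1.\<close>

lemma sum_xlogx_bernoulli_weight:
  assumes "finite I" "\<And>x. x \<in> I \<Longrightarrow> 0 \<le> p x \<and> p x \<le> 1"
  shows "(\<Sum>S\<in>Pow I. - bernoulli_weight I p S * ln (bernoulli_weight I p S))
    = (\<Sum>x\<in>I. bin_entropy (p x))"
  using assms
proof (induction I rule: finite_induct)
  case (insert x I)
  let ?b = "bernoulli_weight I p"
  have phi: "- (u * v) * ln (u * v) = u * (- v * ln v) + v * (- u * ln u)" if "0 \<le> u" "0 \<le> v" for u v :: real
    using that by (cases "u = 0 \<or> v = 0") (auto simp: ln_mult_pos algebra_simps)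
  have p: "0 \<le> p x" "p x \<le> 1" "\<And>y. y \<in> I \<Longrightarrow> 0 \<le> p y \<and> p y \<le> 1"
    using insert.prems by auto
  have b: "0 \<le> ?b S" for S by (rule bernoulli_weight_nonneg) (use p in auto)
  have s: "(\<Sum>S\<in>Pow I. - (u * ?b S) * ln (u * ?b S)) =
      u * (\<Sum>x\<in>I. bin_entropy (p x)) - u * ln u" if "0 \<le> u" for u
  proof -
    have "(\<Sum>S\<in>Pow I. - (u * ?b S) * ln (u * ?b S)) =
      (\<Sum>S\<in>Pow I. u * (- ?b S * ln (?b S)) + ?b S * (- u * ln u))"
      using phi[OF that b] by simp
    also have "\<dots> = u * (\<Sum>S\<in>Pow I. - ?b S * ln (?b S)) + (\<Sum>S\<in>Pow I. ?b S) * (- u * ln u)"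
      unfolding sum.distrib sum_distrib_left sum_distrib_right ..
    finally show ?thesis
      using insert.IH p sum_bernoulli_weight[OF insert.hyps(1)] by simp
  qed
  have "(\<Sum>S\<in>Pow (insert x I). - bernoulli_weight (insert x I) p S * ln (bernoulli_weight (insert x I) p S))
    = (\<Sum>S\<in>Pow I. - (p x * ?b S) * ln (p x * ?b S)) + (\<Sum>S\<in>Pow I. - ((1 - p x) * ?b S) * ln ((1 - p x) * ?b S))"
    unfolding sum_Pow_insert[OF insert.hyps(1,2)]
    by (intro arg_cong2[where f = "(+)"] sum.cong) (use bernoulli_weight_insert[OF insert.hyps(1,2)] in auto)
  also have "\<dots> = (\<Sum>x\<in>I. bin_entropy (p x)) + bin_entropy (p x)"
    using s[of "p x"] s[of "1 - p x"] p by (simp add: bin_entropy_def algebra_simps)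
  finally show ?case using insert.hyps by simp
qed (simp add: bernoulli_weight_def)

text \<open>The outcomes in \<open>B\<close> contribute at most ln of their number plus 1. The
  remaining mass, at most \<open>\<eta>\<close>, contributes at most \<open>\<eta>\<close> times the
  maximal entropy \<open>card I * ln 2\<close>, plus 1.\<close>

lemma entropy_le_ln_card:
  assumes I: "finite I" and p: "\<And>x. x \<in> I \<Longrightarrow> 0 \<le> p x \<and> p x \<le> 1" and B: "B \<subseteq> Pow I"
    and \<eta>: "(\<Sum>S\<in>Pow I - B. bernoulli_weight I p S) \<le> \<eta>"
  shows "(\<Sum>x\<in>I. bin_entropy (p x)) \<le> ln (real (card B)) + 2 + \<eta> * (real (card I) * ln 2)"
proof -
  let ?b = "bernoulli_weight I p"
  have b: "0 \<le> ?b S" for S by (rule bernoulli_weight_nonneg) (use p in auto)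
  \<comment> \<open>Comparison with the constant weight 1/K; it is used with K = card B on
    \<open>B\<close> and with K = 2 ^ card I off \<open>B\<close>, where \<open>card C / K\<close>
    is at most 1.\<close>
  have xl: "(\<Sum>S\<in>C. - ?b S * ln (?b S)) \<le> (\<Sum>S\<in>C. ?b S) * ln K + real (card C) / K" if "0 < K" for K C
  proof -
    have "- ?b S * ln (?b S) \<le> ?b S * ln K + 1 / K" for S
      using mult_ln_le[OF b, of "1 / K" S] that b[of S] by (simp add: ln_div)
    then have "(\<Sum>S\<in>C. - ?b S * ln (?b S)) \<le> (\<Sum>S\<in>C. ?b S * ln K + 1 / K)" by (intro sum_mono)
    then show ?thesis by (simp add: sum.distrib sum_distrib_right)
  qed
  have fB: "finite B" using B I finite_subset by auto
  have "(\<Sum>S\<in>B. ?b S) \<le> 1"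
    using sum_mono2[of "Pow I" B ?b] B I b sum_bernoulli_weight[OF I] by simp
  have 1: "(\<Sum>S\<in>B. - ?b S * ln (?b S)) \<le> ln (real (card B)) + 1"
  proof (cases "B = {}")
    case False
    then have c: "1 \<le> card B" using fB by (simp add: Suc_le_eq card_gt_0_iff)
    have "(\<Sum>S\<in>B. ?b S) * ln (real (card B)) \<le> 1 * ln (real (card B))"
      using c by (intro mult_right_mono \<open>(\<Sum>S\<in>B. ?b S) \<le> 1\<close>) simp
    with xl[of "real (card B)" B] c show ?thesis by simp
  qed simp
  have r1: "(\<Sum>S\<in>Pow I - B. ?b S) * (real (card I) * ln 2) \<le> \<eta> * (real (card I) * ln 2)"
    by (intro mult_right_mono \<eta>) simp
  have r2: "real (card (Pow I - B)) / 2 ^ card I \<le> 1"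
  proof -
    have "card (Pow I - B) \<le> 2 ^ card I"
      using card_mono[of "Pow I" "Pow I - B"] I by (simp add: card_Pow)
    then have "real (card (Pow I - B)) \<le> real (2 ^ card I)" by (rule of_nat_mono)
    then show ?thesis by simp
  qed
  have 2: "(\<Sum>S\<in>Pow I - B. - ?b S * ln (?b S)) \<le> \<eta> * (real (card I) * ln 2) + 1"
  proof -
    have "ln (2 ^ card I :: real) = real (card I) * ln 2" by (simp add: ln_realpow)
    then have "(\<Sum>S\<in>Pow I - B. - ?b S * ln (?b S))
        \<le> (\<Sum>S\<in>Pow I - B. ?b S) * (real (card I) * ln 2) + real (card (Pow I - B)) / 2 ^ card I"
      using xl[of "2 ^ card I" "Pow I - B"] by simp
    then show ?thesis using r1 r2 by linarith
  qed
  have "(\<Sum>S\<in>Pow I. - ?b S * ln (?b S)) =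
      (\<Sum>S\<in>Pow I - B. - ?b S * ln (?b S)) + (\<Sum>S\<in>B. - ?b S * ln (?b S))"
    by (rule sum.subset_diff) (use B I in auto)
  then show ?thesis
    using 1 2 sum_xlogx_bernoulli_weight[OF I p] by simp
qed

text \<open>Subadditivity of entropy, obtained as nonnegativity of the relative entropy of the
  uniform measure on \<open>C\<close> with respect to the product of its marginals: the mean over
  \<open>C\<close> of ln (b S * M) is at most 0.\<close>

lemma ln_card_le_entropy:
  assumes I: "finite I" and C: "C \<subseteq> Pow I" "C \<noteq> {}"
    and p: "\<And>x. x \<in> I \<Longrightarrow> p x = real (card {S\<in>C. x \<in> S}) / real (card C)"
  shows "ln (real (card C)) \<le> (\<Sum>x\<in>I. bin_entropy (p x))"
proof -
  let ?b = "bernoulli_weight I p"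
  have fC: "finite C" using C I finite_subset by auto
  define M where "M = real (card C)"
  have M: "0 < M" using C(2) fC by (simp add: M_def card_gt_0_iff)
  have pM: "real (card {S\<in>C. x \<in> S}) = M * p x" "real (card {S\<in>C. x \<notin> S}) = M * (1 - p x)" if "x \<in> I" for x
  proof -
    show 1: "real (card {S\<in>C. x \<in> S}) = M * p x" using p[OF that] M by (simp add: M_def)
    have "card C = card ({S\<in>C. x \<in> S} \<union> {S\<in>C. x \<notin> S})" by (rule arg_cong[where f = card]) auto
    also have "\<dots> = card {S\<in>C. x \<in> S} + card {S\<in>C. x \<notin> S}"
      by (rule card_Un_disjoint) (use fC in auto)
    finally show "real (card {S\<in>C. x \<notin> S}) = M * (1 - p x)"
      using 1 by (simp add: M_def algebra_simps)
  qed
  have p01: "0 \<le> p x \<and> p x \<le> 1" if "x \<in> I" for x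
    using pM[OF that] M by (metis of_nat_0_le_iff zero_le_mult_iff not_less diff_ge_0_iff_ge less_le_not_le)
  \<comment> \<open>Every factor of the weight of a member \<open>S\<close> of \<open>C\<close> is
    witnessed by \<open>S\<close> itself, so no logarithm is taken at 0.\<close>
  have pos: "0 < (if x \<in> S then p x else 1 - p x)" if "x \<in> I" "S \<in> C" for x S
  proof -
    have "x \<in> S \<Longrightarrow> 0 < card {S\<in>C. x \<in> S}" "x \<notin> S \<Longrightarrow> 0 < card {S\<in>C. x \<notin> S}"
      using that fC by (auto simp: card_gt_0_iff)
    then show ?thesis
      using pM[OF that(1)] M by (smt (verit) of_nat_0_less_iff zero_less_mult_iff)
  qed
  have bpos: "0 < ?b S" if "S \<in> C" for S
    unfolding bernoulli_weight_def using pos that by (intro prod_pos) fast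
  have "(\<Sum>S\<in>C. ln (?b S * M)) \<le> (\<Sum>S\<in>C. ?b S * M - 1)"
    by (intro sum_mono ln_le_minus_one) (use bpos M in simp)
  also have "\<dots> = M * (\<Sum>S\<in>C. ?b S) - M"
    by (simp add: sum_subtractf sum_distrib_left M_def mult.commute)
  also have "(\<Sum>S\<in>C. ?b S) \<le> 1"
    using sum_mono2[of "Pow I" C ?b] C I bernoulli_weight_nonneg[of I p] p01 sum_bernoulli_weight[OF I, of p] by simp
  finally have 1: "(\<Sum>S\<in>C. ln (?b S * M)) \<le> 0" using M by simp
  have "(\<Sum>S\<in>C. ln (?b S * M)) = (\<Sum>S\<in>C. ln (?b S)) + M * ln M"
    using bpos M by (simp add: ln_mult_pos sum.distrib M_def)
  also have "(\<Sum>S\<in>C. ln (?b S)) = (\<Sum>S\<in>C. \<Sum>x\<in>I. if x \<in> S then ln (p x) else ln (1 - p x))"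
  proof (rule sum.cong)
    fix S assume "S \<in> C"
    then have "ln (?b S) = (\<Sum>x\<in>I. ln (if x \<in> S then p x else 1 - p x))"
      unfolding bernoulli_weight_def using pos by (intro ln_prod) (auto simp: less_le I split: if_splits)
    then show "ln (?b S) = (\<Sum>x\<in>I. if x \<in> S then ln (p x) else ln (1 - p x))"
      by (simp add: if_distrib)
  qed simp
  also have "\<dots> = (\<Sum>x\<in>I. \<Sum>S\<in>C. if x \<in> S then ln (p x) else ln (1 - p x))"
    by (rule sum.swap)
  also have "\<dots> = (\<Sum>x\<in>I. - M * bin_entropy (p x))"
  proof (rule sum.cong)
    fix x assume x: "x \<in> I"
    have "(\<Sum>S\<in>C. if x \<in> S then ln (p x) else ln (1 - p x)) =
      real (card {S\<in>C. x \<in> S}) * ln (p x) + real (card {S\<in>C. x \<notin> S}) * ln (1 - p x)"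
      by (simp add: sum.If_cases fC Int_def)
    then show "(\<Sum>S\<in>C. if x \<in> S then ln (p x) else ln (1 - p x)) = - M * bin_entropy (p x)"
      unfolding pM[OF x] by (simp add: bin_entropy_def algebra_simps)
  qed simp
  finally have "M * ln M \<le> M * (\<Sum>x\<in>I. bin_entropy (p x))"
    using 1 by (simp add: sum_distrib_left sum_negf)
  then show ?thesis using M by (simp add: M_def)
qed

section \<open>From a window of graphs to edge probabilities\<close>

text \<open>The 2 offsets the double counting of edges in the ordered sum: for an edge matrix,
  multiplication by \<open>n ^ 2\<close> gives the entropy of the random graph with independent
  edges, on the scale of \<open>log_count\<close>.\<close>

definition mean_entropy :: "nat \<Rightarrow> (nat \<Rightarrow> nat \<Rightarrow> real) \<Rightarrow> real" where
  "mean_entropy n a = (\<Sum>i<n. \<Sum>j<n. bin_entropy (a i j)) / (2 * real n ^ 2)"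

lemma sum_bin_entropy_edges:
  assumes "0 < n"
  shows "(\<Sum>S\<in>nsets {..<n} 2. bin_entropy (w S)) = mean_entropy n (edge_matrix w) * real n ^ 2"
proof -
  have "edge_matrix (\<lambda>S. bin_entropy (w S)) i j = bin_entropy (edge_matrix w i j)" for i j
    by (simp add: edge_matrix_def)
  then show ?thesis
    using assms sum_nsets_2[of "\<lambda>S. bin_entropy (w S)" n] by (simp add: mean_entropy_def)
qed

lemma exists_large_fibre:
  assumes "finite G" "G \<noteq> {}"
  shows "\<exists>a\<in>G. card G \<le> card (\<kappa> ` G) * card {b\<in>G. \<kappa> b = \<kappa> a}"
proof (rule ccontr)
  assume "\<not> ?thesis"
  then have H: "card (\<kappa> ` G) * card {b\<in>G. \<kappa> b = y} < card G" if "y \<in> \<kappa> ` G" for y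
    using that by (auto simp: not_le)
  have "(\<Sum>y\<in>\<kappa> ` G. card (\<kappa> ` G) * card {b\<in>G. \<kappa> b = y}) < (\<Sum>y\<in>\<kappa> ` G. card G)"
    by (rule sum_strict_mono) (use assms H in auto)
  moreover have "card G = (\<Sum>y\<in>\<kappa> ` G. card {b\<in>G. \<kappa> b = y})"
    using sum.image_gen[OF assms(1), of "\<lambda>_. 1::nat" \<kappa>] by simp
  ultimately show False by (simp flip: sum_distrib_left)
qed

text \<open>For fixed \<open>V\<close> this is the label of a graph in the partition by all edges at
  \<open>V\<close>; enlarging \<open>V\<close> refines the partition.\<close>

definition edges_meeting :: "'a set \<Rightarrow> 'a set set \<Rightarrow> 'a set set" where
  "edges_meeting V E = {S \<in> E. S \<inter> V \<noteq> {}}"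

text \<open>An edge meeting \<open>V\<close> is a pair {v, j} with \<open>v\<close> in
  \<open>V\<close> and \<open>j < n\<close>. There are at most \<open>K * n\<close> such pairs, and
  a label is a set of them.\<close>

lemma card_edges_meeting_image:
  assumes "G \<subseteq> simple_graphs n" "finite V" "card V \<le> K"
  shows "card (edges_meeting V ` G) \<le> 2 ^ (K * n)"
proof -
  define F where "F = (\<lambda>(v, j). {v, j}) ` (V \<times> {..<n})"
  have "S \<in> F" if "S \<in> edges_meeting V E" "E \<in> G" for S E
  proof -
    have "S \<in> nsets {..<n} 2" using that assms(1) by (auto simp: edges_meeting_def simple_graphs_def)
    then obtain x y where "S = {x, y}" "x < n" "y < n" by (auto simp: nsets_2_eq)
    moreover from this that have "x \<in> V \<or> y \<in> V" by (auto simp: edges_meeting_def)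
    ultimately have "S = (\<lambda>(v, j). {v, j}) (x, y) \<and> (x, y) \<in> V \<times> {..<n} \<or>
        S = (\<lambda>(v, j). {v, j}) (y, x) \<and> (y, x) \<in> V \<times> {..<n}" by auto
    then show ?thesis unfolding F_def by blast
  qed
  then have "edges_meeting V ` G \<subseteq> Pow F" by auto
  moreover have fF: "finite F" using assms(2) by (simp add: F_def)
  ultimately have "card (edges_meeting V ` G) \<le> 2 ^ card F"
    using card_mono[of "Pow F"] by (simp add: card_Pow)
  also have "(2::nat) ^ card F \<le> 2 ^ (K * n)"
  proof (rule power_increasing)
    have "card F \<le> card V * n"
      using card_image_le[of "V \<times> {..<n}" "\<lambda>(v, j). {v, j}"] assms(2)
      by (simp add: F_def card_cartesian_product)
    then show "card F \<le> K * n" using mult_le_mono1[OF assms(3), of n] by (rule le_trans)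
  qed simp
  finally show ?thesis .
qed

lemma adjacency_bounds: "0 \<le> adjacency E i j" "adjacency E i j \<le> 1"
  by (auto simp: edge_matrix_def)

text \<open>\<open>X\<close> is first separated from the product \<open>Y Z\<close>, using that
  \<open>\<mu>\<close> determines both factors; then \<open>Y\<close> is separated from
  \<open>Z\<close>, using that \<open>\<nu>\<close> determines \<open>Z\<close>. In the application
  these are the edges ij, ik, jk, with \<open>\<mu>\<close> revealing the edges at k and
  \<open>\<nu>\<close> those at j.\<close>

lemma cond_avg_triple_defect:
  fixes X :: "'a \<Rightarrow> real"
  assumes fin: "finite A" and a: "a \<in> A"
    and r1: "\<And>a b. \<mu> a = \<mu> b \<Longrightarrow> \<kappa> a = \<kappa> b" and r2: "\<And>a b. \<nu> a = \<nu> b \<Longrightarrow> \<kappa> a = \<kappa> b"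
    and Y1: "\<And>a b. \<mu> a = \<mu> b \<Longrightarrow> Y a = Y b"
    and Z1: "\<And>a b. \<mu> a = \<mu> b \<Longrightarrow> Z a = Z b"
    and Z2: "\<And>a b. \<nu> a = \<nu> b \<Longrightarrow> Z a = Z b"
    and X01: "\<And>a. 0 \<le> X a" "\<And>a. X a \<le> 1" and Y01: "\<And>a. 0 \<le> Y a" "\<And>a. Y a \<le> 1"
    and Z01: "\<And>a. 0 \<le> Z a" "\<And>a. Z a \<le> 1"
  shows "\<bar>cond_avg A \<kappa> (\<lambda>b. X b * Y b * Z b) a - cond_avg A \<kappa> X a * cond_avg A \<kappa> Y a * cond_avg A \<kappa> Z a\<bar>
    \<le> cond_avg A \<kappa> (\<lambda>b. \<bar>cond_avg A \<mu> X b - cond_avg A \<kappa> X b\<bar>) a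
     + cond_avg A \<kappa> (\<lambda>b. \<bar>cond_avg A \<nu> Y b - cond_avg A \<kappa> Y b\<bar>) a"
proof -
  let ?c = "\<lambda>f. cond_avg A \<kappa> f a"
  have "\<bar>?c (\<lambda>b. (Y b * Z b) * X b) - ?c X * ?c (\<lambda>b. Y b * Z b)\<bar>
      \<le> ?c (\<lambda>b. \<bar>cond_avg A \<mu> X b - cond_avg A \<kappa> X b\<bar>)"
  proof (rule cond_avg_decorrelate[OF fin r1 a])
    show "Y b * Z b = Y b' * Z b'" if "\<mu> b = \<mu> b'" for b b'
      using Y1[OF that] Z1[OF that] by simp
    show "\<bar>Y b * Z b\<bar> \<le> 1" for b
      using Y01[of b] Z01[of b] by (simp add: mult_le_one)
  qed
  moreover have "\<bar>?c (\<lambda>b. Z b * Y b) - ?c Y * ?c Z\<bar> \<le> ?c (\<lambda>b. \<bar>cond_avg A \<nu> Y b - cond_avg A \<kappa> Y b\<bar>)"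
  proof (rule cond_avg_decorrelate[OF fin r2 a])
    show "Z b = Z b'" if "\<nu> b = \<nu> b'" for b b'
      by (rule Z2[OF that])
    show "\<bar>Z b\<bar> \<le> 1" for b
      using Z01[of b] by simp
  qed
  moreover have "\<bar>?c X * ?c (\<lambda>b. Y b * Z b) - ?c X * (?c Y * ?c Z)\<bar> \<le> \<bar>?c (\<lambda>b. Z b * Y b) - ?c Y * ?c Z\<bar>"
  proof -
    have "0 \<le> ?c X" "?c X \<le> 1" using cond_avg_bounds[OF fin a, of 0 X 1] X01 by auto
    then have "\<bar>?c X\<bar> * \<bar>?c (\<lambda>b. Y b * Z b) - ?c Y * ?c Z\<bar> \<le> \<bar>?c (\<lambda>b. Y b * Z b) - ?c Y * ?c Z\<bar>"
      by (intro mult_left_le_one_le) auto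
    moreover have "(\<lambda>b. Z b * Y b) = (\<lambda>b. Y b * Z b)" by (simp add: mult.commute)
    ultimately show ?thesis by (simp add: abs_mult flip: right_diff_distrib)
  qed
  moreover have "(\<lambda>b. (Y b * Z b) * X b) = (\<lambda>b. X b * Y b * Z b)"
    by (simp add: mult_ac)
  ultimately show ?thesis by (simp add: mult.assoc)
qed

text \<open>Energy increment: the classes record all edges at a bounded set \<open>V\<close> of vertices, chosen so that
  adding a random vertex \<open>k\<close> barely increases the mean square of the conditional edge probabilities.
  Since the edges at \<open>k\<close> become known, the edge \<open>ij\<close> is nearly uncorrelated with \<open>ik\<close> and \<open>jk\<close>
  within most classes. There are only \<open>2 ^ O(n)\<close> classes, so a large class costs no entropy.\<close>

lemma exists_decorrelated_class:
  assumes A: "A \<subseteq> simple_graphs n" "A \<noteq> {}" and n: "0 < n"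
    and \<epsilon>: "0 < \<epsilon>" and K: "0 < K" "1 / real K \<le> \<epsilon>\<^sup>2"
  obtains C where "C \<subseteq> A" "C \<noteq> {}" "card A \<le> 2 * 2 ^ (K * n) * card C"
    "\<bar>(\<Sum>E\<in>C. hom_tri n (adjacency E)) / real (card C)
      - hom_tri n (edge_matrix (\<lambda>S. real (card {E\<in>C. S \<in> E}) / real (card C)))\<bar> \<le> 4 * \<epsilon>"
proof -
  have fA: "finite A" using A finite_simple_graphs finite_subset by blast
  define M where "M = real (card A)"
  have M: "0 < M" using A fA by (simp add: M_def card_gt_0_iff)
  define P where "P V i j E = cond_avg A (edges_meeting V) (\<lambda>E. adjacency E i j) E" for V :: "nat set" and i j E
  have P01: "0 \<le> P V i j E" "P V i j E \<le> 1" if "E \<in> A" for V i j E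
    unfolding P_def using cond_avg_bounds[OF fA that, of 0 "\<lambda>E. adjacency E i j" 1] adjacency_bounds by auto
  have Psq: "(P V i j E)\<^sup>2 \<le> 1" if "E \<in> A" for V i j E
    using P01[OF that] by (simp add: power_le_one)
  \<comment> \<open>The energy to be incremented. Conditional probabilities lie in [0, 1], which
    bounds it by \<open>n ^ 2 * M\<close>.\<close>
  define Q where "Q V = (\<Sum>i<n. \<Sum>j<n. \<Sum>E\<in>A. (P V i j E)\<^sup>2)" for V
  have Q0: "0 \<le> Q V" for V by (simp add: Q_def sum_nonneg)
  have Q1: "Q V \<le> real n ^ 2 * M" for V
  proof -
    have "Q V \<le> (\<Sum>i<n. \<Sum>j<n. \<Sum>E\<in>A. 1)"
      unfolding Q_def by (intro sum_mono Psq)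
    then show ?thesis by (simp add: M_def power2_eq_square mult.assoc)
  qed
  obtain V where V: "finite V" "card V \<le> K"
    "(\<Sum>k<n. Q (insert k V) - Q V) \<le> real n * (real n ^ 2 * M / real K)"
    using exists_set_small_increment[of Q "real n ^ 2 * M" K n] Q0 Q1 K n M by auto
  define \<kappa> where "\<kappa> = edges_meeting V"
  have refine: "\<kappa> E = \<kappa> E'" if "edges_meeting (insert k V) E = edges_meeting (insert k V) E'" for k E E'
    using that unfolding \<kappa>_def edges_meeting_def by blast
  have meas: "adjacency E i k = adjacency E' i k" "adjacency E k i = adjacency E' k i"
    if "edges_meeting (insert k V) E = edges_meeting (insert k V) E'" for i k E E'
  proof -
    have "{i, k} \<in> E \<longleftrightarrow> {i, k} \<in> edges_meeting (insert k V) E" for E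
      by (auto simp: edges_meeting_def)
    then have "{i, k} \<in> E \<longleftrightarrow> {i, k} \<in> E'" using that by metis
    then show "adjacency E i k = adjacency E' i k" "adjacency E k i = adjacency E' k i"
      by (auto simp: edge_matrix_def insert_commute)
  qed
  define d where "d k i j = (\<Sum>E\<in>A. \<bar>P (insert k V) i j E - P V i j E\<bar>)" for k i j
  have d_le: "d k i j \<le> M * \<epsilon> / 2 + ((\<Sum>E\<in>A. (P (insert k V) i j E)\<^sup>2) - (\<Sum>E\<in>A. (P V i j E)\<^sup>2)) / (2 * \<epsilon>)" for k i j
  proof -
    \<comment> \<open>Weighted arithmetic-geometric mean inequality, passing from absolute
      differences to squares, which Pythagoras turns into energy increments. As \<open>1 / K\<close>
      is at most the square of \<open>\<epsilon>\<close>, after summation both terms are at most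
      \<open>n ^ 3 * M * \<epsilon> / 2\<close>.\<close>
    have amgm: "\<bar>x\<bar> \<le> \<epsilon> / 2 + x\<^sup>2 / (2 * \<epsilon>)" for x
    proof -
      have "0 \<le> (\<bar>x\<bar> - \<epsilon>)\<^sup>2" by simp
      then have "2 * \<epsilon> * \<bar>x\<bar> \<le> \<epsilon>\<^sup>2 + x\<^sup>2" by (simp add: power2_diff mult_ac)
      then show ?thesis using \<epsilon> by (simp add: field_simps power2_eq_square)
    qed
    have "d k i j \<le> (\<Sum>E\<in>A. \<epsilon> / 2 + (P (insert k V) i j E - P V i j E)\<^sup>2 / (2 * \<epsilon>))"
      unfolding d_def by (intro sum_mono amgm)
    also have "\<dots> = M * \<epsilon> / 2 + (\<Sum>E\<in>A. (P (insert k V) i j E - P V i j E)\<^sup>2) / (2 * \<epsilon>)"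
      by (simp add: sum.distrib sum_divide_distrib M_def)
    also have "(\<Sum>E\<in>A. (P (insert k V) i j E - P V i j E)\<^sup>2)
        = (\<Sum>E\<in>A. (P (insert k V) i j E)\<^sup>2) - (\<Sum>E\<in>A. (P V i j E)\<^sup>2)"
      unfolding P_def \<kappa>_def[symmetric] by (rule sum_power2_cond_avg_diff[OF fA refine])
    finally show ?thesis .
  qed
  define T where "T = (\<Sum>k<n. \<Sum>i<n. \<Sum>j<n. d k i j)"
  have "T \<le> (\<Sum>k<n. \<Sum>i<n. \<Sum>j<n. M * \<epsilon> / 2 + ((\<Sum>E\<in>A. (P (insert k V) i j E)\<^sup>2) - (\<Sum>E\<in>A. (P V i j E)\<^sup>2)) / (2 * \<epsilon>))"
    unfolding T_def by (intro sum_mono d_le)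
  also have "\<dots> = real n ^ 3 * M * \<epsilon> / 2 + (\<Sum>k<n. Q (insert k V) - Q V) / (2 * \<epsilon>)"
    by (simp add: sum.distrib Q_def sum_subtractf power3_eq_cube flip: sum_divide_distrib)
  also have "(\<Sum>k<n. Q (insert k V) - Q V) / (2 * \<epsilon>) \<le> (real n ^ 3 * M * \<epsilon>\<^sup>2) / (2 * \<epsilon>)"
  proof (rule divide_right_mono)
    have "real n ^ 3 * M * (1 / real K) \<le> real n ^ 3 * M * \<epsilon>\<^sup>2"
      using M by (intro mult_left_mono K) auto
    with V(3) show "(\<Sum>k<n. Q (insert k V) - Q V) \<le> real n ^ 3 * M * \<epsilon>\<^sup>2"
      by (simp add: power3_eq_cube power2_eq_square mult.assoc)
  qed (use \<epsilon> in simp)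
  also have "(real n ^ 3 * M * \<epsilon>\<^sup>2) / (2 * \<epsilon>) = real n ^ 3 * M * \<epsilon> / 2"
    using \<epsilon> by (simp add: power2_eq_square)
  finally have T: "T \<le> real n ^ 3 * M * \<epsilon>" by (simp add: mult_ac)

  define tri where "tri a = (\<Sum>i<n. \<Sum>j<n. \<Sum>k<n. a i j * a i k * a j k)" for a :: "nat \<Rightarrow> nat \<Rightarrow> real"
  define D where "D E = \<bar>cond_avg A \<kappa> (\<lambda>E. tri (adjacency E)) E - tri (\<lambda>i j. P V i j E)\<bar>" for E
  have D_le: "D E \<le> (\<Sum>i<n. \<Sum>j<n. \<Sum>k<n. cond_avg A \<kappa> (\<lambda>E. \<bar>P (insert k V) i j E - P V i j E\<bar>) E
      + cond_avg A \<kappa> (\<lambda>E. \<bar>P (insert j V) i k E - P V i k E\<bar>) E)" (is "_ \<le> ?R") if E: "E \<in> A" for E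
  proof -
    have "D E = \<bar>\<Sum>i<n. \<Sum>j<n. \<Sum>k<n. cond_avg A \<kappa> (\<lambda>E. adjacency E i j * adjacency E i k * adjacency E j k) E
        - P V i j E * P V i k E * P V j k E\<bar>"
      by (simp add: D_def tri_def cond_avg_sum sum_subtractf)
    also have "\<dots> \<le> (\<Sum>i<n. \<Sum>j<n. \<Sum>k<n. \<bar>cond_avg A \<kappa> (\<lambda>E. adjacency E i j * adjacency E i k * adjacency E j k) E
        - P V i j E * P V i k E * P V j k E\<bar>)"
      by (intro order.trans[OF sum_abs] sum_mono order.refl)
    also have "\<dots> \<le> ?R"
    proof (intro sum_mono)
      fix i j k
      show "\<bar>cond_avg A \<kappa> (\<lambda>E. adjacency E i j * adjacency E i k * adjacency E j k) E
        - P V i j E * P V i k E * P V j k E\<bar> \<le> cond_avg A \<kappa> (\<lambda>E. \<bar>P (insert k V) i j E - P V i j E\<bar>) E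
      + cond_avg A \<kappa> (\<lambda>E. \<bar>P (insert j V) i k E - P V i k E\<bar>) E"
        unfolding P_def \<kappa>_def[symmetric]
        by (rule cond_avg_triple_defect[OF fA E, where \<mu> = "edges_meeting (insert k V)" and \<nu> = "edges_meeting (insert j V)"])
          (rule refine meas adjacency_bounds; assumption)+
    qed
    finally show ?thesis .
  qed
  have "(\<Sum>E\<in>A. D E) \<le> (\<Sum>E\<in>A. \<Sum>i<n. \<Sum>j<n. \<Sum>k<n. cond_avg A \<kappa> (\<lambda>E. \<bar>P (insert k V) i j E - P V i j E\<bar>) E
      + cond_avg A \<kappa> (\<lambda>E. \<bar>P (insert j V) i k E - P V i k E\<bar>) E)"
    by (intro sum_mono D_le)
  also have "\<dots> = (\<Sum>i<n. \<Sum>j<n. \<Sum>k<n. d k i j + d j i k)"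
    unfolding sum.swap[of _ _ A] sum.distrib sum_cond_avg[OF fA] d_def ..
  also have "\<dots> = (\<Sum>i<n. \<Sum>j<n. \<Sum>k<n. d k i j) + (\<Sum>i<n. \<Sum>j<n. \<Sum>k<n. d j i k)"
    by (simp add: sum.distrib)
  also have "(\<Sum>i<n. \<Sum>j<n. \<Sum>k<n. d j i k) = T"
    unfolding T_def by (rule sum.swap)
  also have "(\<Sum>i<n. \<Sum>j<n. \<Sum>k<n. d k i j) = (\<Sum>i<n. \<Sum>k<n. \<Sum>j<n. d k i j)"
    by (intro sum.cong refl sum.swap)
  also have "\<dots> = T" unfolding T_def by (rule sum.swap)
  finally have sumD: "(\<Sum>E\<in>A. D E) \<le> 2 * (real n ^ 3 * M * \<epsilon>)" using T by simp

  \<comment> \<open>Markov's inequality: the mean of \<open>D\<close> over \<open>A\<close> is at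
    most \<open>2 * \<epsilon> * n ^ 3\<close>, so at least half of \<open>A\<close> stays below
    twice this value.\<close>
  define G where "G = {E\<in>A. D E \<le> 4 * \<epsilon> * real n ^ 3}"
  have fG: "finite G" and GA: "G \<subseteq> A" using fA by (auto simp: G_def)
  have "real (card (A - G)) * (4 * \<epsilon> * real n ^ 3) = (\<Sum>E\<in>A - G. 4 * \<epsilon> * real n ^ 3)" by simp
  also have "\<dots> \<le> (\<Sum>E\<in>A - G. D E)" by (intro sum_mono) (auto simp: G_def)
  also have "\<dots> \<le> (\<Sum>E\<in>A. D E)" by (intro sum_mono2 fA) (auto simp: D_def)
  also have "\<dots> \<le> M / 2 * (4 * \<epsilon> * real n ^ 3)" using sumD by (simp add: mult_ac)
  finally have "real (card (A - G)) \<le> M / 2"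
    using \<epsilon> n by (subst (asm) mult_le_cancel_right) auto
  moreover have "card A = card G + card (A - G)"
    using card_Un_disjoint[of G "A - G"] fA GA fG by (simp add: Un_absorb1)
  ultimately have G_half: "card A \<le> 2 * card G" by (simp add: M_def)
  then have "G \<noteq> {}" using M by (auto simp: M_def)
  with exists_large_fibre[OF fG, of \<kappa>] obtain E0 where E0: "E0 \<in> G"
    "card G \<le> card (\<kappa> ` G) * card {E\<in>G. \<kappa> E = \<kappa> E0}" by blast
  \<comment> \<open>The full class inside \<open>A\<close>, not only its part in \<open>G\<close>:
    the averages in \<open>D E0\<close> run over this class, so \<open>P V i j E0\<close> is exactly
    the edge frequency in \<open>C\<close>.\<close>
  define C where "C = {E\<in>A. \<kappa> E = \<kappa> E0}"
  have "card {E\<in>G. \<kappa> E = \<kappa> E0} \<le> card C"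
    unfolding C_def by (rule card_mono) (use fA GA in auto)
  moreover have "card (\<kappa> ` G) \<le> 2 ^ (K * n)"
    unfolding \<kappa>_def by (rule card_edges_meeting_image) (use GA A V in auto)
  ultimately have "card G \<le> 2 ^ (K * n) * card C"
    using E0(2) mult_le_mono le_trans by blast
  then have big: "card A \<le> 2 * 2 ^ (K * n) * card C" using G_half by simp
  define p where "p S = real (card {E\<in>C. S \<in> E}) / real (card C)" for S
  have fC: "finite C" using fA by (simp add: C_def)
  have Pp: "P V i j E0 = edge_matrix p i j" for i j
  proof (cases "i = j")
    case False
    have "(\<Sum>E\<in>C. of_bool ({i, j} \<in> E)) = real (card {E\<in>C. {i, j} \<in> E})"
      by (subst sum_of_bool_eq) (auto simp: fC Int_def)
    then show ?thesis
      using False by (simp add: P_def cond_avg_def edge_matrix_def p_def C_def \<kappa>_def)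
  qed (simp add: P_def cond_avg_def edge_matrix_def)
  have "\<bar>(\<Sum>E\<in>C. tri (adjacency E)) / real (card C) - tri (edge_matrix p)\<bar> \<le> 4 * \<epsilon> * real n ^ 3"
    using E0(1) by (simp add: G_def D_def cond_avg_def C_def[symmetric] Pp)
  then have "\<bar>((\<Sum>E\<in>C. tri (adjacency E)) / real (card C) - tri (edge_matrix p)) / real n ^ 3\<bar> \<le> 4 * \<epsilon>"
    using n by (simp add: field_simps)
  moreover have "((\<Sum>E\<in>C. tri (adjacency E)) / real (card C) - tri (edge_matrix p)) / real n ^ 3
    = (\<Sum>E\<in>C. hom_tri n (adjacency E)) / real (card C) - hom_tri n (edge_matrix p)"
    by (simp add: hom_tri_def tri_def diff_divide_distrib mult.commute flip: sum_divide_distrib)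
  ultimately have "\<bar>(\<Sum>E\<in>C. hom_tri n (adjacency E)) / real (card C) - hom_tri n (edge_matrix p)\<bar> \<le> 4 * \<epsilon>"
    by simp
  moreover have "C \<subseteq> A" "C \<noteq> {}" using E0(1) GA by (auto simp: C_def)
  ultimately show thesis using that big unfolding p_def by blast
qed

section \<open>Counting graphs by the entropy of edge probabilities\<close>

lemma hom_edge_diff_le:
  "\<bar>hom_edge n a - hom_edge n b\<bar> \<le> (\<Sum>i<n. \<Sum>j<n. \<bar>a i j - b i j\<bar>) / real n ^ 2"
proof -
  have "hom_edge n a - hom_edge n b = (\<Sum>i<n. \<Sum>j<n. a i j - b i j) / real n ^ 2"
    by (simp add: hom_edge_def sum_subtractf diff_divide_distrib)
  also have "\<bar>\<dots>\<bar> = \<bar>\<Sum>i<n. \<Sum>j<n. a i j - b i j\<bar> / real n ^ 2" by simp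
  also have "\<dots> \<le> (\<Sum>i<n. \<Sum>j<n. \<bar>a i j - b i j\<bar>) / real n ^ 2"
    by (intro divide_right_mono order.trans[OF sum_abs] sum_mono order.refl) auto
  finally show ?thesis .
qed

text \<open>Products of three numbers in [-1, 1] telescope into three single differences; each
  involves two of the three indices, so the free index contributes a factor
  \<open>n\<close>.\<close>

lemma hom_tri_diff_le:
  assumes "\<And>i j. \<bar>a i j\<bar> \<le> 1" "\<And>i j. \<bar>b i j\<bar> \<le> 1"
  shows "\<bar>hom_tri n a - hom_tri n b\<bar> \<le> 3 * (\<Sum>i<n. \<Sum>j<n. \<bar>a i j - b i j\<bar>) / real n ^ 2"
proof -
  define d where "d i j = \<bar>a i j - b i j\<bar>" for i j
  have tri: "\<bar>x * y * z - x' * y' * z'\<bar> \<le> \<bar>x - x'\<bar> + \<bar>y - y'\<bar> + \<bar>z - z'\<bar>"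
    if "\<bar>x'\<bar> \<le> 1" "\<bar>y\<bar> \<le> 1" "\<bar>z\<bar> \<le> 1" "\<bar>y'\<bar> \<le> 1" for x y z x' y' z' :: real
  proof -
    have "x * y * z - x' * y' * z' = (y * z) * (x - x') + (x' * z) * (y - y') + (x' * y') * (z - z')"
      by (simp add: algebra_simps)
    moreover have "\<bar>(u * v) * w\<bar> \<le> \<bar>w\<bar>" if "\<bar>u\<bar> \<le> 1" "\<bar>v\<bar> \<le> 1" for u v w :: real
      unfolding abs_mult[of "u * v"] by (rule mult_left_le_one_le) (use that in \<open>auto simp: abs_mult mult_le_one\<close>)
    from this[of y z "x - x'"] this[of x' z "y - y'"] this[of x' y' "z - z'"] that
    have "\<bar>(y * z) * (x - x')\<bar> \<le> \<bar>x - x'\<bar>" "\<bar>(x' * z) * (y - y')\<bar> \<le> \<bar>y - y'\<bar>"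
      "\<bar>(x' * y') * (z - z')\<bar> \<le> \<bar>z - z'\<bar>" by auto
    ultimately show ?thesis by linarith
  qed
  have "\<bar>(\<Sum>i<n. \<Sum>j<n. \<Sum>k<n. a i j * a i k * a j k) - (\<Sum>i<n. \<Sum>j<n. \<Sum>k<n. b i j * b i k * b j k)\<bar>
      = \<bar>\<Sum>i<n. \<Sum>j<n. \<Sum>k<n. a i j * a i k * a j k - b i j * b i k * b j k\<bar>"
    by (simp add: sum_subtractf)
  also have "\<dots> \<le> (\<Sum>i<n. \<Sum>j<n. \<Sum>k<n. \<bar>a i j * a i k * a j k - b i j * b i k * b j k\<bar>)"
    by (intro order.trans[OF sum_abs] sum_mono order.refl)
  also have "\<dots> \<le> (\<Sum>i<n. \<Sum>j<n. \<Sum>k<n. d i j + d i k + d j k)"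
    unfolding d_def by (intro sum_mono tri assms)
  also have "\<dots> = (\<Sum>i<n. \<Sum>j<n. real n * d i j) + (\<Sum>i<n. real n * (\<Sum>k<n. d i k)) + real n * (\<Sum>j<n. \<Sum>k<n. d j k)"
    by (simp add: sum.distrib)
  also have "\<dots> = 3 * real n * (\<Sum>i<n. \<Sum>j<n. d i j)"
    by (simp flip: sum_distrib_left)
  finally have "\<bar>(\<Sum>i<n. \<Sum>j<n. \<Sum>k<n. a i j * a i k * a j k) - (\<Sum>i<n. \<Sum>j<n. \<Sum>k<n. b i j * b i k * b j k)\<bar> / real n ^ 3
      \<le> 3 * real n * (\<Sum>i<n. \<Sum>j<n. d i j) / real n ^ 3"
    by (intro divide_right_mono) auto
  then show ?thesis
    by (cases "n = 0")
      (simp_all add: hom_tri_def d_def power3_eq_cube power2_eq_square flip: diff_divide_distrib)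
qed

lemma edge_matrix_bounds:
  "(\<And>S. 0 \<le> w S \<and> w S \<le> 1) \<Longrightarrow> 0 \<le> edge_matrix w i j \<and> edge_matrix w i j \<le> 1"
  by (simp add: edge_matrix_def)

lemma adjacency_flip_edge:
  "(\<Sum>i<n. \<Sum>j<n. \<bar>adjacency (insert x S) i j - adjacency (S - {x}) i j\<bar>) \<le> 2"
proof (cases "x \<in> nsets {..<n} 2")
  case True
  then obtain u v where uv: "x = {u, v}" "u \<noteq> v" "u < n" "v < n"
    by (auto simp: nsets_2_eq)
  have "(\<Sum>i<n. \<Sum>j<n. \<bar>adjacency (insert x S) i j - adjacency (S - {x}) i j\<bar>)
    = (\<Sum>i<n. \<Sum>j<n. (if i = u then if j = v then 1 else 0 else 0) + (if i = v then if j = u then 1 else 0 else 0))"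
    by (intro sum.cong) (use uv in \<open>auto simp: edge_matrix_def doubleton_eq_iff\<close>)
  also have "\<dots> = (\<Sum>i<n. (if i = u then 1 else 0) + (if i = v then 1 else 0))"
    by (intro sum.cong) (use uv in \<open>auto simp: sum.distrib\<close>)
  also have "\<dots> = 2" using uv by (simp add: sum.distrib)
  finally show ?thesis by simp
next
  case False
  have "(\<Sum>i<n. \<Sum>j<n. \<bar>adjacency (insert x S) i j - adjacency (S - {x}) i j\<bar>) = 0"
    by (intro sum.neutral ballI) (use False in \<open>auto simp: edge_matrix_def\<close>)
  then show ?thesis by simp
qed

lemma expect_adjacency:
  assumes "i < n" "j < n"
  shows "expect (nsets {..<n} 2) w (\<lambda>E. adjacency E i j) = edge_matrix w i j"
proof (cases "i = j")
  case False
  then have "(\<lambda>E. adjacency E i j) = (\<lambda>E. of_bool ({{i, j}} \<subseteq> E))"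
    by (simp add: edge_matrix_def)
  moreover have "expect (nsets {..<n} 2) w (\<lambda>E. of_bool ({{i, j}} \<subseteq> E)) = (\<Prod>x\<in>{{i, j}}. w x)"
    by (rule expect_superset) (use False assms in \<open>auto simp: finite_imp_finite_nsets\<close>)
  ultimately show ?thesis using False by (simp add: edge_matrix_def)
qed (simp add: edge_matrix_def expect_const finite_imp_finite_nsets)

lemma expect_adjacency_triangle:
  assumes "i < n" "j < n" "k < n"
  shows "expect (nsets {..<n} 2) w (\<lambda>E. adjacency E i j * adjacency E i k * adjacency E j k)
    = edge_matrix w i j * edge_matrix w i k * edge_matrix w j k"
proof (cases "i = j \<or> i = k \<or> j = k")
  case False
  then have "(\<lambda>E. adjacency E i j * adjacency E i k * adjacency E j k :: real)
      = (\<lambda>E. of_bool ({{i, j}, {i, k}, {j, k}} \<subseteq> E))"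
    by (auto simp: edge_matrix_def fun_eq_iff)
  moreover have "expect (nsets {..<n} 2) w (\<lambda>E. of_bool ({{i, j}, {i, k}, {j, k}} \<subseteq> E))
      = (\<Prod>x\<in>{{i, j}, {i, k}, {j, k}}. w x)"
    by (rule expect_superset) (use False assms in \<open>auto simp: finite_imp_finite_nsets\<close>)
  ultimately show ?thesis
    using False by (auto simp: edge_matrix_def doubleton_eq_iff)
qed (auto simp: edge_matrix_def expect_const finite_imp_finite_nsets)

lemma expect_hom_edge:
  "expect (nsets {..<n} 2) w (\<lambda>E. hom_edge n (adjacency E)) = hom_edge n (edge_matrix w)"
  unfolding hom_edge_def by (simp add: expect_divide expect_sum expect_adjacency)

lemma expect_hom_tri:
  "expect (nsets {..<n} 2) w (\<lambda>E. hom_tri n (adjacency E)) = hom_tri n (edge_matrix w)"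
  unfolding hom_tri_def by (simp add: expect_divide expect_sum expect_adjacency_triangle)

lemma chebyshev_expect:
  assumes I: "finite I" and p: "\<And>x. x \<in> I \<Longrightarrow> 0 \<le> p x \<and> p x \<le> 1" and r: "0 < r"
    and f: "\<And>x S. x \<in> I \<Longrightarrow> S \<subseteq> I \<Longrightarrow> \<bar>f (insert x S) - f (S - {x})\<bar> \<le> c"
  shows "(\<Sum>S\<in>{S \<in> Pow I. r \<le> \<bar>f S - expect I p f\<bar>}. bernoulli_weight I p S) \<le> real (card I) * c\<^sup>2 / r\<^sup>2"
proof -
  let ?b = "bernoulli_weight I p"
  have b: "0 \<le> ?b S" for S by (rule bernoulli_weight_nonneg) (use p in auto)
  have "(\<Sum>S\<in>{S \<in> Pow I. r \<le> \<bar>f S - expect I p f\<bar>}. ?b S)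
      \<le> (\<Sum>S\<in>{S \<in> Pow I. r \<le> \<bar>f S - expect I p f\<bar>}. ?b S * ((f S - expect I p f)\<^sup>2 / r\<^sup>2))"
  proof (rule sum_mono)
    fix S assume "S \<in> {S \<in> Pow I. r \<le> \<bar>f S - expect I p f\<bar>}"
    then have "r\<^sup>2 \<le> (f S - expect I p f)\<^sup>2"
      using r by (simp add: abs_le_square_iff[symmetric])
    then have "1 \<le> (f S - expect I p f)\<^sup>2 / r\<^sup>2" using r by simp
    from mult_left_mono[OF this b[of S]]
    show "?b S \<le> ?b S * ((f S - expect I p f)\<^sup>2 / r\<^sup>2)" by simp
  qed
  also have "\<dots> \<le> (\<Sum>S\<in>Pow I. ?b S * ((f S - expect I p f)\<^sup>2 / r\<^sup>2))"
    by (intro sum_mono2) (use I b in auto)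
  also have "\<dots> = expect I p (\<lambda>S. (f S - expect I p f)\<^sup>2) / r\<^sup>2"
    unfolding expect_divide[symmetric] by (simp add: expect_def)
  also have "\<dots> \<le> real (card I) * c\<^sup>2 / r\<^sup>2"
    using variance_bounded_differences[OF I p f] by (intro divide_right_mono) auto
  finally show ?thesis .
qed

lemma finite_window:
  "finite {E \<in> simple_graphs n. P E}"
  using finite_simple_graphs by auto

text \<open>Flipping an edge alters two matrix entries and hence each density by at most 6/n^2, so
  with at most n^2/2 edges the variances are at most 18/n^2. Chebyshev for both densities leaves
  exceptional mass at most 36/(n * \<delta>)^2. Multiplied by the maximal entropy, of order n^2,
  this costs only a constant.\<close>

lemma exists_typical_set:
  assumes n: "0 < n" and w: "\<And>S. 0 \<le> w S \<and> w S \<le> 1" and \<delta>: "0 < \<delta>" and big: "36 < (real n * \<delta>)\<^sup>2"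
  defines "B \<equiv> {E \<in> simple_graphs n. \<bar>hom_edge n (adjacency E) - hom_edge n (edge_matrix w)\<bar> < \<delta>
      \<and> \<bar>hom_tri n (adjacency E) - hom_tri n (edge_matrix w)\<bar> < \<delta>}"
  shows "B \<noteq> {}" "mean_entropy n (edge_matrix w) * real n ^ 2 \<le> ln (real (card B)) + 2 + 36 / \<delta>\<^sup>2"
proof -
  define I where "I = nsets {..<n} (2::nat)"
  have I: "finite I" by (simp add: I_def finite_imp_finite_nsets)
  have cI: "2 * real (card I) \<le> real n ^ 2"
    using real_choose_2[of n] by (simp add: I_def card_nsets power2_eq_square algebra_simps)
  define b where "b = bernoulli_weight I w"
  have b: "0 \<le> b S" for S unfolding b_def by (rule bernoulli_weight_nonneg) (use w in auto)
  define f g where "f E = hom_edge n (adjacency E)" and "g E = hom_tri n (adjacency E)" for E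
  have ef: "expect I w f = hom_edge n (edge_matrix w)" "expect I w g = hom_tri n (edge_matrix w)"
    unfolding f_def g_def I_def by (rule expect_hom_edge expect_hom_tri)+
  have abs1: "\<bar>adjacency E i j\<bar> \<le> 1" for E i j
    using adjacency_bounds[of E i j] by simp
  have df: "\<bar>f (insert x S) - f (S - {x})\<bar> \<le> 6 / real n ^ 2" for x S
  proof -
    have "\<bar>f (insert x S) - f (S - {x})\<bar> \<le> (\<Sum>i<n. \<Sum>j<n. \<bar>adjacency (insert x S) i j - adjacency (S - {x}) i j\<bar>) / real n ^ 2"
      unfolding f_def by (rule hom_edge_diff_le)
    also have "\<dots> \<le> 6 / real n ^ 2"
      using adjacency_flip_edge[where n = n and x = x and S = S] by (intro divide_right_mono) auto
    finally show ?thesis .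
  qed
  have dg: "\<bar>g (insert x S) - g (S - {x})\<bar> \<le> 6 / real n ^ 2" for x S
  proof -
    have "\<bar>g (insert x S) - g (S - {x})\<bar> \<le> 3 * (\<Sum>i<n. \<Sum>j<n. \<bar>adjacency (insert x S) i j - adjacency (S - {x}) i j\<bar>) / real n ^ 2"
      unfolding g_def by (rule hom_tri_diff_le) (rule abs1)+
    also have "\<dots> \<le> 6 / real n ^ 2"
      using adjacency_flip_edge[where n = n and x = x and S = S] by (intro divide_right_mono) auto
    finally show ?thesis .
  qed
  define F G where "F = {S \<in> Pow I. \<delta> \<le> \<bar>f S - expect I w f\<bar>}"
    and "G = {S \<in> Pow I. \<delta> \<le> \<bar>g S - expect I w g\<bar>}"
  have var: "real (card I) * (6 / real n ^ 2)\<^sup>2 / \<delta>\<^sup>2 \<le> 18 / (real n ^ 2 * \<delta>\<^sup>2)"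
  proof -
    have "real (card I) * (6 / real n ^ 2)\<^sup>2 / \<delta>\<^sup>2 = (2 * real (card I)) * (18 / (real n ^ 4 * \<delta>\<^sup>2))"
      by (simp add: power_divide)
    also have "\<dots> \<le> real n ^ 2 * (18 / (real n ^ 4 * \<delta>\<^sup>2))"
      by (intro mult_right_mono cI) auto
    also have "\<dots> = 18 / (real n ^ 2 * \<delta>\<^sup>2)"
      using n by (simp add: field_simps power2_eq_square power4_eq_xxxx)
    finally show ?thesis .
  qed
  have FG: "sum b F \<le> 18 / (real n ^ 2 * \<delta>\<^sup>2)" "sum b G \<le> 18 / (real n ^ 2 * \<delta>\<^sup>2)"
    unfolding F_def G_def b_def
    using chebyshev_expect[where p = w, OF I w \<delta> df] chebyshev_expect[where p = w, OF I w \<delta> dg] var by (meson order.trans)+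
  have BI: "B \<subseteq> Pow I" by (auto simp: B_def simple_graphs_def I_def)
  have "sum b (Pow I - B) \<le> sum b (F \<union> G)"
    by (intro sum_mono2) (auto simp: F_def G_def B_def ef simple_graphs_def I b f_def g_def not_less simp flip: I_def)
  also have "\<dots> \<le> sum b F + sum b G"
    using sum_Un_nat sum.union_inter[of F G b] sum_nonneg[of "F \<inter> G" b] b I by (simp add: F_def G_def)
  finally have \<eta>: "sum b (Pow I - B) \<le> 36 / (real n ^ 2 * \<delta>\<^sup>2)" using FG by simp
  show "B \<noteq> {}"
  proof
    assume "B = {}"
    then have "1 \<le> 36 / (real n ^ 2 * \<delta>\<^sup>2)"
      using \<eta> sum_bernoulli_weight[OF I, of w] by (simp add: b_def)
    then show False using big n \<delta> by (simp add: field_simps power_mult_distrib)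
  qed
  have "(\<Sum>S\<in>I. bin_entropy (w S)) \<le> ln (real (card B)) + 2 + 36 / (real n ^ 2 * \<delta>\<^sup>2) * (real (card I) * ln 2)"
    by (rule entropy_le_ln_card[OF I w BI \<eta>[unfolded b_def]])
  also have "36 / (real n ^ 2 * \<delta>\<^sup>2) * (real (card I) * ln 2) \<le> 36 / (real n ^ 2 * \<delta>\<^sup>2) * (real n ^ 2 * 1)"
  proof (intro mult_left_mono mult_mono)
    show "real (card I) \<le> real n ^ 2" using cI by linarith
  qed (use ln_le_minus_one[of 2] in auto)
  also have "\<dots> = 36 / \<delta>\<^sup>2" using n by simp
  finally show "mean_entropy n (edge_matrix w) * real n ^ 2 \<le> ln (real (card B)) + 2 + 36 / \<delta>\<^sup>2"
    using sum_bin_entropy_edges[OF n, of w] by (simp add: I_def)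
qed

text \<open>The threshold for \<open>n\<close> depends on \<open>\<delta>\<close> alone. This
  uniformity is essential because the weights to which the bound is applied, such as blow-ups, vary
  with \<open>n\<close>.\<close>

lemma entropy_le_log_count:
  assumes \<delta>: "0 < \<delta>"
  shows "\<forall>\<^sub>F n in sequentially. \<forall>e t \<alpha> w. (\<forall>S. 0 \<le> w S \<and> w S \<le> 1)
      \<and> \<bar>hom_edge n (edge_matrix w) - e\<bar> < \<alpha> \<and> \<bar>hom_tri n (edge_matrix w) - t\<bar> < \<alpha> \<longrightarrow>
    0 < num_graphs n (\<alpha> + \<delta>) e t \<and> mean_entropy n (edge_matrix w) \<le> log_count e t (\<alpha> + \<delta>) n + \<delta>"
proof -
  define r where "r = \<delta> / 2"
  have r: "0 < r" using \<delta> by (simp add: r_def)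
  have "((\<lambda>n. (2 + 36 / r\<^sup>2) / real n ^ 2) \<longlongrightarrow> 0) sequentially" by real_asymp
  then have e1: "\<forall>\<^sub>F n in sequentially. (2 + 36 / r\<^sup>2) / real n ^ 2 < \<delta>" using \<delta> by (rule order_tendstoD)
  have "((\<lambda>n. 10 / real n) \<longlongrightarrow> 0) sequentially" by real_asymp
  then have e2: "\<forall>\<^sub>F n in sequentially. 10 / real n < r" using r by (rule order_tendstoD)
  have "filterlim (\<lambda>n. (real n * r)\<^sup>2) at_top sequentially" using r by real_asymp
  then have e3: "\<forall>\<^sub>F n in sequentially. 36 < (real n * r)\<^sup>2" by (simp add: filterlim_at_top_dense)
  show ?thesis
    using e1 e2 e3 eventually_ge_at_top[of 3]
  proof eventually_elim
    case (elim n)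
    show ?case
    proof (intro allI impI, elim conjE)
      fix e t \<alpha> and w :: "nat set \<Rightarrow> real"
      assume w: "\<forall>S. 0 \<le> w S \<and> w S \<le> 1" and we: "\<bar>hom_edge n (edge_matrix w) - e\<bar> < \<alpha>"
        and wt: "\<bar>hom_tri n (edge_matrix w) - t\<bar> < \<alpha>"
      define B where "B = {E \<in> simple_graphs n. \<bar>hom_edge n (adjacency E) - hom_edge n (edge_matrix w)\<bar> < r
        \<and> \<bar>hom_tri n (adjacency E) - hom_tri n (edge_matrix w)\<bar> < r}"
      have n: "0 < n" using elim by simp
      have w': "0 \<le> w S \<and> w S \<le> 1" for S using w by blast
      note B = exists_typical_set[where w = w, OF n w' r elim(3), folded B_def]
      define W where "W = {E \<in> simple_graphs n. edge_density n E \<in> {e - (\<alpha> + \<delta>)<..<e + (\<alpha> + \<delta>)}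
                              \<and> triangle_density n E \<in> {t - (\<alpha> + \<delta>)<..<t + (\<alpha> + \<delta>)}}"
      have "B \<subseteq> W"
      proof
        fix E assume E: "E \<in> B"
        then have "E \<in> simple_graphs n" by (simp add: B_def)
        moreover have "\<bar>hom_edge n (adjacency E) - hom_edge n (edge_matrix w)\<bar> < r"
          "\<bar>hom_tri n (adjacency E) - hom_tri n (edge_matrix w)\<bar> < r"
          using E by (auto simp: B_def)
        moreover have "\<bar>edge_density n E - hom_edge n (adjacency E)\<bar> \<le> 10 / real n"
          "\<bar>triangle_density n E - hom_tri n (adjacency E)\<bar> \<le> 10 / real n"
          using edge_density_approx[of E n] triangle_density_approx[of E n] calculation elim(4) by auto
        moreover have "\<delta> = 2 * r" by (simp add: r_def)
        ultimately have "\<bar>edge_density n E - e\<bar> < \<alpha> + \<delta>" "\<bar>triangle_density n E - t\<bar> < \<alpha> + \<delta>"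
          using elim(2) we wt by linarith+
        with \<open>E \<in> simple_graphs n\<close> show "E \<in> W"
          unfolding W_def by (simp add: abs_less_iff)
      qed
      have fW: "finite W" unfolding W_def by (rule finite_window)
      have W: "num_graphs n (\<alpha> + \<delta>) e t = card W" by (simp add: num_graphs_def W_def)
      have "1 \<le> card B" using B(1) \<open>B \<subseteq> W\<close> fW finite_subset by (auto simp: Suc_le_eq card_gt_0_iff)
      moreover have "card B \<le> card W" by (rule card_mono[OF fW \<open>B \<subseteq> W\<close>])
      ultimately have "0 < card W" "ln (real (card B)) \<le> ln (real (card W))" by auto
      then have "mean_entropy n (edge_matrix w) * real n ^ 2 \<le> ln (real (card W)) + (2 + 36 / r\<^sup>2)"
        using B(2) by simp
      then have "mean_entropy n (edge_matrix w) \<le> (ln (real (card W)) + (2 + 36 / r\<^sup>2)) / real n ^ 2"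
        using n by (simp add: pos_le_divide_eq)
      also have "\<dots> \<le> ln (real (card W)) / real n ^ 2 + \<delta>"
        using elim(1) by (simp add: add_divide_distrib)
      finally show "0 < num_graphs n (\<alpha> + \<delta>) e t \<and> mean_entropy n (edge_matrix w) \<le> log_count e t (\<alpha> + \<delta>) n + \<delta>"
        using \<open>0 < card W\<close> by (simp add: W log_count_def)
    qed
  qed
qed

lemma average_close:
  fixes f :: "'a \<Rightarrow> real"
  assumes "finite C" "C \<noteq> {}" "\<And>x. x \<in> C \<Longrightarrow> \<bar>f x - m\<bar> \<le> r"
  shows "\<bar>(\<Sum>x\<in>C. f x) / real (card C) - m\<bar> \<le> r"
proof -
  have c: "0 < real (card C)" using assms by (simp add: card_gt_0_iff)
  have "(\<Sum>x\<in>C. f x) / real (card C) - m = (\<Sum>x\<in>C. f x - m) / real (card C)"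
    using c by (simp add: sum_subtractf field_simps)
  also have "\<bar>\<dots>\<bar> = \<bar>\<Sum>x\<in>C. f x - m\<bar> / real (card C)" by simp
  also have "\<dots> \<le> (\<Sum>x\<in>C. r) / real (card C)"
    by (intro divide_right_mono order.trans[OF sum_abs] sum_mono assms) auto
  also have "\<dots> = r" using c by simp
  finally show ?thesis .
qed

text \<open>The edge density is linear in the matrix, so it survives averaging exactly;
  decorrelation is needed for triangles only.\<close>

lemma hom_edge_average:
  assumes "finite C"
  shows "hom_edge n (edge_matrix (\<lambda>S. real (card {E\<in>C. S \<in> E}) / real (card C)))
    = (\<Sum>E\<in>C. hom_edge n (adjacency E)) / real (card C)"
proof -
  have "edge_matrix (\<lambda>S. real (card {E\<in>C. S \<in> E}) / real (card C)) i j = (\<Sum>E\<in>C. adjacency E i j) / real (card C)" for i j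
  proof (cases "i = j")
    case False
    have "(\<Sum>E\<in>C. of_bool ({i, j} \<in> E)) = real (card {E\<in>C. {i, j} \<in> E})"
      by (subst sum_of_bool_eq) (auto simp: assms Int_def)
    then show ?thesis using False by (simp add: edge_matrix_def)
  qed (simp add: edge_matrix_def)
  then have "hom_edge n (edge_matrix (\<lambda>S. real (card {E\<in>C. S \<in> E}) / real (card C))) =
      (\<Sum>i<n. \<Sum>j<n. \<Sum>E\<in>C. adjacency E i j) / real (card C) / real n ^ 2"
    by (simp add: hom_edge_def sum_divide_distrib)
  also have "(\<Sum>i<n. \<Sum>j<n. \<Sum>E\<in>C. adjacency E i j) = (\<Sum>E\<in>C. \<Sum>i<n. \<Sum>j<n. adjacency E i j)"
    unfolding sum.swap[of _ _ C] ..
  finally show ?thesis by (simp add: hom_edge_def sum_divide_distrib mult.commute)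
qed

text \<open>Subadditivity is applied to a decorrelated class of the window. \<open>K\<close> is
  chosen from \<open>\<delta>\<close> before \<open>n\<close>, so the loss of ln (2 * 2 ^ (K * n))
  is linear in \<open>n\<close> and disappears after division by \<open>n ^ 2\<close>.\<close>

lemma log_count_le_entropy:
  assumes \<delta>: "0 < \<delta>"
  shows "\<forall>\<^sub>F n in sequentially. \<forall>e t \<alpha>. 0 < num_graphs n \<alpha> e t \<longrightarrow>
    (\<exists>w. (\<forall>S. 0 \<le> w S \<and> w S \<le> 1) \<and> \<bar>hom_edge n (edge_matrix w) - e\<bar> < \<alpha> + \<delta>
      \<and> \<bar>hom_tri n (edge_matrix w) - t\<bar> < \<alpha> + \<delta> \<and> log_count e t \<alpha> n \<le> mean_entropy n (edge_matrix w) + \<delta>)"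
proof -
  \<comment> \<open>The triangle error is at most \<open>4 * \<epsilon>\<close> from decorrelation
    plus \<open>\<epsilon>\<close> from the normalisation of densities, well below
    \<open>\<delta>\<close>.\<close>
  define \<epsilon> where "\<epsilon> = \<delta> / 8"
  have \<epsilon>: "0 < \<epsilon>" using \<delta> by (simp add: \<epsilon>_def)
  obtain K where K: "0 < K" "1 / real K \<le> \<epsilon>\<^sup>2"
    using reals_Archimedean[of "\<epsilon>\<^sup>2"] \<epsilon>
    by (metis inverse_eq_divide less_imp_le zero_less_Suc zero_less_power)
  have "((\<lambda>n. (1 + real K * real n) / real n ^ 2) \<longlongrightarrow> 0) sequentially" by real_asymp
  then have e1: "\<forall>\<^sub>F n in sequentially. (1 + real K * real n) / real n ^ 2 < \<delta>" using \<delta> by (rule order_tendstoD)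
  have "((\<lambda>n. 10 / real n) \<longlongrightarrow> 0) sequentially" by real_asymp
  then have e2: "\<forall>\<^sub>F n in sequentially. 10 / real n < \<epsilon>" using \<epsilon> by (rule order_tendstoD)
  show ?thesis
    using e1 e2 eventually_ge_at_top[of 3]
  proof eventually_elim
    case (elim n)
    show ?case
    proof (intro allI impI)
      fix e t \<alpha> assume pos: "0 < num_graphs n \<alpha> e t"
      define A where "A = {E \<in> simple_graphs n. edge_density n E \<in> {e - \<alpha><..<e + \<alpha>}
                              \<and> triangle_density n E \<in> {t - \<alpha><..<t + \<alpha>}}"
      have num: "num_graphs n \<alpha> e t = card A" by (simp add: num_graphs_def A_def)
      have "A \<noteq> {}" using pos num by (metis card.empty less_irrefl)
      moreover have "A \<subseteq> simple_graphs n" by (auto simp: A_def)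
      ultimately have A: "A \<subseteq> simple_graphs n" "A \<noteq> {}" by auto
      have n: "0 < n" using elim by simp
      obtain C where C: "C \<subseteq> A" "C \<noteq> {}"
        "card A \<le> 2 * 2 ^ (K * n) * card C"
        "\<bar>(\<Sum>E\<in>C. hom_tri n (adjacency E)) / real (card C)
          - hom_tri n (edge_matrix (\<lambda>S. real (card {E\<in>C. S \<in> E}) / real (card C)))\<bar> \<le> 4 * \<epsilon>"
        by (rule exists_decorrelated_class[OF A n \<epsilon> K])
      define w where "w S = real (card {E\<in>C. S \<in> E}) / real (card C)" for S
      have fC: "finite C" by (rule finite_subset[OF order.trans[OF C(1) A(1)] finite_simple_graphs])
      have cC: "0 < card C" using fC C(2) by (simp add: card_gt_0_iff)
      have w: "\<forall>S. 0 \<le> w S \<and> w S \<le> 1"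
        using cC by (auto simp: w_def divide_simps intro!: card_mono fC)
      have "\<bar>hom_edge n (edge_matrix w) - e\<bar> \<le> \<alpha> + 10 / real n"
        unfolding w_def hom_edge_average[OF fC]
      proof (rule average_close[OF fC C(2)])
        fix E assume "E \<in> C"
        then have "E \<in> A" using C(1) by blast
        then show "\<bar>hom_edge n (adjacency E) - e\<bar> \<le> \<alpha> + 10 / real n"
          using edge_density_approx[of E n] elim(3) unfolding A_def by auto
      qed
      moreover have "\<bar>(\<Sum>E\<in>C. hom_tri n (adjacency E)) / real (card C) - t\<bar> \<le> \<alpha> + 10 / real n"
      proof (rule average_close[OF fC C(2)])
        fix E assume "E \<in> C"
        then have "E \<in> A" using C(1) by blast
        then show "\<bar>hom_tri n (adjacency E) - t\<bar> \<le> \<alpha> + 10 / real n"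
          using triangle_density_approx[of E n] elim(3) unfolding A_def by auto
      qed
      ultimately have close: "\<bar>hom_edge n (edge_matrix w) - e\<bar> < \<alpha> + \<delta>" "\<bar>hom_tri n (edge_matrix w) - t\<bar> < \<alpha> + \<delta>"
        using C(4) elim(2) \<delta> unfolding w_def[symmetric] \<epsilon>_def by linarith+
      have "ln (real (card C)) \<le> (\<Sum>S\<in>nsets {..<n} 2. bin_entropy (w S))"
        by (rule ln_card_le_entropy)
          (use C A in \<open>auto simp: w_def simple_graphs_def finite_imp_finite_nsets\<close>)
      then have lnC: "ln (real (card C)) \<le> mean_entropy n (edge_matrix w) * real n ^ 2"
        using sum_bin_entropy_edges[OF n] by simp
      have "real (card A) \<le> real (2 * 2 ^ (K * n) * card C)"
        using C(3) by (rule of_nat_mono)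
      then have "real (card A) \<le> 2 * 2 ^ (K * n) * real (card C)" by simp
      then have "ln (real (card A)) \<le> ln (2 * 2 ^ (K * n) * real (card C))"
        by (subst ln_le_cancel_iff) (use pos num cC in auto)
      also have "\<dots> = (1 + real K * real n) * ln 2 + ln (real (card C))"
        using cC by (simp add: ln_mult_pos ln_realpow algebra_simps)
      also have "(1 + real K * real n) * ln 2 \<le> (1 + real K * real n) * 1"
        using ln_le_minus_one[of 2] by (intro mult_left_mono) auto
      finally have "ln (real (card A)) \<le> (1 + real K * real n) + mean_entropy n (edge_matrix w) * real n ^ 2"
        using lnC by simp
      then have "ln (real (card A)) / real n ^ 2 \<le> ((1 + real K * real n) + mean_entropy n (edge_matrix w) * real n ^ 2) / real n ^ 2"
        by (rule divide_right_mono) simp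
      also have "\<dots> = (1 + real K * real n) / real n ^ 2 + mean_entropy n (edge_matrix w)"
        using n by (simp add: add_divide_distrib)
      finally have "log_count e t \<alpha> n \<le> mean_entropy n (edge_matrix w) + \<delta>"
        using elim(1) by (simp add: log_count_def num)
      with w close show "\<exists>w. (\<forall>S. 0 \<le> w S \<and> w S \<le> 1) \<and> \<bar>hom_edge n (edge_matrix w) - e\<bar> < \<alpha> + \<delta>
      \<and> \<bar>hom_tri n (edge_matrix w) - t\<bar> < \<alpha> + \<delta> \<and> log_count e t \<alpha> n \<le> mean_entropy n (edge_matrix w) + \<delta>"
        by blast
    qed
  qed
qed

section \<open>Blow-ups and existence of the entropy density\<close>

text \<open>Vertices from \<open>N\<close> on are isolated; with \<open>N\<close> a multiple of \<open>m\<close>, all densities scale exactly.\<close>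

definition blow_up :: "nat \<Rightarrow> nat \<Rightarrow> (nat set \<Rightarrow> real) \<Rightarrow> nat set \<Rightarrow> real" where
  "blow_up m N w S =
    (let T = (\<lambda>i. i mod m) ` S in if S \<subseteq> {..<N} \<and> card T = 2 then w T else 0)"

text \<open>Distinct vertices in one residue class fail the test \<open>card T = 2\<close> and get
  weight 0, in agreement with the zero diagonal of \<open>edge_matrix w\<close>.\<close>

lemma edge_matrix_blow_up:
  "edge_matrix (blow_up m N w) i j =
    (if i < N then if j < N then edge_matrix w (i mod m) (j mod m) else 0 else 0)"
  by (auto simp: edge_matrix_def blow_up_def Let_def card_insert_if)

lemma sum_blow_up:
  fixes F :: "nat \<Rightarrow> real"
  assumes "q * m \<le> n"
  shows "(\<Sum>i<n. if i < q * m then F (i mod m) else 0) = real q * (\<Sum>i<m. F i)"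
proof -
  have "(\<Sum>i<n. if i < q * m then F (i mod m) else 0) = (\<Sum>i<q * m. F (i mod m))"
  proof -
    have "{i. i < n \<and> i < q * m} = {..<q * m}" using assms by auto
    then show ?thesis by (simp add: sum.If_cases Int_def)
  qed
  also have "\<dots> = (\<Sum>k<q. \<Sum>i\<in>{k * m..<k * m + m}. F (i mod m))"
    by (rule sum.nat_group[symmetric])
  also have "\<dots> = (\<Sum>k<q. \<Sum>i<m. F i)"
  proof (rule sum.cong)
    fix k
    have "(\<Sum>i\<in>{k * m..<k * m + m}. F (i mod m)) = (\<Sum>i<m. F ((k * m + i) mod m))"
      unfolding sum.atLeastLessThan_shift_0[of _ "k * m"] by (simp add: lessThan_atLeast0)
    also have "\<dots> = (\<Sum>i<m. F i)" by (rule sum.cong) auto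
    finally show "(\<Sum>i\<in>{k * m..<k * m + m}. F (i mod m)) = (\<Sum>i<m. F i)" .
  qed simp
  finally show ?thesis by simp
qed

lemma sum_blow_up_2:
  fixes f :: "nat \<Rightarrow> nat \<Rightarrow> real"
  assumes "q * m \<le> n"
  shows "(\<Sum>i<n. \<Sum>j<n. if i < q * m then if j < q * m then f (i mod m) (j mod m) else 0 else 0)
    = real q ^ 2 * (\<Sum>i<m. \<Sum>j<m. f i j)"
proof -
  have "(\<Sum>i<n. \<Sum>j<n. if i < q * m then if j < q * m then f (i mod m) (j mod m) else 0 else 0)
      = (\<Sum>i<n. if i < q * m then real q * (\<Sum>j<m. f (i mod m) j) else 0)"
    by (rule sum.cong) (simp_all add: sum_blow_up[OF assms, of "f _"])
  also have "\<dots> = real q * (\<Sum>i<m. real q * (\<Sum>j<m. f i j))"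
    by (rule sum_blow_up[OF assms])
  finally show ?thesis by (simp add: power2_eq_square mult.assoc flip: sum_distrib_left)
qed

lemma sum_blow_up_3:
  fixes f :: "nat \<Rightarrow> nat \<Rightarrow> nat \<Rightarrow> real"
  assumes "q * m \<le> n"
  shows "(\<Sum>i<n. \<Sum>j<n. \<Sum>k<n. if i < q * m then if j < q * m then if k < q * m
      then f (i mod m) (j mod m) (k mod m) else 0 else 0 else 0)
    = real q ^ 3 * (\<Sum>i<m. \<Sum>j<m. \<Sum>k<m. f i j k)"
proof -
  have "(\<Sum>i<n. \<Sum>j<n. \<Sum>k<n. if i < q * m then if j < q * m then if k < q * m
      then f (i mod m) (j mod m) (k mod m) else 0 else 0 else 0)
      = (\<Sum>i<n. if i < q * m then real q ^ 2 * (\<Sum>j<m. \<Sum>k<m. f (i mod m) j k) else 0)"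
    by (rule sum.cong) (simp_all add: sum_blow_up_2[OF assms, of "f _"])
  also have "\<dots> = real q * (\<Sum>i<m. real q ^ 2 * (\<Sum>j<m. \<Sum>k<m. f i j k))"
    by (rule sum_blow_up[OF assms])
  finally show ?thesis by (simp add: power2_eq_square power3_eq_cube mult.assoc flip: sum_distrib_left)
qed

context
  fixes m n q :: nat and w :: "nat set \<Rightarrow> real"
  assumes m: "0 < m" and n: "0 < n" and q: "q * m \<le> n"
begin

lemma hom_edge_blow_up:
  "hom_edge n (edge_matrix (blow_up m (q * m) w)) =
    (real (q * m) / real n) ^ 2 * hom_edge m (edge_matrix w)"
  unfolding hom_edge_def edge_matrix_blow_up sum_blow_up_2[OF q]
  using m n by (simp add: power_divide power_mult_distrib)

lemma hom_tri_blow_up: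
  "hom_tri n (edge_matrix (blow_up m (q * m) w)) =
    (real (q * m) / real n) ^ 3 * hom_tri m (edge_matrix w)"
proof -
  define a where "a = edge_matrix w"
  have "(\<Sum>i<n. \<Sum>j<n. \<Sum>k<n. edge_matrix (blow_up m (q * m) w) i j * edge_matrix (blow_up m (q * m) w) i k
      * edge_matrix (blow_up m (q * m) w) j k) =
    (\<Sum>i<n. \<Sum>j<n. \<Sum>k<n. if i < q * m then if j < q * m then if k < q * m then
      a (i mod m) (j mod m) * a (i mod m) (k mod m) * a (j mod m) (k mod m) else 0 else 0 else 0)"
    by (intro sum.cong refl) (simp add: edge_matrix_blow_up a_def)
  also have "\<dots> = real q ^ 3 * (\<Sum>i<m. \<Sum>j<m. \<Sum>k<m. a i j * a i k * a j k)"
    by (rule sum_blow_up_3[OF q])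
  finally show ?thesis
    using m n by (simp add: hom_tri_def a_def power_divide power_mult_distrib)
qed

lemma mean_entropy_blow_up:
  "mean_entropy n (edge_matrix (blow_up m (q * m) w)) =
    (real (q * m) / real n) ^ 2 * mean_entropy m (edge_matrix w)"
proof -
  have "(\<Sum>i<n. \<Sum>j<n. bin_entropy (edge_matrix (blow_up m (q * m) w) i j)) =
    (\<Sum>i<n. \<Sum>j<n. if i < q * m then if j < q * m then bin_entropy (edge_matrix w (i mod m) (j mod m)) else 0 else 0)"
    by (intro sum.cong refl) (simp add: edge_matrix_blow_up)
  also have "\<dots> = real q ^ 2 * (\<Sum>i<m. \<Sum>j<m. bin_entropy (edge_matrix w i j))"
    by (rule sum_blow_up_2[OF q])
  finally show ?thesis
    using m n by (simp add: mean_entropy_def power_divide power_mult_distrib)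
qed

end

lemma div_mult_ratio_tendsto:
  assumes "0 < m"
  shows "(\<lambda>n. real (n div m * m) / real n) \<longlonglongrightarrow> 1"
proof (rule tendsto_sandwich)
  show "(\<lambda>n. 1 - real m / real n) \<longlonglongrightarrow> 1" by real_asymp
  show "\<forall>\<^sub>F n in sequentially. 1 - real m / real n \<le> real (n div m * m) / real n"
    using eventually_gt_at_top[of 0]
  proof eventually_elim
    case (elim n)
    have "n \<le> n div m * m + m"
      using div_mult_mod_eq[of n m] mod_less_divisor[OF assms, of n] by linarith
    then have "real n - real m \<le> real (n div m * m)" by linarith
    then have "(real n - real m) / real n \<le> real (n div m * m) / real n"
      by (rule divide_right_mono) simp
    then show ?case using elim by (simp add: diff_divide_distrib)
  qed
  have "real (n div m * m) / real n \<le> 1" for n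
    using of_nat_mono[OF div_times_less_eq_dividend[of n m]] by (cases "n = 0") (simp_all del: of_nat_mult)
  then show "\<forall>\<^sub>F n in sequentially. real (n div m * m) / real n \<le> 1" by simp
qed simp

text \<open>Carries a weight from a single order \<open>m\<close> to every large order. Fewer than
  \<open>m\<close> vertices are left isolated, so the scaling factors tend to 1.\<close>

lemma blow_up_approx:
  assumes m: "0 < m" and \<delta>: "0 < \<delta>" and w: "\<And>S. 0 \<le> w S \<and> w S \<le> 1"
  shows "\<forall>\<^sub>F n in sequentially. \<exists>v. (\<forall>S. 0 \<le> v S \<and> v S \<le> 1)
    \<and> \<bar>hom_edge n (edge_matrix v) - hom_edge m (edge_matrix w)\<bar> < \<delta>
    \<and> \<bar>hom_tri n (edge_matrix v) - hom_tri m (edge_matrix w)\<bar> < \<delta>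
    \<and> \<bar>mean_entropy n (edge_matrix v) - mean_entropy m (edge_matrix w)\<bar> < \<delta>"
proof -
  define r where "r n = real (n div m * m) / real n" for n
  have r: "(\<lambda>n. r n ^ k * x) \<longlonglongrightarrow> x" for k and x :: real
    using tendsto_mult_right[OF tendsto_power[OF div_mult_ratio_tendsto[OF m]], of k x]
    by (simp add: r_def)
  have close: "\<forall>\<^sub>F n in sequentially. \<bar>r n ^ k * x - x\<bar> < \<delta>" for k and x :: real
    using tendstoD[OF r \<delta>, of k x] by (simp add: dist_real_def)
  show ?thesis
    using close[of 2 "hom_edge m (edge_matrix w)"] close[of 3 "hom_tri m (edge_matrix w)"]
      close[of 2 "mean_entropy m (edge_matrix w)"] eventually_gt_at_top[of 0]
  proof eventually_elim
    case (elim n)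
    have le: "n div m * m \<le> n" by (rule div_times_less_eq_dividend)
    have v: "\<forall>S. 0 \<le> blow_up m (n div m * m) w S \<and> blow_up m (n div m * m) w S \<le> 1"
      using w by (auto simp: blow_up_def Let_def)
    then show ?case
      using elim hom_edge_blow_up[OF m elim(4) le, of w] hom_tri_blow_up[OF m elim(4) le, of w]
        mean_entropy_blow_up[OF m elim(4) le, of w]
      unfolding r_def[symmetric] by (intro exI[of _ "blow_up m (n div m * m) w"] conjI v) simp_all
  qed
qed

section \<open>Monotonicity in the window width and existence of the limit\<close>

lemma log_count_nonneg: "0 \<le> log_count e t \<alpha> n"
  by (cases "num_graphs n \<alpha> e t = 0") (auto simp: log_count_def)

lemma log_count_mono:
  assumes "\<alpha> \<le> \<beta>"
  shows "log_count e t \<alpha> n \<le> log_count e t \<beta> n"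
proof (cases "num_graphs n \<alpha> e t = 0")
  case True
  then have "log_count e t \<alpha> n = 0" by (simp add: log_count_def)
  then show ?thesis by (simp add: log_count_nonneg)
next
  case False
  have "num_graphs n \<alpha> e t \<le> num_graphs n \<beta> e t"
    unfolding num_graphs_def by (rule card_mono[OF finite_window]) (use assms in auto)
  with False have "ln (real (num_graphs n \<alpha> e t)) \<le> ln (real (num_graphs n \<beta> e t))" by simp
  then show ?thesis unfolding log_count_def by (rule divide_right_mono) simp
qed

lemma log_count_le_1: "log_count e t \<alpha> n \<le> 1"
proof (cases "num_graphs n \<alpha> e t = 0 \<or> n = 0")
  case False
  have "num_graphs n \<alpha> e t \<le> card (simple_graphs n)"
    unfolding num_graphs_def by (rule card_mono[OF finite_simple_graphs]) auto
  also have "\<dots> = 2 ^ (n choose 2)"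
    by (simp add: simple_graphs_def card_Pow finite_imp_finite_nsets card_nsets)
  finally have "real (num_graphs n \<alpha> e t) \<le> real (2 ^ (n choose 2))" by (rule of_nat_mono)
  then have "ln (real (num_graphs n \<alpha> e t)) \<le> ln (2 ^ (n choose 2))"
    using False by (subst ln_le_cancel_iff) auto
  also have "\<dots> = real (n choose 2) * ln 2" by (simp add: ln_realpow)
  also have "\<dots> \<le> real (n choose 2) * 1"
    using ln_le_minus_one[of 2] by (intro mult_left_mono) auto
  also have "\<dots> \<le> real n ^ 2"
  proof -
    have "2 * real (n choose 2) \<le> real n ^ 2"
      unfolding real_choose_2 by (simp add: power2_eq_square algebra_simps)
    then show ?thesis by linarith
  qed
  finally show ?thesis using False by (simp add: log_count_def)
qed (auto simp: log_count_def)

definition lower_rate :: "real \<Rightarrow> real \<Rightarrow> real \<Rightarrow> ereal" where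
  "lower_rate e t \<alpha> = liminf (\<lambda>n. ereal (log_count e t \<alpha> n))"

definition upper_rate :: "real \<Rightarrow> real \<Rightarrow> real \<Rightarrow> ereal" where
  "upper_rate e t \<alpha> = limsup (\<lambda>n. ereal (log_count e t \<alpha> n))"

lemma lower_rate_le_upper_rate: "lower_rate e t \<alpha> \<le> upper_rate e t \<alpha>"
  unfolding lower_rate_def upper_rate_def by (rule Liminf_le_Limsup) simp

text \<open>A limit superior above \<open>c\<close> supplies one order \<open>m\<close> with many
  graphs in the narrow window. Their edge frequencies, blown up to any large order, again produce
  many graphs there, in the wider window; one order thus controls all large ones.\<close>

lemma upper_rate_le_lower_rate:
  assumes "\<alpha> < \<beta>"
  shows "upper_rate e t \<alpha> \<le> lower_rate e t \<beta>"
proof (rule dense_le)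
  have key: "ereal c' \<le> lower_rate e t \<beta>" if c: "ereal c < upper_rate e t \<alpha>" "c' < c" for c c'
  proof (cases "c < 0")
    case True
    have "0 \<le> lower_rate e t \<beta>"
      unfolding lower_rate_def by (rule Liminf_bounded) (simp add: log_count_nonneg)
    then show ?thesis using True c(2) by (auto intro: order.trans[of _ 0])
  next
    case False
    \<comment> \<open>Three errors of size \<open>\<delta>\<close> occur both in the width and in
      the entropy: from graphs to a matrix, in the blow-up, and from the matrix back to
      graphs.\<close>
    define \<delta> where "\<delta> = min ((\<beta> - \<alpha>) / 4) ((c - c') / 4)"
    have \<delta>_le: "4 * \<delta> \<le> \<beta> - \<alpha>" "4 * \<delta> \<le> c - c'"
      using min.cobounded1[of "(\<beta> - \<alpha>) / 4" "(c - c') / 4"] min.cobounded2[of "(\<beta> - \<alpha>) / 4" "(c - c') / 4"]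
      unfolding \<delta>_def[symmetric] by (simp_all add: field_simps)
    have \<delta>: "0 < \<delta>" "\<alpha> + 3 * \<delta> \<le> \<beta>" "c' \<le> c - 3 * \<delta>"
    proof -
      show "0 < \<delta>" using assms c(2) by (simp add: \<delta>_def)
      show "\<alpha> + 3 * \<delta> \<le> \<beta>" using \<delta>_le(1) assms by linarith
      show "c' \<le> c - 3 * \<delta>" using \<delta>_le(2) c(2) by linarith
    qed
    have "\<exists>\<^sub>F n in sequentially. c < log_count e t \<alpha> n"
    proof (rule ccontr)
      assume "\<not> ?thesis"
      then have "\<forall>\<^sub>F n in sequentially. ereal (log_count e t \<alpha> n) \<le> ereal c"
        by (simp add: not_frequently not_less)
      then have "upper_rate e t \<alpha> \<le> ereal c" unfolding upper_rate_def by (rule Limsup_bounded)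
      with c show False by simp
    qed
    from frequently_ex[OF frequently_eventually_conj[OF this
        eventually_conj[OF log_count_le_entropy[OF \<delta>(1)] eventually_gt_at_top[of 0]]]]
    obtain m where m: "0 < m" "c < log_count e t \<alpha> m" and
      "0 < num_graphs m \<alpha> e t \<longrightarrow>
      (\<exists>w. (\<forall>S. 0 \<le> w S \<and> w S \<le> 1) \<and> \<bar>hom_edge m (edge_matrix w) - e\<bar> < \<alpha> + \<delta>
      \<and> \<bar>hom_tri m (edge_matrix w) - t\<bar> < \<alpha> + \<delta> \<and> log_count e t \<alpha> m \<le> mean_entropy m (edge_matrix w) + \<delta>)"
      by blast
    \<comment> \<open>Here \<open>0 \<le> c\<close> matters: an empty window has
      \<open>log_count\<close> 0 by the convention for ln 0, which does not exceed
      \<open>c\<close>.\<close>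
    moreover have "num_graphs m \<alpha> e t \<noteq> 0"
    proof
      assume "num_graphs m \<alpha> e t = 0"
      then have "log_count e t \<alpha> m = 0" by (simp add: log_count_def)
      then show False using False m by simp
    qed
    ultimately obtain w where w: "\<forall>S. 0 \<le> w S \<and> w S \<le> 1" "\<bar>hom_edge m (edge_matrix w) - e\<bar> < \<alpha> + \<delta>"
      "\<bar>hom_tri m (edge_matrix w) - t\<bar> < \<alpha> + \<delta>" "log_count e t \<alpha> m \<le> mean_entropy m (edge_matrix w) + \<delta>"
      by auto
    have "\<forall>\<^sub>F n in sequentially. ereal c' \<le> ereal (log_count e t \<beta> n)"
      using blow_up_approx[where w = w, OF m(1) \<delta>(1) w(1)[rule_format]] entropy_le_log_count[OF \<delta>(1)]
    proof eventually_elim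
      case (elim n)
      then obtain v where v: "\<forall>S. 0 \<le> v S \<and> v S \<le> 1"
        "\<bar>hom_edge n (edge_matrix v) - hom_edge m (edge_matrix w)\<bar> < \<delta>"
        "\<bar>hom_tri n (edge_matrix v) - hom_tri m (edge_matrix w)\<bar> < \<delta>"
        "\<bar>mean_entropy n (edge_matrix v) - mean_entropy m (edge_matrix w)\<bar> < \<delta>" by blast
      have "\<bar>hom_edge n (edge_matrix v) - e\<bar> < \<alpha> + 2 * \<delta>" "\<bar>hom_tri n (edge_matrix v) - t\<bar> < \<alpha> + 2 * \<delta>"
        using v w by linarith+
      then have "mean_entropy n (edge_matrix v) \<le> log_count e t (\<alpha> + 2 * \<delta> + \<delta>) n + \<delta>"
        using elim(2) v(1) by blast
      moreover have "log_count e t (\<alpha> + 2 * \<delta> + \<delta>) n \<le> log_count e t \<beta> n"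
        by (rule log_count_mono) (use \<delta> in simp)
      ultimately show ?case using v(4) w(4) m(2) \<delta>(3) by simp
    qed
    then show ?thesis unfolding lower_rate_def by (rule Liminf_bounded)
  qed
  fix y assume "y < upper_rate e t \<alpha>"
  then obtain c where c: "y < ereal c" "ereal c < upper_rate e t \<alpha>" using ereal_dense2 by blast
  from c(1) obtain c' where c': "y < ereal c'" "ereal c' < ereal c" using ereal_dense2 by blast
  with key[OF c(2), of c'] show "y \<le> lower_rate e t \<beta>" by simp
qed

text \<open>The limit is the infimum of the lower rates over all widths. At widths below a nearly
  optimal \<open>\<alpha>\<close> even the upper rate is at most the lower rate at
  \<open>\<alpha>\<close>, so both rates are squeezed. It is finite because all rates lie in
  [0, 1].\<close>

lemma has_entropy_density_entropy_density: "has_entropy_density e t (entropy_density e t)"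
proof -
  define s where "s = (INF \<alpha>\<in>{0<..}. lower_rate e t \<alpha>)"
  have s_le: "s \<le> lower_rate e t \<alpha>" if "0 < \<alpha>" for \<alpha>
    unfolding s_def by (rule INF_lower) (use that in simp)
  have "0 \<le> s"
    unfolding s_def lower_rate_def by (intro INF_greatest Liminf_bounded) (simp add: log_count_nonneg)
  moreover have "s \<le> 1"
  proof -
    have "upper_rate e t 1 \<le> 1"
      unfolding upper_rate_def by (rule Limsup_bounded) (simp add: log_count_le_1)
    with s_le[of 1] lower_rate_le_upper_rate[of e t 1] show ?thesis by simp
  qed
  ultimately obtain s' where s': "s = ereal s'" by (cases s) auto
  have small: "\<forall>\<^sub>F \<alpha> in at_right 0. lower_rate e t \<alpha> < a \<and> upper_rate e t \<alpha> < a" if a: "s < a" for a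
  proof -
    from a obtain \<alpha> where \<alpha>: "0 < \<alpha>" "lower_rate e t \<alpha> < a"
      unfolding s_def INF_less_iff by auto
    have "\<forall>\<^sub>F x in at_right 0. x \<in> {0<..<\<alpha>}"
      using eventually_at_right_real[OF \<alpha>(1)] .
    then show ?thesis
    proof eventually_elim
      case (elim x)
      then have "upper_rate e t x \<le> lower_rate e t \<alpha>" by (intro upper_rate_le_lower_rate) simp
      then show ?case using \<alpha>(2) lower_rate_le_upper_rate[of e t x] by auto
    qed
  qed
  have large: "\<forall>\<^sub>F \<alpha> in at_right 0. a < lower_rate e t \<alpha> \<and> a < upper_rate e t \<alpha>" if a: "a < s" for a
    using eventually_at_right_less[of "0::real"]
  proof eventually_elim
    case (elim x)
    then show ?case using a s_le[of x] lower_rate_le_upper_rate[of e t x] by auto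
  qed
  have "(lower_rate e t \<longlongrightarrow> s) (at_right 0)" "(upper_rate e t \<longlongrightarrow> s) (at_right 0)"
    by (rule order_tendstoI; use small large in \<open>force elim: eventually_mono\<close>)+
  then have "has_entropy_density e t s'"
    by (simp add: has_entropy_density_def s' lower_rate_def[abs_def] upper_rate_def[abs_def])
  then show ?thesis using entropy_density_eqI by simp
qed

lemma lower_rate_tendsto: "(lower_rate e t \<longlongrightarrow> ereal (entropy_density e t)) (at_right 0)"
  using has_entropy_density_entropy_density
  by (simp add: has_entropy_density_def lower_rate_def[abs_def])

lemma entropy_density_geI:
  assumes "\<And>\<alpha>. 0 < \<alpha> \<Longrightarrow> ereal c \<le> lower_rate e t \<alpha>"
  shows "c \<le> entropy_density e t"
proof -
  have "\<forall>\<^sub>F \<alpha> in at_right 0. ereal c \<le> lower_rate e t \<alpha>"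
    using eventually_at_right_less[of "0::real"] by eventually_elim (rule assms)
  from tendsto_lowerbound[OF lower_rate_tendsto this] show ?thesis by simp
qed

lemma entropy_density_leI:
  assumes "\<And>\<alpha>. 0 < \<alpha> \<Longrightarrow> lower_rate e t \<alpha> \<le> ereal (g \<alpha>)" "(g \<longlongrightarrow> c) (at_right 0)"
  shows "entropy_density e t \<le> c"
proof -
  have "\<forall>\<^sub>F \<alpha> in at_right 0. lower_rate e t \<alpha> \<le> ereal (g \<alpha>)"
    using eventually_at_right_less[of "0::real"] by eventually_elim (rule assms)
  moreover have "((\<lambda>\<alpha>. ereal (g \<alpha>)) \<longlongrightarrow> ereal c) (at_right 0)" using assms(2) by simp
  ultimately have "ereal (entropy_density e t) \<le> ereal c"
    by (intro tendsto_le[OF trivial_limit_at_right_real _ lower_rate_tendsto])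
  then show ?thesis by simp
qed

section \<open>The region around the curve of random graphs\<close>

text \<open>The matrix is \<open>c + x s\<^sub>i s\<^sub>j\<close> with \<open>s\<^sub>i = (-1)\<^sup>i\<close>: the perturbation has zero row sums, and
  the trace of its cube moves the triangle density by \<open>x\<^sup>3\<close> in either direction.\<close>

definition parity_weight :: "real \<Rightarrow> real \<Rightarrow> nat set \<Rightarrow> real" where
  "parity_weight c x S = (if even (\<Sum>S) then c + x else c - x)"

lemma sum_alternating: "\<bar>\<Sum>i<n. (- 1 :: real) ^ i\<bar> \<le> 1"
proof -
  have "(\<Sum>i<n. (- 1 :: real) ^ i) = (if even n then 0 else 1)" by (induction n) auto
  then show ?thesis by simp
qed

lemma parity_weight_tendsto:
  assumes "0 \<le> c + x" "c + x \<le> 1" "0 \<le> c - x" "c - x \<le> 1"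
  shows "(\<lambda>n. hom_edge n (edge_matrix (parity_weight c x))) \<longlonglongrightarrow> c"
    and "(\<lambda>n. hom_tri n (edge_matrix (parity_weight c x))) \<longlonglongrightarrow> c ^ 3 + x ^ 3"
proof -
  define s :: "nat \<Rightarrow> real" where "s i = (- 1) ^ i" for i
  \<comment> \<open>Same matrix with the diagonal filled in, an O(1/n) change of both densities. Now
    all sums factor through the alternating sum \<open>\<sigma>\<close>, which stays
    bounded.\<close>
  define b where "b i j = c + x * (s i * s j)" for i j
  define \<sigma> where "\<sigma> n = (\<Sum>i<n. s i)" for n
  have ss: "s i * s i = 1" for i by (simp add: s_def flip: power_add mult_2 power_mult)
  have b: "b i j = (if even (i + j) then c + x else c - x)" for i j
    by (simp add: b_def s_def flip: power_add)
  have b01: "\<bar>b i j\<bar> \<le> 1" for i j using assms by (auto simp: b)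
  have w01: "\<bar>edge_matrix (parity_weight c x) i j\<bar> \<le> 1" for i j
    using assms by (auto simp: edge_matrix_def parity_weight_def)
  have diff: "(\<Sum>i<n. \<Sum>j<n. \<bar>edge_matrix (parity_weight c x) i j - b i j\<bar>) \<le> real n" for n
  proof -
    have "(\<Sum>i<n. \<Sum>j<n. \<bar>edge_matrix (parity_weight c x) i j - b i j\<bar>) \<le> (\<Sum>i<n. \<Sum>j<n. if i = j then 1 else 0)"
      by (intro sum_mono) (use assms in \<open>auto simp: b edge_matrix_def parity_weight_def\<close>)
    then show ?thesis by simp
  qed
  have \<sigma>: "\<bar>\<sigma> n\<bar> \<le> 1" for n unfolding \<sigma>_def s_def by (rule sum_alternating)
  then have \<sigma>2: "(\<sigma> n)\<^sup>2 \<le> 1" for n by (simp add: abs_square_le_1)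
  have "(\<lambda>n. (\<sigma> n)\<^sup>2 / real n ^ 2) \<longlonglongrightarrow> 0"
  proof (rule tendsto_sandwich[of "\<lambda>_. 0" _ _ "\<lambda>n. 1 / real n ^ 2"])
    show "\<forall>\<^sub>F n in sequentially. (\<sigma> n)\<^sup>2 / real n ^ 2 \<le> 1 / real n ^ 2"
      by (intro always_eventually allI divide_right_mono \<sigma>2) simp
    show "(\<lambda>n. 1 / real n ^ 2) \<longlonglongrightarrow> 0" by real_asymp
  qed auto
  then have lim: "(\<lambda>n. y + z * ((\<sigma> n)\<^sup>2 / real n ^ 2)) \<longlonglongrightarrow> y" for y z
    using tendsto_add[OF tendsto_const tendsto_mult_right_zero, of _ _ y z] by fastforce
  have ev: "\<forall>\<^sub>F n in sequentially. 0 < (n::nat)" by (rule eventually_gt_at_top)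
  have pair: "(\<Sum>i<n. s i * sum s {..<n}) = \<sigma> n * \<sigma> n" for n
    by (simp only: \<sigma>_def sum_distrib_right)
  have he: "hom_edge n b = c + x * ((\<sigma> n)\<^sup>2 / real n ^ 2)" if "0 < n" for n
  proof -
    have "(\<Sum>i<n. \<Sum>j<n. b i j) = real n ^ 2 * c + x * (\<sigma> n)\<^sup>2"
      by (simp add: b_def sum.distrib pair power2_eq_square mult.assoc flip: sum_distrib_left)
    then show ?thesis using that by (simp add: hom_edge_def field_simps)
  qed
  have ht: "hom_tri n b = c ^ 3 + x ^ 3 + (3 * (c\<^sup>2 * x + c * x\<^sup>2)) * ((\<sigma> n)\<^sup>2 / real n ^ 2)" if "0 < n" for n
  proof -
    \<comment> \<open>Since the squares of the signs are 1, a product of two perturbation terms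
      collapses to a single product of signs and the product of all three to the constant
      \<open>x ^ 3\<close>; only this constant survives averaging.\<close>
    have "b i j * b i k * b j k = (c ^ 3 + x ^ 3) + (c\<^sup>2 * x + c * x\<^sup>2) * (s i * s j + s i * s k + s j * s k)" for i j k
    proof -
      have "b i j * b i k * b j k = c ^ 3 + c\<^sup>2 * x * (s i * s j + s i * s k + s j * s k)
        + c * x\<^sup>2 * ((s i * s i) * (s j * s k) + (s j * s j) * (s i * s k) + (s k * s k) * (s i * s j))
        + x ^ 3 * ((s i * s i) * (s j * s j) * (s k * s k))"
        unfolding b_def by (simp add: algebra_simps power2_eq_square power3_eq_cube)
      then show ?thesis unfolding ss by (simp add: algebra_simps)
    qed
    then have "(\<Sum>i<n. \<Sum>j<n. \<Sum>k<n. b i j * b i k * b j k) =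
      real n ^ 3 * (c ^ 3 + x ^ 3) + (c\<^sup>2 * x + c * x\<^sup>2) *
        ((\<Sum>i<n. \<Sum>j<n. real n * (s i * s j)) + (\<Sum>i<n. real n * (\<Sum>k<n. s i * s k)) + real n * (\<Sum>j<n. \<Sum>k<n. s j * s k))"
      by (simp add: sum.distrib power3_eq_cube mult.assoc flip: sum_distrib_left)
    also have "\<dots> = real n ^ 3 * (c ^ 3 + x ^ 3) + (c\<^sup>2 * x + c * x\<^sup>2) * (3 * real n * (\<sigma> n)\<^sup>2)"
      by (simp add: pair power2_eq_square flip: sum_distrib_left)
    finally show ?thesis using that by (simp add: hom_tri_def field_simps power3_eq_cube power2_eq_square)
  qed
  have "(\<lambda>n. hom_edge n b) \<longlonglongrightarrow> c"
    by (rule Lim_transform_eventually[OF lim]) (use ev in eventually_elim, rule he[symmetric])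
  moreover have "(\<lambda>n. hom_edge n (edge_matrix (parity_weight c x)) - hom_edge n b) \<longlonglongrightarrow> 0"
  proof (rule Lim_null_comparison)
    show "\<forall>\<^sub>F n in sequentially. norm (hom_edge n (edge_matrix (parity_weight c x)) - hom_edge n b) \<le> 1 / real n"
      using ev
    proof eventually_elim
      case (elim n)
      have "\<bar>hom_edge n (edge_matrix (parity_weight c x)) - hom_edge n b\<bar> \<le> real n / real n ^ 2"
        by (rule order.trans[OF hom_edge_diff_le]) (intro divide_right_mono diff, simp)
      then show ?case using elim by (simp add: power2_eq_square)
    qed
    show "(\<lambda>n. 1 / real n) \<longlonglongrightarrow> 0" by real_asymp
  qed
  ultimately show "(\<lambda>n. hom_edge n (edge_matrix (parity_weight c x))) \<longlonglongrightarrow> c"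
    using tendsto_add by fastforce
  have "(\<lambda>n. hom_tri n b) \<longlonglongrightarrow> c ^ 3 + x ^ 3"
    by (rule Lim_transform_eventually[OF lim]) (use ev in eventually_elim, rule ht[symmetric])
  moreover have "(\<lambda>n. hom_tri n (edge_matrix (parity_weight c x)) - hom_tri n b) \<longlonglongrightarrow> 0"
  proof (rule Lim_null_comparison)
    show "\<forall>\<^sub>F n in sequentially. norm (hom_tri n (edge_matrix (parity_weight c x)) - hom_tri n b) \<le> 3 / real n"
      using ev
    proof eventually_elim
      case (elim n)
      have "\<bar>hom_tri n (edge_matrix (parity_weight c x)) - hom_tri n b\<bar> \<le> 3 * real n / real n ^ 2"
        by (rule order.trans[OF hom_tri_diff_le[OF w01 b01]]) (intro divide_right_mono mult_left_mono diff, simp_all)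
      then show ?case using elim by (simp add: power2_eq_square)
    qed
    show "(\<lambda>n. 3 / real n) \<longlonglongrightarrow> 0" by real_asymp
  qed
  ultimately show "(\<lambda>n. hom_tri n (edge_matrix (parity_weight c x))) \<longlonglongrightarrow> c ^ 3 + x ^ 3"
    using tendsto_add by fastforce
qed

lemma parity_weight_log_count:
  assumes x: "0 \<le> c + x" "c + x \<le> 1" "0 \<le> c - x" "c - x \<le> 1" and \<alpha>: "0 < \<alpha>" and \<epsilon>: "0 < \<epsilon>"
  shows "\<forall>\<^sub>F n in sequentially. 0 < num_graphs n \<alpha> c (c ^ 3 + x ^ 3)
    \<and> mean_entropy n (edge_matrix (parity_weight c x)) \<le> log_count c (c ^ 3 + x ^ 3) \<alpha> n + \<epsilon>"
proof -
  define \<delta> where "\<delta> = min (\<alpha> / 2) \<epsilon>"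
  have \<delta>: "0 < \<delta>" "\<delta> \<le> \<alpha> / 2" "\<delta> \<le> \<epsilon>"
    unfolding \<delta>_def by (use \<alpha> \<epsilon> in simp) (rule min.cobounded1 min.cobounded2)+
  have \<beta>: "0 < \<alpha> - \<delta>" using \<alpha> \<delta> by simp
  have w: "\<forall>S. 0 \<le> parity_weight c x S \<and> parity_weight c x S \<le> 1"
    using x by (simp add: parity_weight_def)
  show ?thesis
    using tendstoD[OF parity_weight_tendsto(1)[OF x] \<beta>] tendstoD[OF parity_weight_tendsto(2)[OF x] \<beta>]
      entropy_le_log_count[OF \<delta>(1)]
  proof eventually_elim
    case (elim n)
    then have "0 < num_graphs n (\<alpha> - \<delta> + \<delta>) c (c ^ 3 + x ^ 3)
      \<and> mean_entropy n (edge_matrix (parity_weight c x)) \<le> log_count c (c ^ 3 + x ^ 3) (\<alpha> - \<delta> + \<delta>) n + \<delta>"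
      using w unfolding dist_real_def by blast
    then show ?case using \<delta> by simp
  qed
qed

text \<open>The case \<open>x = 0\<close> of the parity weights is the random graph with edge
  probability \<open>e\<close>; the zero diagonal lowers its mean entropy by a term of order
  1/n.\<close>

lemma entropy_density_constant_ge:
  assumes e: "0 < e" "e < 1"
  shows "bin_entropy e / 2 \<le> entropy_density e (e ^ 3)"
proof (rule dense_le)
  fix y assume y: "y < bin_entropy e / 2"
  define \<epsilon> where "\<epsilon> = (bin_entropy e / 2 - y) / 2"
  have \<epsilon>: "0 < \<epsilon>" using y by (simp add: \<epsilon>_def)
  have "(\<lambda>n. bin_entropy e / 2 - bin_entropy e / 2 / real n) \<longlonglongrightarrow> bin_entropy e / 2" by real_asymp
  then have lim: "\<forall>\<^sub>F n in sequentially. bin_entropy e / 2 - \<epsilon> < bin_entropy e / 2 - bin_entropy e / 2 / real n"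
    using \<epsilon> by (intro order_tendstoD) auto
  have h_const: "mean_entropy n (edge_matrix (parity_weight e 0)) = bin_entropy e / 2 - bin_entropy e / 2 / real n" if "0 < n" for n
  proof -
    have "(\<Sum>i<n. \<Sum>j<n. bin_entropy (edge_matrix (parity_weight e 0) i j))
      = (\<Sum>i<n. \<Sum>j<n. bin_entropy e - (if i = j then bin_entropy e else 0))"
      by (intro sum.cong refl) (simp add: edge_matrix_def parity_weight_def)
    also have "\<dots> = real n ^ 2 * bin_entropy e - real n * bin_entropy e"
      by (simp add: sum_subtractf power2_eq_square right_diff_distrib)
    finally show ?thesis using that by (simp add: mean_entropy_def field_simps power2_eq_square)
  qed
  show "y \<le> entropy_density e (e ^ 3)"
  proof (rule entropy_density_geI)
    fix \<alpha> :: real assume "0 < \<alpha>"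
    have "\<forall>\<^sub>F n in sequentially. 0 < num_graphs n \<alpha> e (e ^ 3 + 0 ^ 3)
      \<and> mean_entropy n (edge_matrix (parity_weight e 0)) \<le> log_count e (e ^ 3 + 0 ^ 3) \<alpha> n + \<epsilon>"
      by (rule parity_weight_log_count) (use e \<epsilon> \<open>0 < \<alpha>\<close> in auto)
    then have "\<forall>\<^sub>F n in sequentially. ereal y \<le> ereal (log_count e (e ^ 3) \<alpha> n)"
      using lim eventually_gt_at_top[of 0]
    proof eventually_elim
      case (elim n)
      have "mean_entropy n (edge_matrix (parity_weight e 0)) \<le> log_count e (e ^ 3) \<alpha> n + \<epsilon>"
        using elim(1) by simp
      moreover have "bin_entropy e / 2 = y + 2 * \<epsilon>" by (simp add: \<epsilon>_def field_simps)
      ultimately have "y \<le> log_count e (e ^ 3) \<alpha> n"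
        using elim(2) unfolding h_const[OF elim(3)] by linarith
      then show ?case by simp
    qed
    then show "ereal y \<le> lower_rate e (e ^ 3) \<alpha>"
      unfolding lower_rate_def by (rule Liminf_bounded)
  qed
qed

abbreviation densities :: "(real \<times> real) set" where
  "densities \<equiv> (\<Union>n. (\<lambda>E. (edge_density n E, triangle_density n E)) ` simple_graphs n)"

lemma num_graphs_pos_imp_close:
  assumes "0 < num_graphs n \<alpha> e t"
  shows "\<exists>p\<in>densities. dist p (e, t) < 2 * \<alpha>"
proof -
  obtain E where E: "E \<in> simple_graphs n" "\<bar>edge_density n E - e\<bar> < \<alpha>" "\<bar>triangle_density n E - t\<bar> < \<alpha>"
  proof -
    have "{E \<in> simple_graphs n. edge_density n E \<in> {e - \<alpha><..<e + \<alpha>}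
                              \<and> triangle_density n E \<in> {t - \<alpha><..<t + \<alpha>}} \<noteq> {}"
      using assms unfolding num_graphs_def by (metis card.empty less_irrefl)
    then show ?thesis using that by (auto simp: abs_less_iff)
  qed
  have "dist (edge_density n E, triangle_density n E) (e, t) \<le> \<bar>edge_density n E - e\<bar> + \<bar>triangle_density n E - t\<bar>"
    using sqrt_sum_squares_le_sum_abs by (simp add: dist_Pair_Pair dist_real_def)
  also have "\<dots> < 2 * \<alpha>" using E by simp
  finally show ?thesis using E(1) by blast
qed

text \<open>The parameters \<open>c\<close> and \<open>x\<close> of the parity weights sweep out a
  neighbourhood: given a nearby point (c, t), the real cube root solves
  \<open>x ^ 3 = t - c ^ 3\<close> whatever the sign of the right-hand side.\<close>

lemma cube_interior_achievable:
  assumes e: "0 < e" "e < 1"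
  shows "(e, e ^ 3) \<in> interior achievable"
proof -
  \<comment> \<open>Keeps \<open>c + x\<close> and \<open>c - x\<close> in [0, 1] when both
    \<open>x\<close> and \<open>c - e\<close> are smaller than \<open>r\<close> in absolute
    value.\<close>
  define r where "r = min e (1 - e) / 2"
  have r: "0 < r" "2 * r \<le> e" "2 * r \<le> 1 - e" using e by (auto simp: r_def)
  define U where "U = {p. \<bar>fst p - e\<bar> < r \<and> \<bar>snd p - fst p ^ 3\<bar> < r ^ 3}"
  have "open U" unfolding U_def
    by (intro open_Collect_conj open_Collect_less continuous_intros)
  moreover have "U \<subseteq> closure densities"
  proof
    fix p assume p: "p \<in> U"
    obtain c t where pct: "p = (c, t)" by force
    define x where "x = root 3 (t - c ^ 3)"
    have x3: "x ^ 3 = t - c ^ 3" by (simp add: x_def odd_real_root_pow)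
    have "\<bar>x\<bar> ^ 3 < r ^ 3" using p unfolding power_abs[symmetric] x3 by (simp add: U_def pct)
    then have xr: "\<bar>x\<bar> < r" using r(1) power_less_imp_less_base by (metis less_imp_le)
    have cr: "\<bar>c - e\<bar> < r" using p by (simp add: U_def pct)
    have t: "t = c ^ 3 + x ^ 3" using x3 by simp
    show "p \<in> closure densities"
      unfolding closure_approachable
    proof (intro allI impI)
      fix \<epsilon> :: real assume "0 < \<epsilon>"
      then have "\<forall>\<^sub>F n in sequentially. 0 < num_graphs n (\<epsilon> / 2) c (c ^ 3 + x ^ 3)
        \<and> mean_entropy n (edge_matrix (parity_weight c x)) \<le> log_count c (c ^ 3 + x ^ 3) (\<epsilon> / 2) n + 1"
        by (intro parity_weight_log_count) (use xr cr r in linarith)+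
      then obtain n where "0 < num_graphs n (\<epsilon> / 2) c t"
        unfolding t using eventually_happens by force
      from num_graphs_pos_imp_close[OF this] show "\<exists>y\<in>densities. dist y p < \<epsilon>"
        by (simp add: pct)
    qed
  qed
  moreover have "(e, e ^ 3) \<in> U" using r(1) by (simp add: U_def)
  moreover have "U \<subseteq> achievable"
  proof
    fix p assume "p \<in> U"
    \<comment> \<open>Being in the closure is weaker than being an accumulation point; the plane has
      no isolated points, so interior points of the closure are limit points.\<close>
    then have "p \<in> interior (closure densities)"
      using calculation(1,2) interior_maximal by blast
    then have "p islimpt closure densities" by (rule interior_limit_point)
    then show "p \<in> achievable" by (simp add: achievable_def limpt_of_closure)
  qed
  ultimately show ?thesis by (meson interiorI)
qed

text \<open>Each order \<open>n\<close> contributes finitely many density pairs, so infinitely many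
  pairs near an accumulation point must come from unboundedly large orders.\<close>

lemma achievable_imp_frequently_num_graphs_pos:
  assumes "(e, t) \<in> achievable" "0 < \<alpha>"
  shows "\<exists>\<^sub>F n in sequentially. 0 < num_graphs n \<alpha> e t"
proof (rule ccontr)
  assume "\<not> ?thesis"
  then obtain N where N: "num_graphs n \<alpha> e t = 0" if "N \<le> n" for n
    by (auto simp: not_frequently eventually_sequentially)
  define V where "V = {e - \<alpha><..<e + \<alpha>} \<times> {t - \<alpha><..<t + \<alpha>}"
  have "open V" "(e, t) \<in> V" unfolding V_def using assms(2) by (auto intro: open_Times)
  then have inf: "infinite (densities \<inter> V)"
    using assms(1) unfolding achievable_def islimpt_eq_acc_point by (auto simp: Int_commute)
  have "densities \<inter> V \<subseteq> (\<Union>n<N. (\<lambda>E. (edge_density n E, triangle_density n E)) ` simple_graphs n)"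
  proof
    fix p assume "p \<in> densities \<inter> V"
    then obtain n E where p: "p = (edge_density n E, triangle_density n E)" "E \<in> simple_graphs n" "p \<in> V" by auto
    have "n < N"
    proof (rule ccontr)
      assume "\<not> n < N"
      then have "num_graphs n \<alpha> e t = 0" by (intro N) simp
      then have "{E \<in> simple_graphs n. edge_density n E \<in> {e - \<alpha><..<e + \<alpha>}
                              \<and> triangle_density n E \<in> {t - \<alpha><..<t + \<alpha>}} = {}"
        unfolding num_graphs_def using finite_window by simp
      then show False using p by (auto simp: V_def)
    qed
    with p show "p \<in> (\<Union>n<N. (\<lambda>E. (edge_density n E, triangle_density n E)) ` simple_graphs n)" by auto
  qed
  moreover have "finite (\<Union>n<N. (\<lambda>E. (edge_density n E, triangle_density n E)) ` simple_graphs n)"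
    using finite_simple_graphs by auto
  ultimately show False using inf finite_subset by blast
qed

section \<open>Bounds on the entropy density\<close>

text \<open>The edge density is known only up to the window width, so every bound carries an error
  in its distance from \<open>e\<close>. The quadratic gain -2 * d^2 of the tangent bound is halved
  by the normalisation of \<open>mean_entropy\<close>, which leaves \<open>y\<close> with
  coefficient 1.\<close>

lemma hom_deviation_bounds:
  fixes a :: "nat \<Rightarrow> nat \<Rightarrow> real"
  assumes n: "0 < n" and e: "0 < e" "e < 1"
    and a: "\<And>i j. 0 \<le> a i j \<and> a i j \<le> 1" and sym: "\<And>i j. a i j = a j i"
  defines "y \<equiv> (\<Sum>i<n. \<Sum>j<n. (a i j - e)\<^sup>2) / real n ^ 2"
  shows "0 \<le> y"
    and "mean_entropy n a \<le> bin_entropy e / 2 + \<bar>ln (1 - e) - ln e\<bar> * \<bar>hom_edge n a - e\<bar> - y"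
    and "\<bar>hom_tri n a - e ^ 3\<bar> \<le> 3 * \<bar>hom_edge n a - e\<bar> + 4 * y"
    and "e ^ 3 - hom_tri n a \<le> 3 * \<bar>hom_edge n a - e\<bar> + y powr (3/2)"
proof -
  define d where "d i j = a i j - e" for i j
  define N where "N = real n"
  have N: "0 < N" using n by (simp add: N_def)
  define \<kappa> where "\<kappa> = ln (1 - e) - ln e"
  define D1 where "D1 = (\<Sum>i<n. \<Sum>j<n. d i j)"
  define D2 where "D2 = (\<Sum>i<n. \<Sum>j<n. (d i j)\<^sup>2)"
  define Q where "Q = (\<Sum>i<n. (\<Sum>j<n. d i j)\<^sup>2)"
  define Z where "Z = (\<Sum>i<n. \<Sum>j<n. \<Sum>k<n. d i j * d i k * d j k)"
  have dsym: "d i j = d j i" for i j using sym[of i j] by (simp add: d_def)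
  have y: "y = D2 / N ^ 2" by (simp add: y_def D2_def d_def N_def)
  have D2: "0 \<le> D2" by (simp add: D2_def sum_nonneg)
  show y0: "0 \<le> y" using D2 by (simp add: y)
  have he: "hom_edge n a - e = D1 / N ^ 2"
    using n by (simp add: hom_edge_def D1_def d_def N_def sum_subtractf field_simps power2_eq_square)
  have "(\<Sum>i<n. \<Sum>j<n. bin_entropy (a i j)) \<le> (\<Sum>i<n. \<Sum>j<n. bin_entropy e + \<kappa> * d i j - 2 * (d i j)\<^sup>2)"
    unfolding d_def \<kappa>_def by (intro sum_mono bin_entropy_tangent e) (use a in auto)
  also have "\<dots> = N ^ 2 * bin_entropy e + \<kappa> * D1 - 2 * D2"
    by (simp add: sum.distrib sum_subtractf D1_def D2_def N_def power2_eq_square mult.assoc flip: sum_distrib_left)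
  finally have "mean_entropy n a \<le> (N ^ 2 * bin_entropy e + \<kappa> * D1 - 2 * D2) / (2 * N ^ 2)"
    unfolding mean_entropy_def N_def by (intro divide_right_mono) simp_all
  also have "\<dots> = bin_entropy e / 2 + \<kappa> * (hom_edge n a - e) / 2 - y"
    using N by (simp add: he y field_simps)
  also have "\<kappa> * (hom_edge n a - e) / 2 \<le> \<bar>\<kappa>\<bar> * \<bar>hom_edge n a - e\<bar>"
    using abs_ge_self[of "\<kappa> * (hom_edge n a - e)"] abs_ge_zero[of "\<kappa> * (hom_edge n a - e)"]
    unfolding abs_mult[symmetric] by linarith
  finally show "mean_entropy n a \<le> bin_entropy e / 2 + \<bar>ln (1 - e) - ln e\<bar> * \<bar>hom_edge n a - e\<bar> - y"
    by (simp add: \<kappa>_def)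
  have q1: "(\<Sum>i<n. \<Sum>j<n. \<Sum>k<n. d i j * d i k) = Q"
    by (simp add: Q_def power2_eq_square sum_product)
  \<comment> \<open>Each of the three quadratic products has one shared vertex. Reordering the sums
    and the symmetry of \<open>d\<close> move it to the front, where the squared row sums
    appear.\<close>
  have q2: "(\<Sum>i<n. \<Sum>j<n. \<Sum>k<n. d i j * d j k) = Q"
  proof -
    have "(\<Sum>i<n. \<Sum>j<n. \<Sum>k<n. d i j * d j k) = (\<Sum>j<n. \<Sum>i<n. \<Sum>k<n. d i j * d j k)"
      by (rule sum.swap)
    also have "\<dots> = (\<Sum>j<n. \<Sum>i<n. \<Sum>k<n. d j i * d j k)"
      by (intro sum.cong refl) (simp add: dsym)
    finally show ?thesis using q1 by simp
  qed
  have q3: "(\<Sum>i<n. \<Sum>j<n. \<Sum>k<n. d i k * d j k) = Q"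
  proof -
    have "(\<Sum>i<n. \<Sum>j<n. \<Sum>k<n. d i k * d j k) = (\<Sum>i<n. \<Sum>k<n. \<Sum>j<n. d i k * d j k)"
      by (intro sum.cong refl sum.swap)
    also have "\<dots> = (\<Sum>i<n. \<Sum>k<n. \<Sum>j<n. d i k * d k j)"
      by (intro sum.cong refl arg_cong2[where f = "(*)"] dsym)
    finally show ?thesis using q2 by simp
  qed
  have s1: "(\<Sum>i<n. \<Sum>j<n. \<Sum>k<n. d i j) = N * D1" "(\<Sum>i<n. \<Sum>j<n. \<Sum>k<n. d i k) = N * D1"
    "(\<Sum>i<n. \<Sum>j<n. \<Sum>k<n. d j k) = N * D1"
    by (simp_all add: D1_def N_def flip: sum_distrib_left)
  have "a i j * a i k * a j k = e ^ 3 + e\<^sup>2 * (d i j + d i k + d j k)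
      + e * (d i j * d i k + d i j * d j k + d i k * d j k) + d i j * d i k * d j k" for i j k
    unfolding d_def by (simp add: algebra_simps power2_eq_square power3_eq_cube)
  then have "(\<Sum>i<n. \<Sum>j<n. \<Sum>k<n. a i j * a i k * a j k) =
    (\<Sum>i<n. \<Sum>j<n. \<Sum>k<n. e ^ 3)
    + e\<^sup>2 * ((\<Sum>i<n. \<Sum>j<n. \<Sum>k<n. d i j) + (\<Sum>i<n. \<Sum>j<n. \<Sum>k<n. d i k) + (\<Sum>i<n. \<Sum>j<n. \<Sum>k<n. d j k))
    + e * ((\<Sum>i<n. \<Sum>j<n. \<Sum>k<n. d i j * d i k) + (\<Sum>i<n. \<Sum>j<n. \<Sum>k<n. d i j * d j k) + (\<Sum>i<n. \<Sum>j<n. \<Sum>k<n. d i k * d j k))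
    + (\<Sum>i<n. \<Sum>j<n. \<Sum>k<n. d i j * d i k * d j k)"
    by (simp only: sum.distrib sum_distrib_left[symmetric])
  also have "\<dots> = N ^ 3 * e ^ 3 + e\<^sup>2 * (3 * N * D1) + e * (3 * Q) + Z"
    unfolding s1 q1 q2 q3 Z_def[symmetric] by (simp add: N_def power3_eq_cube)
  finally have ht: "hom_tri n a - e ^ 3 = 3 * e\<^sup>2 * (hom_edge n a - e) + 3 * e * (Q / N ^ 3) + Z / N ^ 3"
    unfolding hom_tri_def N_def[symmetric] he using N by (simp add: field_simps power2_eq_square power3_eq_cube)
  have Q0: "0 \<le> Q / N ^ 3" using N by (simp add: Q_def sum_nonneg)
  have "Q \<le> (\<Sum>i<n. N * (\<Sum>j<n. (d i j)\<^sup>2))"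
    unfolding Q_def
  proof (rule sum_mono)
    fix i
    have "(\<Sum>j<n. d i j * 1)\<^sup>2 \<le> (\<Sum>j<n. (d i j)\<^sup>2) * (\<Sum>j<n. 1\<^sup>2)" by (rule Cauchy_Schwarz_ineq_sum)
    then show "(\<Sum>j<n. d i j)\<^sup>2 \<le> N * (\<Sum>j<n. (d i j)\<^sup>2)" by (simp add: N_def mult.commute)
  qed
  also have "\<dots> = N * D2" by (simp add: D2_def sum_distrib_left)
  finally have "Q / N ^ 3 \<le> N * D2 / N ^ 3" using N by (intro divide_right_mono) simp_all
  then have Qy: "Q / N ^ 3 \<le> y" using N by (simp add: y power2_eq_square power3_eq_cube)
  have "(N ^ 2) powr (3/2) = N ^ 3"
    using N by (simp add: powr_powr powr_realpow flip: powr_numeral)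
  then have "y powr (3/2) = D2 powr (3/2) / N ^ 3"
    using N D2 by (simp add: y powr_divide)
  moreover have "\<bar>Z\<bar> / N ^ 3 \<le> D2 powr (3/2) / N ^ 3"
    unfolding Z_def D2_def using N by (intro divide_right_mono abs_triangle_sum_le) simp
  ultimately have Zy: "\<bar>Z / N ^ 3\<bar> \<le> y powr (3/2)" using N by simp
  have y1: "y \<le> 1"
  proof -
    have "D2 \<le> (\<Sum>i<n. \<Sum>j<n. 1)"
      unfolding D2_def
    proof (intro sum_mono)
      fix i j show "(d i j)\<^sup>2 \<le> 1" using a[of i j] e by (simp add: d_def abs_square_le_1 abs_le_iff)
    qed
    then show ?thesis using N by (simp add: y N_def power2_eq_square)
  qed
  \<comment> \<open>As \<open>y \<le> 1\<close>, the cubic term is also at most \<open>y\<close>;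
    with at most \<open>3 * y\<close> from the row sums this accounts for the constant 4.\<close>
  have yp: "y powr (3/2) \<le> y"
    using powr_mono'[of 1 "3/2" y] y0 y1 by simp
  have e1: "\<bar>3 * e\<^sup>2 * (hom_edge n a - e)\<bar> \<le> 3 * \<bar>hom_edge n a - e\<bar>"
  proof -
    have "e\<^sup>2 \<le> 1" using e by (simp add: power_le_one)
    then have "e\<^sup>2 * \<bar>hom_edge n a - e\<bar> \<le> \<bar>hom_edge n a - e\<bar>" by (intro mult_left_le_one_le) auto
    then show ?thesis by (simp add: abs_mult)
  qed
  have e2: "0 \<le> e * (Q / N ^ 3)" "e * (Q / N ^ 3) \<le> y"
  proof -
    show "0 \<le> e * (Q / N ^ 3)" using Q0 e by (intro mult_nonneg_nonneg) auto
    have "e * (Q / N ^ 3) \<le> Q / N ^ 3" using Q0 e by (intro mult_left_le_one_le) auto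
    then show "e * (Q / N ^ 3) \<le> y" using Qy by linarith
  qed
  define u v z where "u = 3 * e\<^sup>2 * (hom_edge n a - e)" and "v = e * (Q / N ^ 3)" and "z = Z / N ^ 3"
  have "hom_tri n a - e ^ 3 = u + 3 * v + z"
    unfolding ht u_def v_def z_def by (simp add: mult.assoc)
  moreover have "u \<le> 3 * \<bar>hom_edge n a - e\<bar>" "- u \<le> 3 * \<bar>hom_edge n a - e\<bar>"
    using e1 unfolding u_def[symmetric] abs_le_iff by auto
  moreover have "z \<le> y powr (3/2)" "- z \<le> y powr (3/2)"
    using Zy unfolding z_def[symmetric] abs_le_iff by auto
  moreover have "0 \<le> v" "v \<le> y" using e2 by (simp_all add: v_def)
  ultimately show "\<bar>hom_tri n a - e ^ 3\<bar> \<le> 3 * \<bar>hom_edge n a - e\<bar> + 4 * y"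
    and "e ^ 3 - hom_tri n a \<le> 3 * \<bar>hom_edge n a - e\<bar> + y powr (3/2)"
    using yp by (auto intro!: abs_leI)
qed

text \<open>Reduces the upper bound to a statement about one real number \<open>y\<close>. The
  matrix has both densities within \<open>2 * \<alpha>\<close> of \<open>e\<close> and
  \<open>t\<close>; since the edge error enters with factor 3, the total slack is
  \<open>6 * \<alpha> + 2 * \<alpha>\<close>. The entropy loses another \<open>\<alpha>\<close> in
  passing to the matrix.\<close>

lemma lower_rate_leI:
  assumes e: "0 < e" "e < 1" and t: "(e, t) \<in> achievable" and \<alpha>: "0 < \<alpha>"
    and B: "\<And>y. 0 \<le> y \<Longrightarrow> \<bar>t - e ^ 3\<bar> \<le> 8 * \<alpha> + 4 * y \<Longrightarrow> e ^ 3 - t \<le> 8 * \<alpha> + y powr (3/2) \<Longrightarrow>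
      bin_entropy e / 2 + (2 * \<bar>ln (1 - e) - ln e\<bar> + 1) * \<alpha> - y \<le> B"
  shows "lower_rate e t \<alpha> \<le> ereal B"
proof (rule ccontr)
  assume "\<not> ?thesis"
  then have "ereal B < liminf (\<lambda>n. ereal (log_count e t \<alpha> n))" by (simp add: lower_rate_def not_le)
  then have "\<forall>\<^sub>F n in sequentially. ereal B < ereal (log_count e t \<alpha> n)" by (rule less_LiminfD)
  from frequently_ex[OF frequently_eventually_conj[OF achievable_imp_frequently_num_graphs_pos[OF t \<alpha>]
        eventually_conj[OF this eventually_conj[OF log_count_le_entropy[OF \<alpha>] eventually_gt_at_top[of 0]]]]]
  obtain n where n: "0 < n" "B < log_count e t \<alpha> n" and
    "\<exists>w. (\<forall>S. 0 \<le> w S \<and> w S \<le> 1) \<and> \<bar>hom_edge n (edge_matrix w) - e\<bar> < \<alpha> + \<alpha>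
      \<and> \<bar>hom_tri n (edge_matrix w) - t\<bar> < \<alpha> + \<alpha> \<and> log_count e t \<alpha> n \<le> mean_entropy n (edge_matrix w) + \<alpha>"
    unfolding less_ereal.simps by blast
  then obtain w where w: "\<forall>S. 0 \<le> w S \<and> w S \<le> 1"
    "\<bar>hom_edge n (edge_matrix w) - e\<bar> < \<alpha> + \<alpha>" "\<bar>hom_tri n (edge_matrix w) - t\<bar> < \<alpha> + \<alpha>"
    "log_count e t \<alpha> n \<le> mean_entropy n (edge_matrix w) + \<alpha>"
    by blast
  define \<kappa> where "\<kappa> = \<bar>ln (1 - e) - ln e\<bar>"
  have a: "0 \<le> edge_matrix w i j \<and> edge_matrix w i j \<le> 1" for i j
    by (rule edge_matrix_bounds) (use w(1) in auto)
  have sym: "edge_matrix w i j = edge_matrix w j i" for i j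
    by (simp add: edge_matrix_def insert_commute)
  define y where "y = (\<Sum>i<n. \<Sum>j<n. (edge_matrix w i j - e)\<^sup>2) / real n ^ 2"
  note D = hom_deviation_bounds[where a = "edge_matrix w", OF n(1) e a sym, folded y_def \<kappa>_def]
  have "\<kappa> * \<bar>hom_edge n (edge_matrix w) - e\<bar> \<le> \<kappa> * (2 * \<alpha>)"
    by (rule mult_left_mono) (use w(2) in \<open>auto simp: \<kappa>_def\<close>)
  moreover have "bin_entropy e / 2 + (2 * \<kappa> + 1) * \<alpha> - y \<le> B"
    unfolding \<kappa>_def
  proof (rule B)
    show "0 \<le> y" by (rule D(1))
    have *: "3 * \<bar>hom_edge n (edge_matrix w) - e\<bar> \<le> 6 * \<alpha>" using w(2) by simp
    have "\<bar>hom_tri n (edge_matrix w) - e ^ 3\<bar> \<le> 6 * \<alpha> + 4 * y"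
      by (rule order.trans[OF D(3)]) (use * in simp)
    then show "\<bar>t - e ^ 3\<bar> \<le> 8 * \<alpha> + 4 * y" using w(3) by linarith
    have "e ^ 3 - hom_tri n (edge_matrix w) \<le> 6 * \<alpha> + y powr (3/2)"
      by (rule order.trans[OF D(4)]) (use * in simp)
    then show "e ^ 3 - t \<le> 8 * \<alpha> + y powr (3/2)" using w(3) by linarith
  qed
  moreover have "(2 * \<kappa> + 1) * \<alpha> = \<kappa> * (2 * \<alpha>) + \<alpha>" by (simp add: algebra_simps)
  ultimately show False using D(2) n(2) w(4) by linarith
qed

lemma entropy_density_linear_bound:
  assumes e: "0 < e" "e < 1" and t: "(e, t) \<in> achievable"
  shows "entropy_density e t \<le> bin_entropy e / 2 - \<bar>t - e ^ 3\<bar> / 4"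
proof -
  define \<kappa> where "\<kappa> = \<bar>ln (1 - e) - ln e\<bar>"
  define g where "g \<alpha> = bin_entropy e / 2 + (2 * \<kappa> + 1) * \<alpha> - (\<bar>t - e ^ 3\<bar> / 4 - 2 * \<alpha>)" for \<alpha>
  show ?thesis
  proof (rule entropy_density_leI)
    show "lower_rate e t \<alpha> \<le> ereal (g \<alpha>)" if "0 < \<alpha>" for \<alpha>
      by (rule lower_rate_leI[OF e t that]) (simp add: g_def \<kappa>_def)
    have "(g \<longlongrightarrow> g 0) (at_right 0)"
      unfolding g_def by (intro tendsto_intros)
    then show "(g \<longlongrightarrow> bin_entropy e / 2 - \<bar>t - e ^ 3\<bar> / 4) (at_right 0)"
      by (simp add: g_def)
  qed
qed

lemma entropy_density_power_bound:
  assumes e: "0 < e" "e < 1" and t: "(e, t) \<in> achievable" "t < e ^ 3"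
  shows "entropy_density e t \<le> bin_entropy e / 2 - (e ^ 3 - t) powr (2/3)"
proof -
  define \<kappa> where "\<kappa> = \<bar>ln (1 - e) - ln e\<bar>"
  \<comment> \<open>The maximum keeps the base of \<open>powr\<close> nonnegative while
    \<open>8 * \<alpha>\<close> exceeds \<open>e ^ 3 - t\<close>; it disappears in the limit because
    \<open>t < e ^ 3\<close>.\<close>
  define g where "g \<alpha> = bin_entropy e / 2 + (2 * \<kappa> + 1) * \<alpha> - max 0 (e ^ 3 - t - 8 * \<alpha>) powr (2/3)" for \<alpha>
  show ?thesis
  proof (rule entropy_density_leI)
    show "lower_rate e t \<alpha> \<le> ereal (g \<alpha>)" if "0 < \<alpha>" for \<alpha>
    proof (rule lower_rate_leI[OF e t(1) that])
      fix y :: real assume y: "0 \<le> y" "e ^ 3 - t \<le> 8 * \<alpha> + y powr (3/2)"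
      then have "max 0 (e ^ 3 - t - 8 * \<alpha>) \<le> y powr (3/2)" by simp
      then have "max 0 (e ^ 3 - t - 8 * \<alpha>) powr (2/3) \<le> (y powr (3/2)) powr (2/3)"
        by (intro powr_mono2) auto
      also have "\<dots> = y" using y(1) by (simp add: powr_powr)
      finally show "bin_entropy e / 2 + (2 * \<bar>ln (1 - e) - ln e\<bar> + 1) * \<alpha> - y \<le> g \<alpha>"
        by (simp add: g_def \<kappa>_def)
    qed
    have "(g \<longlongrightarrow> g 0) (at_right 0)"
      unfolding g_def by (intro tendsto_intros) (use t(2) in auto)
    then show "(g \<longlongrightarrow> bin_entropy e / 2 - (e ^ 3 - t) powr (2/3)) (at_right 0)"
      using t(2) by (simp add: g_def)
  qed
qed

text \<open>The difference quotient is at most \<open>- c\<close> on the right of \<open>x\<close>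
  and at least \<open>c\<close> on the left, so no common limit exists; openness of \<open>T\<close>
  gives access to both sides.\<close>

lemma not_differentiable_at_kink:
  fixes f :: "real \<Rightarrow> real"
  assumes "open T" "x \<in> T" "0 < c" and kink: "\<And>t. t \<in> T \<Longrightarrow> c * \<bar>t - x\<bar> \<le> f x - f t"
  shows "\<not> f differentiable (at x within T)"
proof
  assume "f differentiable (at x within T)"
  then have "f differentiable (at x)" using at_within_open[OF assms(2,1)] by simp
  then obtain D where "DERIV f x :> D" by (auto simp: real_differentiable_def)
  then have D: "((\<lambda>t. (f t - f x) / (t - x)) \<longlongrightarrow> D) (at x)"
    by (simp add: has_field_derivative_iff)
  have T: "\<forall>\<^sub>F t in at x. t \<in> T" using assms(1,2) by (rule eventually_at_in_open')
  have "D \<le> - c"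
  proof (rule tendsto_upperbound)
    show "((\<lambda>t. (f t - f x) / (t - x)) \<longlongrightarrow> D) (at_right x)"
      using D by (rule tendsto_within_subset) simp
    have "\<forall>\<^sub>F t in at_right x. t \<in> T" by (rule filter_leD[OF at_le[OF subset_UNIV] T])
    then show "\<forall>\<^sub>F t in at_right x. (f t - f x) / (t - x) \<le> - c"
      using eventually_at_right_less[of x]
    proof eventually_elim
      case (elim t)
      then show ?case using kink[of t] by (simp add: pos_divide_le_eq)
    qed
  qed simp
  moreover have "c \<le> D"
  proof (rule tendsto_lowerbound)
    show "((\<lambda>t. (f t - f x) / (t - x)) \<longlongrightarrow> D) (at_left x)"
      using D by (rule tendsto_within_subset) simp
    have "\<forall>\<^sub>F t in at_left x. t \<in> T" by (rule filter_leD[OF at_le[OF subset_UNIV] T])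
    moreover have "\<forall>\<^sub>F t in at_left x. t < x" by (simp add: eventually_at_filter)
    ultimately show "\<forall>\<^sub>F t in at_left x. c \<le> (f t - f x) / (t - x)"
    proof eventually_elim
      case (elim t)
      then show ?case using kink[of t] by (simp add: neg_le_divide_eq algebra_simps)
    qed
  qed simp
  ultimately show False using assms(3) by simp
qed

theorem theorem1p1:
  fixes e :: real
  assumes "0 < e" and "e < 1"
  shows
    "(\<exists>c>0. \<forall>t. (e, t) \<in> interior achievable \<longrightarrow>
        entropy_density e (e^3) - entropy_density e t \<ge> c * \<bar>t - e^3\<bar>)
     \<and> ((e, e^3) \<in> interior achievable
        \<and> (\<forall>t. (e, t) \<in> interior achievable \<longrightarrow> entropy_density e t \<le> entropy_density e (e^3))
        \<and> \<not> (\<lambda>t. entropy_density e t) differentiable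
              (at (e^3) within {t. (e, t) \<in> interior achievable}))
     \<and> (\<exists>c'>0. \<forall>t<e^3. (e, t) \<in> interior achievable \<longrightarrow>
        entropy_density e (e^3) - entropy_density e t \<ge> c' * \<bar>t - e^3\<bar> powr (2/3))"
proof -
  define T where "T = {t. (e, t) \<in> interior achievable}"
  have ach: "(e, t) \<in> achievable" if "t \<in> T" for t
    using that interior_subset by (auto simp: T_def)
  have linear: "entropy_density e (e^3) - entropy_density e t \<ge> 1 / 4 * \<bar>t - e^3\<bar>" if "t \<in> T" for t
    \<comment> \<open>The constant 1/4 inverts the bound \<open>4 * y\<close> on the deviation and
      is the same for every \<open>e\<close>; the power bound below even has constant 1.\<close>
    using entropy_density_linear_bound[OF assms ach[OF that]] entropy_density_constant_ge[OF assms] by simp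
  have power: "entropy_density e (e^3) - entropy_density e t \<ge> 1 * \<bar>t - e^3\<bar> powr (2/3)"
    if "t \<in> T" "t < e ^ 3" for t
    using entropy_density_power_bound[OF assms ach[OF that(1)] that(2)] entropy_density_constant_ge[OF assms] that(2)
    by simp
  have max: "entropy_density e t \<le> entropy_density e (e^3)" if "t \<in> T" for t
    using order.trans[OF _ linear[OF that], of 0] by simp
  have mem: "(e, e ^ 3) \<in> interior achievable" by (rule cube_interior_achievable[OF assms])
  have "open T"
  proof -
    have "T = Pair e -` interior achievable" by (auto simp: T_def)
    then show ?thesis by (simp add: open_vimage continuous_on_Pair)
  qed
  then have "\<not> (\<lambda>t. entropy_density e t) differentiable (at (e^3) within T)"
    using mem linear by (intro not_differentiable_at_kink[where c = "1 / 4"]) (auto simp: T_def)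
  moreover have "\<exists>c>0. \<forall>t. (e, t) \<in> interior achievable \<longrightarrow>
        entropy_density e (e^3) - entropy_density e t \<ge> c * \<bar>t - e^3\<bar>"
    using linear unfolding T_def by (intro exI[of _ "1 / 4"]) auto
  moreover have "\<exists>c'>0. \<forall>t<e^3. (e, t) \<in> interior achievable \<longrightarrow>
        entropy_density e (e^3) - entropy_density e t \<ge> c' * \<bar>t - e^3\<bar> powr (2/3)"
    using power unfolding T_def by (intro exI[of _ 1]) auto
  ultimately show ?thesis using max mem unfolding T_def by blast
qed

end
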